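(* Let $d\ge 1$ be an integer and let $\alpha \in (d-1,d]$. There exists a constant $C_6=C_6(\alpha,d)>0$ such that $$\int_{\mathbb{R}^d} |\mathrm{I}_\alpha F| \,d\nu \leq C_6\,\|\nu\|_{\mathcal{M}^{d-\alpha}(\mathbb{R}^d)}\, |F|(\mathbb{R}^d)$$ for all vector measures $F\in M_b(\mathbb{R}^d;\mathbb{R}^d)$ such that $\operatorname{div}F=0$ in the sense of distributions and all non-negative Radon measures $\nu$ on $\mathbb{R}^d$ with $\|\nu\|_{\mathcal{M}^{d-\alpha}(\mathbb{R}^d)}<+\infty$.
   Context: $M_b(\mathbb{R}^d;\mathbb{R}^d)$ is the space of $\mathbb{R}^d$-valued Borel measures on $\mathbb{R}^d$ of bounded total variation, and $|F|$ denotes the total variation measure of $F$. $\operatorname{div}F=0$ means $\int_{\mathbb{R}^d}\nabla\varphi\cdot dF=0$ for all $\varphi\in C_c^\infty(\mathbb{R}^d)$. $\mathrm{I}_\alpha$ denotes the Riesz potential of order $\alpha$, applied componentwise: for $\alpha\in(0,d)$, $\mathrm{I}_\alpha F(x)=c_{d,\alpha}\int_{\mathbb{R}^d}\frac{dF(y)}{|x-y|^{d-\alpha}}$ with the usual normalizing constant $c_{d,\alpha}>0$ (the integral converges absolutely for Lebesgue a.e. $x$). For $\alpha=d$ the kernel $c_{d,\alpha}|x|^{\alpha-d}$ is replaced by the logarithmic kernel $-c_d\log|x|$, $c_d>0$ a dimensional constant. The formula is used at points where the integral converges absolutely, and $\mathrm{I}_\alpha F$ is set to $0$ elsewhere. For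 $\beta\in[0,d]$ and a non-negative Radon measure $\nu$, the Morrey norm is $\|\nu\|_{\mathcal{M}^{\beta}(\mathbb{R}^d)}=\sup_{x\in\mathbb{R}^d,\,r>0}\frac{\nu(B(x,r))}{r^\beta}$ (for $\beta=0$ this is $\nu(\mathbb{R}^d)$). *)

theory Defs
  imports "HOL-Analysis.Analysis"
begin

section \<open>Vector measures\<close>

text \<open>
  A vector measure is a countably additive set function on the Borel sets; its values on sets
  that are not Borel are irrelevant.
\<close>

definition vector_measure :: "('a::topological_space set \<Rightarrow> 'b::real_normed_vector) \<Rightarrow> bool" where
  "vector_measure F \<longleftrightarrow> F {} = 0 \<and>
     (\<forall>A::nat \<Rightarrow> 'a set. range A \<subseteq> sets borel \<longrightarrow> disjoint_family A \<longrightarrow>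
        (\<lambda>i. F (A i)) sums F (\<Union>i. A i))"

definition total_variation ::
  "('a::topological_space set \<Rightarrow> 'b::real_normed_vector) \<Rightarrow> 'a set \<Rightarrow> ennreal" where
  "total_variation F A =
     (SUP E\<in>{E::nat \<Rightarrow> 'a set. range E \<subseteq> sets borel \<and> disjoint_family E \<and> (\<Union>i. E i) = A}.
        \<Sum>i. ennreal (norm (F (E i))))"

definition variation_measure ::
  "('a::topological_space set \<Rightarrow> 'b::real_normed_vector) \<Rightarrow> 'a measure" where
  "variation_measure F = measure_of UNIV (sets borel) (total_variation F)"

text \<open>The positive part of the Jordan decomposition of a finite signed measure.\<close>

definition upper_variation :: "('a::topological_space set \<Rightarrow> real) \<Rightarrow> 'a measure" where
  "upper_variation \<mu> =
     measure_of UNIV (sets borel) (\<lambda>A. SUP B\<in>{B \<in> sets borel. B \<subseteq> A}. ennreal (\<mu> B))"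

definition signed_integral :: "('a::topological_space set \<Rightarrow> real) \<Rightarrow> ('a \<Rightarrow> real) \<Rightarrow> real" where
  "signed_integral \<mu> f =
     integral\<^sup>L (upper_variation \<mu>) f - integral\<^sup>L (upper_variation (\<lambda>A. - \<mu> A)) f"

definition bounded_vector_measures :: "((real^'n) set \<Rightarrow> real^'n) set" where
  "bounded_vector_measures = {F. vector_measure F \<and> total_variation F UNIV < \<infinity>}"

text \<open>
  \<open>measure_of\<close> yields the null measure when its argument is not countably additive. The following
  facts show that this does not happen for the two measures above.
\<close>

lemma ennreal_norm_sums_le:
  fixes x :: "nat \<Rightarrow> 'b::real_normed_vector"
  assumes "x sums s"
  shows "ennreal (norm s) \<le> (\<Sum>i. ennreal (norm (x i)))"
proof -
  have "(\<lambda>n. ennreal (norm (\<Sum>i<n. x i))) \<longlonglongrightarrow> ennreal (norm s)"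
    using assms unfolding sums_def by (intro tendsto_ennrealI tendsto_norm)
  moreover have "ennreal (norm (\<Sum>i<n. x i)) \<le> (\<Sum>i. ennreal (norm (x i)))" for n
  proof -
    have "ennreal (norm (\<Sum>i<n. x i)) \<le> ennreal (\<Sum>i<n. norm (x i))"
      by (intro ennreal_leI norm_sum)
    also have "\<dots> = (\<Sum>i<n. ennreal (norm (x i)))"
      by (rule sum_ennreal[symmetric]) simp
    also have "\<dots> \<le> (\<Sum>i. ennreal (norm (x i)))"
      by (rule sum_le_suminf) auto
    finally show ?thesis .
  qed
  ultimately show ?thesis
    by (intro LIMSEQ_le_const2) blast+
qed

lemma vector_measure_Un:
  assumes F: "vector_measure F" and AB: "A \<in> sets borel" "B \<in> sets borel" "A \<inter> B = {}"
  shows "F (A \<union> B) = F A + F B"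
proof -
  have "range (binaryset A B) \<subseteq> sets borel"
    using AB by (simp add: range_binaryset_eq)
  moreover have "disjoint_family (binaryset A B)"
    using AB(3) by (simp add: disjoint_family_on_def binaryset_def Int_commute)
  ultimately have "(\<lambda>i. F (binaryset A B i)) sums F (\<Union>i. binaryset A B i)"
    using F unfolding vector_measure_def by blast
  moreover have "(\<lambda>i. F (binaryset A B i)) sums (F A + F B)"
    using F by (intro binaryset_sums) (simp add: vector_measure_def)
  ultimately show ?thesis
    by (metis UN_binaryset_eq sums_unique2)
qed

lemma vector_measure_sums_Int:
  assumes F: "vector_measure F" and E: "range E \<subseteq> sets borel" "disjoint_family (E::nat \<Rightarrow> _)"
    and A: "A \<in> sets borel" "A \<subseteq> (\<Union>i. E i)"
  shows "(\<lambda>i. F (A \<inter> E i)) sums F A"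
proof -
  have "range (\<lambda>i. A \<inter> E i) \<subseteq> sets borel" "disjoint_family (\<lambda>i. A \<inter> E i)"
    using E A by (auto simp: disjoint_family_on_def)
  moreover have "(\<Union>i. A \<inter> E i) = A" using A by auto
  ultimately show ?thesis
    using F unfolding vector_measure_def by metis
qed

lemma total_variation_Un_ge:
  fixes A B :: "'a::topological_space set"
  assumes AB: "A \<in> sets borel" "B \<in> sets borel" and disj: "A \<inter> B = {}"
  shows "total_variation F A + total_variation F B \<le> total_variation F (A \<union> B)"
proof -
  let ?P = "\<lambda>A. {E::nat \<Rightarrow> 'a set. range E \<subseteq> sets borel \<and>
                   disjoint_family E \<and> (\<Union>i. E i) = A}"
  let ?s = "\<lambda>E::nat \<Rightarrow> 'a set. \<Sum>i. ennreal (norm (F (E i)))"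
  have le: "?s E + ?s E' \<le> total_variation F (A \<union> B)" if E: "E \<in> ?P A" and E': "E' \<in> ?P B" for E E'
  proof -
    define G where "G = (\<lambda>n. if even n then E (n div 2) else E' (n div 2))"
    have 1: "range G \<subseteq> sets borel" using E E' unfolding G_def by auto
    have 2: "(\<Union>i. G i) = A \<union> B"
    proof -
      have "x \<in> (\<Union>i. G i)" if "x \<in> E i" for x i
        using that by (intro UN_I[of "2*i"]) (auto simp: G_def)
      moreover have "x \<in> (\<Union>i. G i)" if "x \<in> E' i" for x i
        using that by (intro UN_I[of "2*i+1"]) (auto simp: G_def)
      moreover have "(\<Union>i. E i) = A" "(\<Union>i. E' i) = B" using E E' by auto
      ultimately have "A \<union> B \<subseteq> (\<Union>i. G i)" by (metis (no_types, lifting) UN_E Un_iff subsetI)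
      moreover have "(\<Union>i. G i) \<subseteq> A \<union> B" using E E' unfolding G_def by (auto split: if_splits)
      ultimately show ?thesis by blast
    qed
    have 3: "disjoint_family G"
      unfolding disjoint_family_on_def
    proof safe
      fix m n x assume mn: "m \<noteq> n" "x \<in> G m" "x \<in> G n"
      have EA: "E i \<subseteq> A" "E' i \<subseteq> B" for i using E E' by auto
      have same: "even m = even n"
      proof (rule ccontr)
        assume "even m \<noteq> even n"
        then have "x \<in> A \<and> x \<in> B"
          using mn(2,3) EA unfolding G_def by (cases "even m") (auto split: if_splits)
        then show False using disj by auto
      qed
      then have "m div 2 \<noteq> n div 2" using mn(1) by (metis dvd_mult_div_cancel odd_two_times_div_two_succ)
      moreover from this have "E (m div 2) \<inter> E (n div 2) = {}" "E' (m div 2) \<inter> E' (n div 2) = {}"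
        using E E' by (auto simp only: disjoint_family_on_def mem_Collect_eq UNIV_I ball_UNIV simp_thms)
      ultimately show "x \<in> {}"
        using mn same unfolding G_def by (auto split: if_splits)
    qed
    have part: "(\<Sum>i<n. ennreal (norm (F (E i)))) + (\<Sum>i<n. ennreal (norm (F (E' i)))) \<le> ?s G" for n
    proof -
      have "(\<Sum>i<n. ennreal (norm (F (E i)))) + (\<Sum>i<n. ennreal (norm (F (E' i))))
             = (\<Sum>i<2*n. ennreal (norm (F (G i))))"
        by (induction n) (auto simp: G_def algebra_simps)
      also have "\<dots> \<le> ?s G" by (rule sum_le_suminf) auto
      finally show ?thesis .
    qed
    have "(\<lambda>n. (\<Sum>i<n. ennreal (norm (F (E i)))) + (\<Sum>i<n. ennreal (norm (F (E' i)))))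
            \<longlonglongrightarrow> ?s E + ?s E'"
      by (intro tendsto_add summable_LIMSEQ) auto
    then have "?s E + ?s E' \<le> ?s G"
      by (rule LIMSEQ_le_const2) (use part in auto)
    also have "\<dots> \<le> total_variation F (A \<union> B)"
      unfolding total_variation_def by (rule SUP_upper) (use 1 2 3 in auto)
    finally show ?thesis .
  qed
  have "binaryset X {} \<in> ?P X" if "X \<in> sets borel" for X
    using that by (auto simp: range_binaryset_eq UN_binaryset_eq disjoint_family_on_def binaryset_def)
  then have nA: "?P A \<noteq> {}" and nB: "?P B \<noteq> {}"
    using AB(1) AB(2) by (metis (no_types, lifting) empty_iff)+
  have "total_variation F A + total_variation F B
          = (SUP E\<in>?P A. ?s E + total_variation F B)"
    unfolding total_variation_def[of F A] using nA by (rule ennreal_SUP_add_left[symmetric])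
  also have "\<dots> = (SUP E\<in>?P A. SUP E'\<in>?P B. ?s E + ?s E')"
    unfolding total_variation_def[of F B] using nB by (simp add: ennreal_SUP_add_right)
  also have "\<dots> \<le> total_variation F (A \<union> B)"
    by (intro SUP_least le)
  finally show ?thesis .
qed

lemma countably_additive_borelI:
  fixes T :: "'a::topological_space set \<Rightarrow> ennreal"
  assumes sub: "\<And>A. range A \<subseteq> sets borel \<Longrightarrow> disjoint_family (A :: nat \<Rightarrow> _) \<Longrightarrow>
                  T (\<Union>i. A i) \<le> (\<Sum>i. T (A i))"
    and super: "\<And>A B. A \<in> sets borel \<Longrightarrow> B \<in> sets borel \<Longrightarrow> A \<inter> B = {} \<Longrightarrow>
                  T A + T B \<le> T (A \<union> B)"
    and T0: "T {} = 0"
  shows "countably_additive (sets borel) T"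
proof (rule countably_additiveI)
  fix A :: "nat \<Rightarrow> 'a set"
  assume A: "range A \<subseteq> sets borel" "disjoint_family A" "(\<Union>i. A i) \<in> sets borel"
  have mono: "T X \<le> T Y" if "X \<in> sets borel" "Y \<in> sets borel" "X \<subseteq> Y" for X Y
  proof -
    have "T X \<le> T X + T (Y - X)" by simp
    also have "\<dots> \<le> T (X \<union> (Y - X))" using that by (intro super) auto
    also have "X \<union> (Y - X) = Y" using that by auto
    finally show ?thesis .
  qed
  have fin: "(\<Sum>i<n. T (A i)) \<le> T (\<Union>i<n. A i)" for n
  proof (induction n)
    case 0
    then show ?case by (simp add: T0)
  next
    case (Suc n)
    have "(\<Sum>i<Suc n. T (A i)) \<le> T (\<Union>i<n. A i) + T (A n)"
      using Suc by (simp add: add_right_mono)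
    also have "\<dots> \<le> T ((\<Union>i<n. A i) \<union> A n)"
    proof (rule super)
      show "(\<Union>i<n. A i) \<inter> A n = {}"
      proof -
        have "A i \<inter> A n = {}" if "i < n" for i
          using A(2) that by (simp add: disjoint_family_on_def)
        then show ?thesis by auto
      qed
    qed (use A(1) in auto)
    also have "(\<Union>i<n. A i) \<union> A n = (\<Union>i<Suc n. A i)" by (auto simp: lessThan_Suc)
    finally show ?case .
  qed
  have "(\<Sum>i<n. T (A i)) \<le> T (\<Union>i. A i)" for n
    by (rule order_trans[OF fin mono]) (use A in auto)
  then have "(\<Sum>i. T (A i)) \<le> T (\<Union>i. A i)"
    by (intro LIMSEQ_le_const2[OF summable_LIMSEQ]) auto
  then show "(\<Sum>i. T (A i)) = T (\<Union>i. A i)"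
    using sub[OF A(1,2)] by (rule antisym)
qed

lemma emeasure_variation_measure:
  assumes F: "vector_measure F" and A: "A \<in> sets borel"
  shows "emeasure (variation_measure F) A = total_variation F A"
proof -
  have F0: "F {} = 0" using F by (simp add: vector_measure_def)
  have T0: "total_variation F {} = 0"
  proof -
    have "(\<Sum>i. ennreal (norm (F (E i)))) = 0" if "(\<Union>i. E i) = {}" for E :: "nat \<Rightarrow> _"
      using that F0 by simp
    then show ?thesis
      unfolding total_variation_def by (intro antisym SUP_least) auto
  qed
  have ca: "countably_additive (sets borel) (total_variation F)"
  proof (rule countably_additive_borelI)
    fix A :: "nat \<Rightarrow> 'a set"
    assume A: "range A \<subseteq> sets borel" "disjoint_family A"
    show "total_variation F (\<Union>i. A i) \<le> (\<Sum>i. total_variation F (A i))"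
      unfolding total_variation_def[of F "\<Union>i. A i"]
    proof (rule SUP_least)
      fix E :: "nat \<Rightarrow> 'a set"
      assume "E \<in> {E. range E \<subseteq> sets borel \<and> disjoint_family E \<and> (\<Union>i. E i) = (\<Union>i. A i)}"
      then have E: "range E \<subseteq> sets borel" "disjoint_family E" "(\<Union>i. E i) = (\<Union>i. A i)" by auto
      have "(\<Sum>j. ennreal (norm (F (E j)))) \<le> (\<Sum>j. \<Sum>i. ennreal (norm (F (E j \<inter> A i))))"
      proof (intro suminf_le ennreal_norm_sums_le vector_measure_sums_Int[OF F A])
        show "E j \<in> sets borel" "E j \<subseteq> (\<Union>i. A i)" for j using E by auto
      qed auto
      also have "\<dots> = (\<Sum>i. \<Sum>j. ennreal (norm (F (E j \<inter> A i))))"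
        by (subst (1 2) nn_integral_count_space_nat[symmetric]) (simp add: nn_integral_suminf)
      also have "\<dots> \<le> (\<Sum>i. total_variation F (A i))"
      proof (intro suminf_le)
        fix i
        show "(\<Sum>j. ennreal (norm (F (E j \<inter> A i)))) \<le> total_variation F (A i)"
          unfolding total_variation_def
        proof (rule SUP_upper, safe)
          show "E j \<inter> A i \<in> sets borel" for j using E A by auto
          show "disjoint_family (\<lambda>j. E j \<inter> A i)"
            using E(2) unfolding disjoint_family_on_def by blast
          show "x \<in> (\<Union>j. E j \<inter> A i)" if "x \<in> A i" for x using that E(3) by blast
        qed
      qed auto
      finally show "(\<Sum>j. ennreal (norm (F (E j)))) \<le> (\<Sum>i. total_variation F (A i))" .
    qed
  qed (use total_variation_Un_ge T0 in auto)
  show ?thesis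
  proof (rule emeasure_measure_of[OF variation_measure_def])
    show "positive (sets (variation_measure F)) (total_variation F)"
      by (simp add: positive_def T0)
    show "countably_additive (sets (variation_measure F)) (total_variation F)"
      using ca by (simp add: variation_measure_def sets.sets_measure_of_eq[of borel, unfolded space_borel])
    show "A \<in> sets (variation_measure F)"
      using A by (simp add: variation_measure_def sets.sets_measure_of_eq[of borel, unfolded space_borel])
  qed simp
qed

lemma emeasure_upper_variation:
  assumes \<mu>: "vector_measure (\<mu> :: 'a::topological_space set \<Rightarrow> real)" and A: "A \<in> sets borel"
  shows "emeasure (upper_variation \<mu>) A = (SUP B\<in>{B \<in> sets borel. B \<subseteq> A}. ennreal (\<mu> B))"
proof -
  define T where "T A = (SUP B\<in>{B \<in> sets borel. B \<subseteq> A}. ennreal (\<mu> B))" for A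
  have T0: "T {} = 0"
  proof -
    have "{B :: 'a set. B \<in> sets borel \<and> B \<subseteq> {}} = {{}}" by auto
    then show ?thesis using \<mu> by (simp add: T_def vector_measure_def)
  qed
  have upper: "ennreal (\<mu> B) \<le> T A" if "B \<in> sets borel" "B \<subseteq> A" for A B
    unfolding T_def using that by (intro SUP_upper) auto
  have ca: "countably_additive (sets borel) T"
  proof (rule countably_additive_borelI)
    fix A :: "nat \<Rightarrow> 'a set"
    assume A: "range A \<subseteq> sets borel" "disjoint_family A"
    show "T (\<Union>i. A i) \<le> (\<Sum>i. T (A i))"
      unfolding T_def[of "\<Union>i. A i"]
    proof (rule SUP_least)
      fix B assume "B \<in> {B \<in> sets borel. B \<subseteq> (\<Union>i. A i)}"
      then have B: "B \<in> sets borel" "B \<subseteq> (\<Union>i. A i)" by auto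
      have s: "(\<lambda>i. \<mu> (B \<inter> A i)) sums \<mu> B"
        by (rule vector_measure_sums_Int[OF \<mu> A B])
      have "(\<lambda>n. ennreal (\<Sum>i<n. \<mu> (B \<inter> A i))) \<longlonglongrightarrow> ennreal (\<mu> B)"
        using s unfolding sums_def by (rule tendsto_ennrealI)
      moreover have "ennreal (\<Sum>i<n. \<mu> (B \<inter> A i)) \<le> (\<Sum>i. T (A i))" for n
      proof -
        have "ennreal (\<Sum>i<n. \<mu> (B \<inter> A i)) \<le> ennreal (\<Sum>i<n. max 0 (\<mu> (B \<inter> A i)))"
          by (intro ennreal_leI sum_mono) simp
        also have "\<dots> = (\<Sum>i<n. ennreal (max 0 (\<mu> (B \<inter> A i))))"
          by (rule sum_ennreal[symmetric]) simp
        also have "\<dots> \<le> (\<Sum>i<n. T (A i))"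
        proof (rule sum_mono)
          fix i
          have "ennreal (\<mu> (B \<inter> A i)) \<le> T (A i)"
            using A B by (intro upper) auto
          then show "ennreal (max 0 (\<mu> (B \<inter> A i))) \<le> T (A i)"
            by (simp add: max_def ennreal_neg)
        qed
        also have "\<dots> \<le> (\<Sum>i. T (A i))" by (rule sum_le_suminf) auto
        finally show ?thesis .
      qed
      ultimately show "ennreal (\<mu> B) \<le> (\<Sum>i. T (A i))"
        by (intro LIMSEQ_le_const2) blast+
    qed
  next
    fix A B :: "'a set" assume AB: "A \<in> sets borel" "B \<in> sets borel" "A \<inter> B = {}"
    have le: "ennreal (\<mu> X) + ennreal (\<mu> Y) \<le> T (A \<union> B)"
      if X: "X \<in> {X \<in> sets borel. X \<subseteq> A}" and Y: "Y \<in> {Y \<in> sets borel. Y \<subseteq> B}" for X Y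
    proof -
      have 1: "ennreal (\<mu> X) \<le> T (A \<union> B)" "ennreal (\<mu> Y) \<le> T (A \<union> B)"
        using X Y by (auto intro!: upper)
      have 2: "ennreal (\<mu> X + \<mu> Y) \<le> T (A \<union> B)"
        using X Y AB vector_measure_Un[OF \<mu>, of X Y] upper[of "X \<union> Y" "A \<union> B"] by fastforce
      show ?thesis
        using 1 2 by (cases "\<mu> X \<ge> 0"; cases "\<mu> Y \<ge> 0") (auto simp: ennreal_neg)
    qed
    have ne: "{X \<in> sets borel. X \<subseteq> A} \<noteq> {}" "{X \<in> sets borel. X \<subseteq> B} \<noteq> {}" using AB by auto
    have "T A + T B = (SUP X\<in>{X \<in> sets borel. X \<subseteq> A}. ennreal (\<mu> X) + T B)"
      unfolding T_def[of A] using ne(1) by (rule ennreal_SUP_add_left[symmetric])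
    also have "\<dots> = (SUP X\<in>{X \<in> sets borel. X \<subseteq> A}. SUP Y\<in>{Y \<in> sets borel. Y \<subseteq> B}.
                       ennreal (\<mu> X) + ennreal (\<mu> Y))"
      unfolding T_def[of B] using ne(2) by (simp add: ennreal_SUP_add_right)
    also have "\<dots> \<le> T (A \<union> B)" by (intro SUP_least le)
    finally show "T A + T B \<le> T (A \<union> B)" .
  qed (rule T0)
  have "emeasure (upper_variation \<mu>) A = T A"
  proof (rule emeasure_measure_of[of _ UNIV "sets borel"])
    show "upper_variation \<mu> = measure_of UNIV (sets borel) T"
      unfolding upper_variation_def T_def ..
    show "positive (sets (upper_variation \<mu>)) T"
      by (simp add: positive_def T0)
    show "countably_additive (sets (upper_variation \<mu>)) T"
      using ca by (simp add: upper_variation_def sets.sets_measure_of_eq[of borel, unfolded space_borel])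
    show "A \<in> sets (upper_variation \<mu>)"
      using A by (simp add: upper_variation_def sets.sets_measure_of_eq[of borel, unfolded space_borel])
  qed simp
  then show ?thesis by (simp add: T_def)
qed


section \<open>Divergence-free measures\<close>

definition partial_deriv :: "'n \<Rightarrow> (real^'n \<Rightarrow> real) \<Rightarrow> real^'n \<Rightarrow> real" where
  "partial_deriv i f x = frechet_derivative f (at x) (axis i 1)"

primrec C_k :: "nat \<Rightarrow> (real^'n \<Rightarrow> real) \<Rightarrow> bool" where
  "C_k 0 f \<longleftrightarrow> continuous_on UNIV f"
| "C_k (Suc k) f \<longleftrightarrow> f differentiable_on UNIV \<and> (\<forall>i. C_k k (partial_deriv i f))"

definition test_function :: "(real^'n \<Rightarrow> real) \<Rightarrow> bool" where
  "test_function \<phi> \<longleftrightarrow> (\<forall>k. C_k k \<phi>) \<and> compact (closure {x. \<phi> x \<noteq> 0})"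

definition divergence_free :: "((real^'n) set \<Rightarrow> real^'n) \<Rightarrow> bool" where
  "divergence_free F \<longleftrightarrow>
     (\<forall>\<phi>. test_function \<phi> \<longrightarrow> (\<Sum>i\<in>UNIV. signed_integral (\<lambda>A. F A $ i) (partial_deriv i \<phi>)) = 0)"


section \<open>Riesz potentials\<close>

text \<open>
  The parameter \<open>c\<close> is the dimensional constant in front of the logarithmic kernel; it plays no
  role for \<open>\<alpha> < d\<close>. At \<open>z = 0\<close>, where the true kernel is infinite, the value below is a default
  of the library.
\<close>

definition riesz_kernel :: "real \<Rightarrow> real \<Rightarrow> real^'n \<Rightarrow> real" where
  "riesz_kernel c \<alpha> z =
     (let d = real CARD('n) in
      if \<alpha> = d then - c * ln (norm z)
      else Gamma ((d - \<alpha>) / 2) / (pi powr (d / 2) * 2 powr \<alpha> * Gamma (\<alpha> / 2)) *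
             norm z powr (\<alpha> - d))"

text \<open>
  Because the kernel is infinite at the origin, the integral defining the potential at \<open>x\<close> does not
  converge if \<open>F\<close> has an atom at \<open>x\<close>.
\<close>

definition riesz_converges :: "real \<Rightarrow> real \<Rightarrow> ((real^'n) set \<Rightarrow> real^'n) \<Rightarrow> real^'n \<Rightarrow> bool" where
  "riesz_converges c \<alpha> F x \<longleftrightarrow>
     emeasure (variation_measure F) {x} = 0 \<and>
     integrable (variation_measure F) (\<lambda>y. riesz_kernel c \<alpha> (x - y))"

definition riesz_potential ::
  "real \<Rightarrow> real \<Rightarrow> ((real^'n) set \<Rightarrow> real^'n) \<Rightarrow> real^'n \<Rightarrow> real^'n" where
  "riesz_potential c \<alpha> F x =
     (if riesz_converges c \<alpha> F x
      then \<chi> i. signed_integral (\<lambda>A. F A $ i) (\<lambda>y. riesz_kernel c \<alpha> (x - y))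
      else 0)"


section \<open>Radon measures and Morrey norms\<close>

text \<open>On Euclidean space, regularity follows from finiteness on compact sets.\<close>

definition radon_measure :: "(real^'n) measure \<Rightarrow> bool" where
  "radon_measure \<nu> \<longleftrightarrow> sets \<nu> = sets borel \<and> (\<forall>K. compact K \<longrightarrow> emeasure \<nu> K < \<infinity>)"

definition morrey_norm :: "real \<Rightarrow> (real^'n) measure \<Rightarrow> ennreal" where
  "morrey_norm \<beta> \<nu> = (SUP x. SUP r\<in>{0<..}. emeasure \<nu> (ball x r) / ennreal (r powr \<beta>))"

end

theory Submission
  imports Defs "HOL-Computational_Algebra.Polynomial"
begin

text \<open>
  Let \<open>d\<close> be the dimension and \<open>\<beta> = d - \<alpha>\<close>, so that \<open>0 \<le> \<beta> < 1\<close>, and suppose first that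
  \<open>\<beta> > 0\<close>. Consider one component of the potential at a time and let \<open>g\<close> be its sign. By Fubini's
  theorem its \<open>L\<^sup>1(\<nu>)\<close> norm is the integral against \<open>F\<close> of the field \<open>v e\<^sub>i\<close>, where \<open>v(y)\<close> is the
  integral of \<open>g(x) |x - y|\<^bsup>-\<beta>\<^esup>\<close> with respect to \<open>\<nu>\<close>. As \<open>F\<close> annihilates gradients, it suffices
  to find a function \<open>p\<close> such that \<open>v e\<^sub>i - \<nabla>p\<close> is bounded by a multiple of the Morrey norm of \<open>\<nu>\<close>
  (\<open>signed_integral_potential_bound\<close>).

  A field is within \<open>C\<close> of a gradient as soon as its work around every closed loop is at most \<open>C\<close>
  times the length of the loop: the infimum of work plus \<open>C\<close> times length over all paths from a base
  point is then a potential (\<open>exists_potential\<close>). Thus the theorem is reduced to loops. Only finite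
  chains of points are used; the work along an edge is replaced by an antisymmetric expression that
  agrees with it to first order.

  For a loop of length \<open>s\<close> whose arcs are comparable to their chords, the kernel \<open>|x - y|\<^bsup>-\<beta>\<^esup>\<close>
  summed along the loop is at most a multiple of \<open>s\<^bsup>1-\<beta>\<^esup>\<close> for every \<open>x\<close>; this is where \<open>\<beta> < 1\<close>,
  that is, \<open>\<alpha> > d - 1\<close>, enters (\<open>near_bound\<close>). It is used on a ball of radius \<open>2 s\<close>, whose
  \<open>\<nu>\<close>-measure is of order \<open>s\<^bsup>\<beta>\<^esup>\<close>. Outside this ball the cancellation around the loop improves the
  decay in \<open>|x|\<close> by one power (\<open>far_bound\<close>), and the contributions of dyadic shells form a geometric
  series. Altogether the work is of order \<open>s\<close>.

  An arbitrary loop is cut into such loops along chords: as long as there is an arc twice as long as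
  its chord, a minimal one is cut off. Each cut shortens the remaining loop by at least half of the
  length of the arc, so the total length of the pieces stays bounded by a multiple of the length of
  the loop (\<open>closed_chain_bound\<close>).

  For \<open>\<alpha> = d\<close> the kernel is a logarithm and \<open>(y\<^sub>i - x\<^sub>i) log |x - y|\<close> is a potential whose gradient
  differs from the field \<open>log |x - y| e\<^sub>i\<close> by a bounded one, which bounds the Riesz potential at every
  point. In both cases the kernels are first truncated and the truncation is removed in the limit.
\<close>

section \<open>Smooth functions\<close>

lemma partial_deriv_eq:
  assumes "(f has_derivative f') (at x)"
  shows "partial_deriv i f x = f' (axis i 1)"
  using frechet_derivative_at[OF assms] by (simp add: partial_deriv_def)

lemma has_derivative_partial_deriv:
  fixes f :: "real^'n \<Rightarrow> real"
  assumes "f differentiable_on UNIV"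
  shows "(f has_derivative (\<lambda>h. \<Sum>i\<in>UNIV. h $ i * partial_deriv i f x)) (at x)"
proof -
  let ?f' = "frechet_derivative f (at x)"
  have d: "(f has_derivative ?f') (at x)"
    using assms by (simp add: differentiable_on_def frechet_derivative_works)
  then interpret linear ?f' by (rule has_derivative_linear)
  have "?f' h = (\<Sum>i\<in>UNIV. h $ i * partial_deriv i f x)" for h
  proof -
    have "?f' h = ?f' (\<Sum>i\<in>UNIV. h $ i *\<^sub>R axis i 1)"
      by (metis basis_expansion scalar_mult_eq_scaleR)
    then show ?thesis by (simp add: sum scale partial_deriv_def)
  qed
  then have "?f' = (\<lambda>h. \<Sum>i\<in>UNIV. h $ i * partial_deriv i f x)" by (rule ext)
  with d show ?thesis by simp
qed

lemma C_k_continuous_on: "C_k k f \<Longrightarrow> continuous_on UNIV f"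
  by (cases k) (auto intro: differentiable_imp_continuous_on)

lemma C_k_SucD: "C_k (Suc k) f \<Longrightarrow> C_k k f"
  by (induction k arbitrary: f) (auto intro: differentiable_imp_continuous_on)

text \<open>
  Total derivatives come out of the calculus rules in coordinates; reading off the coefficients
  gives the partial derivatives that the definition of \<open>C_k\<close> asks for.
\<close>

lemma C_k_SucI:
  assumes "\<And>x. (f has_derivative (\<lambda>h. \<Sum>i\<in>UNIV. h $ i * f' i x)) (at x)"
    and "\<And>i. C_k k (f' i)"
  shows "C_k (Suc k) f"
proof -
  have "partial_deriv i f = f' i" for i
  proof
    show "partial_deriv i f x = f' i x" for x
      using partial_deriv_eq[OF assms(1), of i x]
      by (simp add: axis_def if_distrib[of "\<lambda>z. z * _"] cong: if_cong)
  qed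
  then show ?thesis
    using assms by (auto simp: differentiable_on_def differentiable_def)
qed

lemma C_k_const: "C_k k (\<lambda>x. c)"
proof (induction k arbitrary: c)
  case (Suc k)
  show ?case
    by (rule C_k_SucI[where f' = "\<lambda>i x. 0"]) (auto intro: Suc)
qed simp

lemma C_k_add: "C_k k f \<Longrightarrow> C_k k g \<Longrightarrow> C_k k (\<lambda>x. f x + g x)"
proof (induction k arbitrary: f g)
  case (Suc k)
  then have "f differentiable_on UNIV" "g differentiable_on UNIV" by auto
  from has_derivative_add[OF this[THEN has_derivative_partial_deriv]] show ?case
    by (intro C_k_SucI[where f' = "\<lambda>i x. partial_deriv i f x + partial_deriv i g x"])
       (use Suc in \<open>auto simp: algebra_simps sum.distrib\<close>)
qed (auto intro!: continuous_intros)

lemma C_k_mult: "C_k k f \<Longrightarrow> C_k k g \<Longrightarrow> C_k k (\<lambda>x. f x * g x)"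
proof (induction k arbitrary: f g)
  case (Suc k)
  then have d: "f differentiable_on UNIV" "g differentiable_on UNIV" by auto
  have "C_k k f" "C_k k g" using Suc.prems by (auto dest: C_k_SucD simp del: C_k.simps)
  then have "C_k k (\<lambda>x. f x * partial_deriv i g x + partial_deriv i f x * g x)" for i
    using Suc by (intro C_k_add) auto
  with has_derivative_mult[OF d[THEN has_derivative_partial_deriv]] show ?case
    by (intro C_k_SucI[where f' = "\<lambda>i x. f x * partial_deriv i g x + partial_deriv i f x * g x"])
       (auto simp: algebra_simps sum.distrib sum_distrib_left)
qed (auto intro!: continuous_intros)

lemma C_k_component: "C_k k (\<lambda>x. x $ i)"
proof (cases k)
  case (Suc k')
  show ?thesis unfolding Suc
    by (intro C_k_SucI[where f' = "\<lambda>j x. if j = i then 1 else 0"])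
       (auto intro!: C_k_const has_derivative_eq_rhs[OF bounded_linear.has_derivative[OF bounded_linear_vec_nth has_derivative_ident]]
             simp: if_distrib cong: if_cong)
qed (auto intro!: continuous_intros)

text \<open>
  For \<open>P = 1\<close> this is the classical smooth function \<open>exp (- 1 / t)\<close> extended by zero. Carrying a
  polynomial along makes the family closed under differentiation, so that smoothness is a plain
  induction.
\<close>

definition exp_bump :: "real poly \<Rightarrow> real \<Rightarrow> real" where
  "exp_bump P t = (if t > 0 then poly P (1 / t) * exp (- 1 / t) else 0)"

definition bump_deriv :: "real poly \<Rightarrow> real poly" where
  "bump_deriv P = [:0, 0, 1:] * (P - pderiv P)"

lemma poly_exp_tendsto_0: "((\<lambda>x. poly P x * exp (- x)) \<longlongrightarrow> (0::real)) at_top"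
proof (induction P)
  case (pCons a P)
  have "((\<lambda>x. poly P x * exp (- x)) \<longlongrightarrow> 0) at_top" by (rule pCons)
  have "((\<lambda>x::real. \<Sum>i\<le>degree P. coeff P i * (x ^ Suc i / exp x)) \<longlongrightarrow> (\<Sum>i\<le>degree P. coeff P i * 0)) at_top"
    by (intro tendsto_intros tendsto_power_div_exp_0)
  moreover have "((\<lambda>x::real. a * (x ^ 0 / exp x)) \<longlongrightarrow> a * 0) at_top"
    by (intro tendsto_intros tendsto_power_div_exp_0)
  ultimately have "((\<lambda>x::real. a * (x ^ 0 / exp x) + (\<Sum>i\<le>degree P. coeff P i * (x ^ Suc i / exp x)))
      \<longlongrightarrow> a * 0 + (\<Sum>i\<le>degree P. coeff P i * 0)) at_top"
    by (rule tendsto_add[rotated])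
  moreover have "a * (x ^ 0 / exp x) + (\<Sum>i\<le>degree P. coeff P i * (x ^ Suc i / exp x))
      = poly (pCons a P) x * exp (- x)" for x :: real
    by (simp add: poly_altdef[of P] exp_minus field_simps sum_distrib_left sum_divide_distrib)
  ultimately show ?case by simp
qed simp

text \<open>
  The only critical point is \<open>0\<close>, where the difference quotient from the right is again of the form
  \<open>Q s * exp (- s)\<close> with \<open>s = 1 / t\<close>, and the exponential beats every polynomial.
\<close>

lemma exp_bump_has_derivative:
  "(exp_bump P has_real_derivative exp_bump (bump_deriv P) t) (at t)"
proof (cases t "0::real" rule: linorder_cases)
  case less
  have "((\<lambda>t. 0) has_real_derivative 0) (at t)" by simp
  then have "(exp_bump P has_real_derivative 0) (at t)"
  proof (rule has_field_derivative_transform_within_open)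
    show "open {..<0::real}" by simp
  qed (use less in \<open>auto simp: exp_bump_def\<close>)
  then show ?thesis using less by (simp add: exp_bump_def)
next
  case greater
  have "((\<lambda>t. poly P (1 / t) * exp (- 1 / t)) has_real_derivative exp_bump (bump_deriv P) t) (at t)"
    using greater
    by (auto intro!: derivative_eq_intros simp: exp_bump_def bump_deriv_def power2_eq_square field_simps)
  then show ?thesis
  proof (rule has_field_derivative_transform_within_open)
    show "open {0::real<..}" by simp
  qed (use greater in \<open>auto simp: exp_bump_def\<close>)
next
  case equal
  have "((\<lambda>h. exp_bump P h / h) \<longlongrightarrow> 0) (at 0)"
  proof (rule filterlim_split_at)
    have "eventually (\<lambda>h::real. 0 = exp_bump P h / h) (at_left 0)"
      by (rule eventually_at_leftI[of "-1"]) (auto simp: exp_bump_def)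
    then show "((\<lambda>h. exp_bump P h / h) \<longlongrightarrow> 0) (at_left 0)"
      by (rule Lim_transform_eventually[OF tendsto_const])
    have "((\<lambda>h. poly ([:0,1:] * P) (inverse h) * exp (- inverse h)) \<longlongrightarrow> 0) (at_right (0::real))"
      by (rule filterlim_compose[OF poly_exp_tendsto_0 filterlim_inverse_at_top_right])
    then show "((\<lambda>h. exp_bump P h / h) \<longlongrightarrow> 0) (at_right 0)"
      by (rule Lim_transform_eventually)
         (auto simp: exp_bump_def field_simps intro!: eventually_at_rightI[of _ 1])
  qed
  then show ?thesis
    using equal by (simp add: has_field_derivative_iff) (simp add: exp_bump_def)
qed

lemma exp_bump_continuous_on: "continuous_on A (exp_bump P)"
  by (meson DERIV_continuous_on exp_bump_has_derivative has_field_derivative_at_within)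

lemma exp_bump_quadratic_has_derivative:
  "((\<lambda>x::real^'n. exp_bump P (c + s * (x \<bullet> x))) has_derivative
     (\<lambda>h. \<Sum>i\<in>UNIV. h $ i * (exp_bump (bump_deriv P) (c + s * (x \<bullet> x)) * (2 * s * x $ i)))) (at x)"
proof -
  have 1: "((\<lambda>x::real^'n. c + s * (x \<bullet> x)) has_derivative (\<lambda>h. s * (2 * (x \<bullet> h)))) (at x)"
    by (auto intro!: derivative_eq_intros simp: inner_commute)
  have "((\<lambda>x::real^'n. exp_bump P (c + s * (x \<bullet> x))) has_derivative
     (\<lambda>h. s * (2 * (x \<bullet> h)) * exp_bump (bump_deriv P) (c + s * (x \<bullet> x)))) (at x)"
    using has_derivative_compose[OF 1 exp_bump_has_derivative[unfolded has_field_derivative_def]]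
    by (simp add: mult.commute)
  then show ?thesis
    by (simp add: inner_vec_def sum_distrib_left sum_distrib_right mult_ac)
qed

lemma C_k_exp_bump_quadratic: "C_k k (\<lambda>x::real^'n. exp_bump P (c + s * (x \<bullet> x)))"
proof (induction k arbitrary: P)
  case 0
  show ?case
    using exp_bump_continuous_on[of UNIV P] by (auto intro!: continuous_intros continuous_on_compose2[of UNIV "exp_bump P"])
next
  case (Suc k)
  show ?case
    by (rule C_k_SucI[OF exp_bump_quadratic_has_derivative])
       (intro C_k_mult C_k_const C_k_component Suc)
qed

text \<open>
  Differentiation under the integral sign puts all derivatives on \<open>\<rho>\<close>. The integral is over a fixed
  box rather than the whole space: for compactly supported \<open>\<rho>\<close> and \<open>y\<close> well inside the box this is
  the usual convolution, and continuity of \<open>p\<close> makes the integral exist.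
\<close>

lemma C_k_integral_translate:
  fixes p \<rho> :: "real^'n \<Rightarrow> real"
  assumes p: "continuous_on UNIV p" and \<rho>: "\<And>k. C_k k \<rho>"
  shows "C_k k (\<lambda>y. integral (cbox a b) (\<lambda>z. p z * \<rho> (z - y)))"
    and "((\<lambda>y. integral (cbox a b) (\<lambda>z. p z * \<rho> (z - y))) has_derivative
           (\<lambda>h. \<Sum>i\<in>UNIV. h $ i * integral (cbox a b) (\<lambda>z. p z * - partial_deriv i \<rho> (z - x)))) (at x)"
proof -
  have der: "((\<lambda>y. integral (cbox a b) (\<lambda>z. p z * \<rho> (z - y))) has_derivative
           (\<lambda>h. \<Sum>i\<in>UNIV. h $ i * integral (cbox a b) (\<lambda>z. p z * - partial_deriv i \<rho> (z - x)))) (at x)"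
    if \<rho>: "\<And>k. C_k k \<rho>" for \<rho> :: "real^'n \<Rightarrow> real" and x
  proof -
    have d: "\<rho> differentiable_on UNIV" using \<rho>[of "Suc 0"] by simp
    have c: "continuous_on A (\<lambda>x. partial_deriv i \<rho> (f x))" if "continuous_on A f"
      for i A and f :: "(real^'n) \<times> (real^'n) \<Rightarrow> _"
      using \<rho>[of "Suc 0"] that by (auto intro: continuous_on_compose2[of UNIV])
    have c': "continuous_on A (\<lambda>x. partial_deriv i \<rho> (f x))" if "continuous_on A f"
      for i A and f :: "(real^'n) \<Rightarrow> _"
      using \<rho>[of "Suc 0"] that by (auto intro: continuous_on_compose2[of UNIV])
    have cr: "continuous_on A (\<lambda>x. \<rho> (f x))" if "continuous_on A f"
      for A and f :: "(real^'n) \<Rightarrow> _"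
      using \<rho>[of 0] that by (auto intro: continuous_on_compose2[of UNIV])
    have cp: "continuous_on A (\<lambda>x. p (f x))" if "continuous_on A f"
      for A and f :: "_::topological_space \<Rightarrow> _"
      using p that by (auto intro: continuous_on_compose2[of UNIV])
    have cp': "continuous_on A p" for A using p continuous_on_subset by blast
    define fx :: "real^'n \<Rightarrow> real^'n \<Rightarrow> (real^'n) \<Rightarrow>\<^sub>L real" where
      "fx = (\<lambda>y z. \<Sum>i\<in>UNIV. (p z * - partial_deriv i \<rho> (z - y)) *\<^sub>R blinfun_inner_right (axis i 1))"
    have fx: "blinfun_apply (fx y z) h = (\<Sum>i\<in>UNIV. h $ i * (p z * - partial_deriv i \<rho> (z - y)))" for y z h
      by (auto simp: fx_def blinfun.sum_left blinfun.scaleR_left blinfun.minus_left inner_axis' mult_ac intro!: sum.cong)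
    have cfx: "continuous_on A (\<lambda>z. fx y z)" for y A
      unfolding fx_def by (intro continuous_intros c' cp')
    have "((\<lambda>y. integral (cbox a b) (\<lambda>z. p z * \<rho> (z - y))) has_derivative
        blinfun_apply (integral (cbox a b) (fx x))) (at x within UNIV)"
    proof (rule leibniz_rule)
      fix y z :: "real^'n"
      have "((\<lambda>y. z - y) has_derivative uminus) (at y)"
        by (auto intro!: derivative_eq_intros)
      from has_derivative_compose[OF this has_derivative_partial_deriv[OF d], THEN has_derivative_mult_right, of "p z"]
      show "((\<lambda>y. p z * \<rho> (z - y)) has_derivative blinfun_apply (fx y z)) (at y within UNIV)"
        by (simp add: fx[abs_def] sum_distrib_left sum_negf mult_ac)
    next
      show "(\<lambda>z. p z * \<rho> (z - y)) integrable_on cbox a b" for y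
        by (intro integrable_continuous continuous_intros cr cp')
      show "continuous_on (UNIV \<times> cbox a b) (\<lambda>(x, t). fx x t)"
        unfolding fx_def case_prod_unfold by (intro continuous_intros c cp)
    qed auto
    moreover have "blinfun_apply (integral (cbox a b) (fx x)) h =
        (\<Sum>i\<in>UNIV. h $ i * integral (cbox a b) (\<lambda>z. p z * - partial_deriv i \<rho> (z - x)))" for h
    proof -
      have "blinfun_apply (integral (cbox a b) (fx x)) h = integral (cbox a b) (\<lambda>z. blinfun_apply (fx x z) h)"
        by (intro blinfun_apply_integral integrable_continuous cfx)
      also have "\<dots> = (\<Sum>i\<in>UNIV. integral (cbox a b) (\<lambda>z. h $ i * (p z * - partial_deriv i \<rho> (z - x))))"
        unfolding fx by (intro integral_sum) (auto intro!: integrable_continuous continuous_intros c' cp')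
      finally show ?thesis by simp
    qed
    then have "blinfun_apply (integral (cbox a b) (fx x)) = (\<lambda>h. \<Sum>i\<in>UNIV. h $ i *
        integral (cbox a b) (\<lambda>z. p z * - partial_deriv i \<rho> (z - x)))" by (rule ext)
    ultimately show ?thesis by simp
  qed
  show "((\<lambda>y. integral (cbox a b) (\<lambda>z. p z * \<rho> (z - y))) has_derivative
           (\<lambda>h. \<Sum>i\<in>UNIV. h $ i * integral (cbox a b) (\<lambda>z. p z * - partial_deriv i \<rho> (z - x)))) (at x)"
    by (rule der[OF \<rho>])
  show "C_k k (\<lambda>y. integral (cbox a b) (\<lambda>z. p z * \<rho> (z - y)))"
    using \<rho>
  proof (induction k arbitrary: \<rho>)
    case 0
    show ?case
      using has_derivative_continuous[OF der[OF 0]]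
      by (simp add: continuous_on_eq_continuous_within)
  next
    case (Suc k)
    show ?case
    proof (rule C_k_SucI[OF der[OF Suc.prems]])
      fix i
      have "C_k j (\<lambda>x. - 1 * partial_deriv i \<rho> x)" for j
        using Suc.prems[of "Suc j"] by (intro C_k_mult C_k_const) simp
      from Suc.IH[OF this]
      show "C_k k (\<lambda>x. integral (cbox a b) (\<lambda>z. p z * - partial_deriv i \<rho> (z - x)))" by simp
    qed
  qed
qed

section \<open>Integration against the components of a vector measure\<close>

lemma sum_axis_mult: "(\<Sum>k\<in>UNIV. axis j 1 $ k * c k) = (c j :: real)"
  by (simp add: axis_def if_distrib[of "\<lambda>z. z * _"] cong: if_cong)

lemma sets_variation_measure [measurable_cong, simp]: "sets (variation_measure F) = sets borel"
  by (simp add: variation_measure_def sets.sets_measure_of_eq[of borel, unfolded space_borel])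

lemma space_variation_measure [simp]: "space (variation_measure F) = UNIV"
  by (simp add: variation_measure_def space_measure_of_conv)

lemma sets_upper_variation [measurable_cong, simp]: "sets (upper_variation \<mu>) = sets borel"
  by (simp add: upper_variation_def sets.sets_measure_of_eq[of borel, unfolded space_borel])

lemma space_upper_variation [simp]: "space (upper_variation \<mu>) = UNIV"
  by (simp add: upper_variation_def space_measure_of_conv)

lemma finite_measure_variation:
  assumes "F \<in> bounded_vector_measures"
  shows "finite_measure (variation_measure F)"
proof (rule finite_measureI)
  have "vector_measure F" "total_variation F UNIV < \<infinity>"
    using assms unfolding bounded_vector_measures_def by blast+
  then show "emeasure (variation_measure F) (space (variation_measure F)) \<noteq> \<infinity>"
    by (simp add: emeasure_variation_measure)
qed

lemma norm_le_total_variation: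
  assumes F: "vector_measure F" and B: "B \<in> sets borel"
  shows "ennreal (norm (F B)) \<le> total_variation F B"
proof -
  have "(\<Sum>i. ennreal (norm (F (binaryset B {} i)))) = ennreal (norm (F B))"
  proof -
    have "F {} = 0" using F unfolding vector_measure_def by blast
    then show ?thesis by (subst suminf_binaryset_eq) simp_all
  qed
  moreover have "(\<Sum>i. ennreal (norm (F (binaryset B {} i)))) \<le> total_variation F B"
    unfolding total_variation_def
  proof (rule SUP_upper, safe)
    show "binaryset B {} n \<in> sets borel" for n using B by (simp add: binaryset_def)
    show "disjoint_family (binaryset B {})" by (simp add: disjoint_family_on_def binaryset_def)
  qed (auto simp: binaryset_def split: if_splits)
  ultimately show ?thesis by simp
qed

text \<open>
  Applied to a coordinate and to its negative, this says that both parts of the Jordan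
  decomposition of each component of \<open>F\<close> are dominated by \<open>|F|\<close>.
\<close>

lemma upper_variation_le_variation_measure:
  fixes F :: "(real^'n) set \<Rightarrow> real^'n"
  assumes F: "vector_measure F" and s: "\<And>x. \<bar>s x\<bar> \<le> norm x" "bounded_linear s"
  shows "upper_variation (\<lambda>A. s (F A)) \<le> variation_measure F"
proof -
  have \<mu>: "vector_measure (\<lambda>A. s (F A))"
    unfolding vector_measure_def
  proof (intro conjI allI impI)
    show "s (F {}) = 0"
      using F linear_0[OF bounded_linear.linear[OF s(2)]] unfolding vector_measure_def by metis
    show "(\<lambda>i. s (F (A i))) sums s (F (\<Union>i. A i))"
      if "range A \<subseteq> sets borel" "disjoint_family A" for A :: "nat \<Rightarrow> _"
      by (rule bounded_linear.sums[OF s(2)]) (use F that vector_measure_def in blast)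
  qed
  have "emeasure (upper_variation (\<lambda>A. s (F A))) A \<le> emeasure (variation_measure F) A"
    if A: "A \<in> sets borel" for A
    unfolding emeasure_upper_variation[OF \<mu> A]
  proof (rule SUP_least, clarify)
    fix B :: "(real^'n) set" assume B: "B \<in> sets borel" "B \<subseteq> A"
    have "ennreal (s (F B)) \<le> ennreal (norm (F B))"
      using s(1)[of "F B"] by (intro ennreal_leI) simp
    also have "\<dots> \<le> emeasure (variation_measure F) B"
      using norm_le_total_variation[OF F B(1)] by (simp add: emeasure_variation_measure[OF F B(1)])
    also have "\<dots> \<le> emeasure (variation_measure F) A"
      using A B by (intro emeasure_mono) simp_all
    finally show "ennreal (s (F B)) \<le> emeasure (variation_measure F) A" .
  qed
  then show ?thesis by (subst le_measure) simp_all
qed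

locale bounded_vector_measure =
  fixes F :: "(real^'n) set \<Rightarrow> real^'n"
  assumes F: "F \<in> bounded_vector_measures"
begin

abbreviation "V \<equiv> variation_measure F"
abbreviation "pos i \<equiv> upper_variation (\<lambda>A. F A $ i)"
abbreviation "neg i \<equiv> upper_variation (\<lambda>A. - (F A $ i))"
abbreviation "SI i f \<equiv> signed_integral (\<lambda>A. F A $ i) f"

lemma vector_measure_F: "vector_measure F" using F unfolding bounded_vector_measures_def by blast

sublocale finite_measure V by (rule finite_measure_variation[OF F])

lemma pos_le: "pos i \<le> V"
  by (rule upper_variation_le_variation_measure[OF vector_measure_F component_le_norm_cart bounded_linear_vec_nth])

lemma neg_le: "neg i \<le> V"
proof (rule upper_variation_le_variation_measure[OF vector_measure_F])
  show "\<bar>- (x $ i)\<bar> \<le> norm x" for x :: "real^'n" using component_le_norm_cart[of x i] by simp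
  show "bounded_linear (\<lambda>x::real^'n. - (x $ i))" by (rule bounded_linear_minus[OF bounded_linear_vec_nth])
qed

lemma finite_measure_le: "U \<le> V \<Longrightarrow> sets U = sets borel \<Longrightarrow> finite_measure U"
proof (rule finite_measureI)
  assume U: "U \<le> V" "sets U = sets borel"
  have "emeasure U (space U) \<le> emeasure V (space U)"
    by (rule le_measureD3) (use U in simp_all)
  also have "\<dots> < \<infinity>" using emeasure_finite[of "space U"] by (metis infinity_ennreal_def top.not_eq_extremum)
  finally show "emeasure U (space U) \<noteq> \<infinity>" by simp
qed

lemma integral_abs_le:
  fixes f :: "_ \<Rightarrow> real"
  assumes U: "U \<le> V" "sets U = sets borel" and f: "integrable V f"
  shows "integrable U f" "\<bar>integral\<^sup>L U f\<bar> \<le> (\<integral>x. \<bar>f x\<bar> \<partial>V)"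
proof -
  have m[measurable]: "f \<in> borel_measurable borel" using borel_measurable_integrable[OF f] by simp
  have mU: "f \<in> borel_measurable U" using m measurable_cong_sets[OF U(2) refl] by blast
  have le: "(\<integral>\<^sup>+x. ennreal (norm (f x)) \<partial>U) \<le> (\<integral>\<^sup>+x. ennreal (norm (f x)) \<partial>V)"
    using U by (intro nn_integral_mono_measure) simp_all
  then show i: "integrable U f"
    using f mU unfolding integrable_iff_bounded by (auto intro: le_less_trans)
  have "ennreal \<bar>integral\<^sup>L U f\<bar> \<le> (\<integral>\<^sup>+x. ennreal (norm (f x)) \<partial>U)"
    using integral_norm_bound_ennreal[OF i] by simp
  also note le
  also have "(\<integral>\<^sup>+x. ennreal (norm (f x)) \<partial>V) = ennreal (\<integral>x. \<bar>f x\<bar> \<partial>V)"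
    using f by (subst nn_integral_eq_integral) auto
  finally show "\<bar>integral\<^sup>L U f\<bar> \<le> (\<integral>x. \<bar>f x\<bar> \<partial>V)" by (simp add: integral_nonneg)
qed

lemmas pos_abs_le = integral_abs_le[OF pos_le sets_upper_variation]
lemmas neg_abs_le = integral_abs_le[OF neg_le sets_upper_variation]

text \<open>
  The two Jordan parts are estimated separately, hence the factor \<open>2\<close>.
\<close>

lemma abs_signed_integral_le:
  "integrable V f \<Longrightarrow> \<bar>SI i f\<bar> \<le> 2 * (\<integral>x. \<bar>f x\<bar> \<partial>V)"
  using pos_abs_le(2)[of f i] neg_abs_le(2)[of f i] unfolding signed_integral_def by linarith

lemma signed_integral_diff:
  "integrable V f \<Longrightarrow> integrable V g \<Longrightarrow> SI i (\<lambda>x. f x - g x) = SI i f - SI i g"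
  using pos_abs_le(1) neg_abs_le(1) unfolding signed_integral_def by simp

text \<open>
  Pointwise convergence may fail at \<open>x\<close>, where the kernels below are singular, because \<open>F\<close> does not
  charge \<open>x\<close>.
\<close>

lemma signed_integral_tendsto:
  assumes x: "emeasure V {x} = 0" and f: "integrable V f"
    and fn: "\<And>n. fn n \<in> borel_measurable borel"
    and le: "\<And>n y. y \<noteq> x \<Longrightarrow> \<bar>fn n y\<bar> \<le> \<bar>f y\<bar>"
    and lim: "\<And>y. y \<noteq> x \<Longrightarrow> (\<lambda>n. fn n y) \<longlonglongrightarrow> f y"
  shows "(\<lambda>n. SI i (fn n)) \<longlonglongrightarrow> SI i f"
proof -
  have "(\<lambda>n. integral\<^sup>L U (fn n)) \<longlonglongrightarrow> integral\<^sup>L U f" if U: "U \<le> V" "sets U = sets borel" for U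
  proof (rule integral_dominated_convergence)
    have "emeasure U {x} \<le> emeasure V {x}" by (rule le_measureD3) (use U in simp_all)
    then have "{x} \<in> null_sets U" using x U(2) by (simp add: null_sets_def)
    then have ne: "AE y in U. y \<noteq> x" by (rule AE_I'[of "{x}"]) auto
    show "AE y in U. (\<lambda>n. fn n y) \<longlonglongrightarrow> f y" using ne by eventually_elim (rule lim)
    show "AE y in U. norm (fn n y) \<le> \<bar>f y\<bar>" for n using ne by eventually_elim (simp add: le)
    have fU: "integrable U f" by (rule integral_abs_le(1)[OF U f])
    then show "integrable U (\<lambda>y. \<bar>f y\<bar>)" "f \<in> borel_measurable U" by auto
    show "fn n \<in> borel_measurable U" for n
      using fn[of n] measurable_cong_sets[OF U(2) refl] by blast
  qed
  from this[OF pos_le] this[OF neg_le] show ?thesis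
    unfolding signed_integral_def by (intro tendsto_diff) auto
qed

lemma signed_integral_scale: "SI i (\<lambda>y. a * f y) = a * SI i f"
  by (simp add: signed_integral_def right_diff_distrib)

end

section \<open>Mollification and cutoffs\<close>

lemma has_derivative_linear_approx_bound:
  fixes f :: "'a::real_normed_vector \<Rightarrow> real"
  assumes f: "(f has_derivative f') (at y)" and l: "linear l" and r: "0 < r"
    and bound: "\<And>h. norm h < r \<Longrightarrow> \<bar>f (y + h) - f y - l h\<bar> \<le> c * norm h"
  shows "\<bar>f' e - l e\<bar> \<le> c * norm e"
proof -
  interpret f': linear f' using f by (rule has_derivative_linear)
  interpret l: linear l by (rule l)
  have 1: "((\<lambda>t::real. y + t *\<^sub>R e) has_derivative (\<lambda>t. t *\<^sub>R e)) (at 0)"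
    by (auto intro!: derivative_eq_intros)
  have "(f has_derivative f') (at (y + (0::real) *\<^sub>R e))" using f by simp
  from has_derivative_compose[OF 1 this]
  have "((\<lambda>t. f (y + t *\<^sub>R e)) has_derivative (\<lambda>t. f' (t *\<^sub>R e))) (at 0)" .
  moreover have "(\<lambda>t. f' (t *\<^sub>R e)) = (*) (f' e)" by (simp add: f'.scale fun_eq_iff)
  ultimately have "((\<lambda>t. f (y + t *\<^sub>R e)) has_real_derivative f' e) (at 0)"
    by (simp add: has_field_derivative_def)
  then have "((\<lambda>t. (f (y + t *\<^sub>R e) - f y) / t) \<longlongrightarrow> f' e) (at 0)"
    by (simp add: has_field_derivative_iff)
  then have "((\<lambda>t. \<bar>(f (y + t *\<^sub>R e) - f y) / t - l e\<bar>) \<longlongrightarrow> \<bar>f' e - l e\<bar>) (at 0)"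
    by (intro tendsto_intros)
  moreover have "eventually (\<lambda>t. \<bar>(f (y + t *\<^sub>R e) - f y) / t - l e\<bar> \<le> c * norm e) (at 0)"
  proof -
    have "((\<lambda>t. norm (t *\<^sub>R e)) \<longlongrightarrow> norm ((0::real) *\<^sub>R e)) (at 0)" by (intro tendsto_intros)
    then have "eventually (\<lambda>t. norm (t *\<^sub>R e) < r) (at 0)"
      using r by (auto intro: order_tendstoD)
    moreover have "eventually (\<lambda>t::real. t \<noteq> 0) (at 0)" by (simp add: eventually_at_filter)
    ultimately show ?thesis
    proof eventually_elim
      case (elim t)
      have "\<bar>(f (y + t *\<^sub>R e) - f y) / t - l e\<bar> = \<bar>(f (y + t *\<^sub>R e) - f y - l (t *\<^sub>R e)) / t\<bar>"
        using elim by (simp add: l.scale diff_divide_distrib)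
      also have "\<dots> \<le> c * norm (t *\<^sub>R e) / \<bar>t\<bar>"
        unfolding abs_divide by (intro divide_right_mono bound[OF elim(1)]) simp
      also have "\<dots> = c * norm e" using elim by simp
      finally show ?case .
    qed
  qed
  ultimately show ?thesis by (rule tendsto_upperbound) simp
qed

text \<open>
  Mollification. The function \<open>f\<close> averages the translates \<open>p (y + z)\<close> over \<open>|z| < \<delta>\<close>. An increment of
  \<open>f\<close> is the average of increments of \<open>p\<close>, so \<open>f\<close> inherits their deviation \<open>C\<close> from the field
  \<open>v e\<^sub>i\<close>, up to the oscillation \<open>\<kappa>\<close> of \<open>v\<close> at scale \<open>\<delta>\<close>. Passing to the limit in the
  difference quotients transfers this to the partial derivatives.
\<close>

lemma smooth_approximate_potential:
  fixes p v :: "real^'n \<Rightarrow> real"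
  assumes p: "\<And>a b. \<bar>p b - p a\<bar> \<le> L * dist a b"
    and \<delta>: "0 < \<delta>"
    and local: "\<And>a b. dist a b < \<delta> \<Longrightarrow> \<bar>p b - p a - v a * (b - a) $ i\<bar> \<le> C * dist a b"
    and v: "\<And>a b. dist a b < \<delta> \<Longrightarrow> \<bar>v a - v b\<bar> \<le> \<kappa>"
  shows "\<exists>f. (\<forall>k. C_k k f) \<and> (\<forall>y. norm y < R \<longrightarrow> \<bar>f y\<bar> \<le> \<bar>p 0\<bar> + L * (norm y + \<delta>) \<and>
           (\<forall>j. \<bar>partial_deriv j f y - (if j = i then v y else 0)\<bar> \<le> C + \<kappa>))"
proof -
  define \<rho> :: "real^'n \<Rightarrow> real" where "\<rho> z = exp_bump 1 (\<delta>\<^sup>2 + (-1) * (z \<bullet> z))" for z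
  have \<rho>_smooth: "C_k k \<rho>" for k unfolding \<rho>_def by (rule C_k_exp_bump_quadratic)
  have \<rho>_pos: "\<rho> z > 0" if "norm z < \<delta>" for z
  proof -
    have "norm z * norm z < \<delta> * \<delta>" using that \<delta> by (intro mult_strict_mono') auto
    then show ?thesis by (simp add: \<rho>_def exp_bump_def power2_norm_eq_inner[symmetric] power2_eq_square)
  qed
  have \<rho>_0: "\<rho> z = 0" if "\<not> norm z < \<delta>" for z
  proof -
    have "norm z * norm z \<ge> \<delta> * \<delta>" using that \<delta> by (intro mult_mono) auto
    then show ?thesis by (simp add: \<rho>_def exp_bump_def power2_norm_eq_inner[symmetric] power2_eq_square)
  qed
  have \<rho>_nonneg: "\<rho> z \<ge> 0" for z using \<rho>_pos[of z] \<rho>_0[of z] by force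
  have \<rho>_cont: "continuous_on A \<rho>" for A
    using C_k_continuous_on[OF \<rho>_smooth] continuous_on_subset by blast
  have L0: "0 \<le> L" using p[of 0 "axis i 1"] by (simp add: dist_norm)
  have p_cont: "continuous_on A p" for A
  proof -
    have "L-lipschitz_on UNIV p"
    proof (rule lipschitz_onI)
      show "dist (p x) (p y) \<le> L * dist x y" for x y using p[of x y] by (simp add: dist_real_def dist_commute abs_minus_commute)
      show "0 \<le> L" by (rule L0)
    qed
    then show ?thesis using lipschitz_on_continuous_on continuous_on_subset by blast
  qed
  have int: "integrable lborel (\<lambda>z. g z * \<rho> z)" if "continuous_on UNIV g" for g :: "real^'n \<Rightarrow> real"
  proof -
    have "integrable lborel (\<lambda>z. indicator (cball 0 \<delta>) z *\<^sub>R (g z * \<rho> z))"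
      by (intro borel_integrable_compact compact_cball continuous_intros \<rho>_cont continuous_on_subset[OF that]) auto
    moreover have "indicator (cball 0 \<delta>) z *\<^sub>R (g z * \<rho> z) = g z * \<rho> z" for z
      using \<rho>_0[of z] by (auto simp: indicator_def)
    ultimately show ?thesis by (simp only:)
  qed
  have int\<rho>: "integrable lborel \<rho>" using int[of "\<lambda>_. 1"] by simp
  define S where "S = (\<integral>z. \<rho> z \<partial>lborel)"
  have S: "S > 0"
  proof -
    have "S \<noteq> 0"
    proof
      assume "S = 0"
      then have "AE z in lborel. \<rho> z = 0"
        unfolding S_def by (subst (asm) integral_nonneg_eq_0_iff_AE[OF int\<rho>]) (simp_all add: \<rho>_nonneg)
      then have "AE z in lborel. z \<notin> ball (0::real^'n) \<delta>"
        by eventually_elim (use \<rho>_pos in force)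
      then have "ball (0::real^'n) \<delta> \<in> null_sets lborel"
        by (subst AE_iff_null_sets) auto
      then show False using \<delta> open_not_negligible[of "ball (0::real^'n) \<delta>"]
        by (auto simp: negligible_iff_null_sets intro: null_sets_completionI)
    qed
    moreover have "S \<ge> 0" unfolding S_def by (rule Bochner_Integration.integral_nonneg) (rule \<rho>_nonneg)
    ultimately show ?thesis by simp
  qed
  \<comment> \<open>The box contains the translates of the support of \<open>\<rho>\<close> by all points of norm below \<open>R\<close>.\<close>
  obtain a :: "real^'n" where a: "ball 0 (R + \<delta>) \<subseteq> cbox (- a) a"
    using bounded_subset_cbox_symmetric[OF bounded_ball] by blast
  define f where "f y = 1 / S * integral (cbox (- a) a) (\<lambda>z. p z * \<rho> (z - y))" for y
  have f_smooth: "C_k k f" for k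
    unfolding f_def[abs_def] by (intro C_k_mult C_k_const C_k_integral_translate p_cont \<rho>_smooth)
  have pint: "integrable lborel (\<lambda>z. p (y + z) * \<rho> z)" for y
    by (intro int continuous_on_compose2[OF p_cont[of UNIV]] continuous_intros) auto
  have f_eq: "S * f y = (\<integral>z. p (y + z) * \<rho> z \<partial>lborel)" if y: "norm y < R" for y
  proof -
    have c: "continuous_on UNIV (\<lambda>z. p z * \<rho> (z - y))"
      by (intro continuous_intros p_cont continuous_on_compose2[OF \<rho>_cont[of UNIV]]) auto
    have "set_integrable lborel (cbox (- a) a) (\<lambda>z. p z * \<rho> (z - y))"
      unfolding set_integrable_def
      by (intro borel_integrable_compact compact_cbox continuous_on_subset[OF c]) auto
    from set_borel_integral_eq_integral(2)[OF this]
    have "S * f y = (\<integral>z. indicator (cbox (- a) a) z *\<^sub>R (p z * \<rho> (z - y)) \<partial>lborel)"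
      using S by (simp add: f_def set_lebesgue_integral_def)
    also have "\<dots> = (\<integral>z. p z * \<rho> (z - y) \<partial>lborel)"
    proof (intro Bochner_Integration.integral_cong refl)
      fix z
      have "z \<in> cbox (- a) a" if "norm (z - y) < \<delta>"
        using a that y norm_triangle_ineq2[of z y] by (auto simp: subset_iff)
      then show "indicator (cbox (- a) a) z *\<^sub>R (p z * \<rho> (z - y)) = p z * \<rho> (z - y)"
        using \<rho>_0[of "z - y"] by (auto simp: indicator_def)
    qed
    also have "\<dots> = (\<integral>z. p z * \<rho> (z - y) \<partial>distr lborel borel ((+) y))"
      by (simp add: lborel_distr_plus)
    also have "\<dots> = (\<integral>z. p (y + z) * \<rho> z \<partial>lborel)"
      using borel_measurable_continuous_onI[OF c] by (subst integral_distr) auto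
    finally show ?thesis .
  qed
  have avg: "\<bar>\<integral>z. g z * \<rho> z \<partial>lborel\<bar> \<le> c * S"
    if g: "\<And>z. norm z < \<delta> \<Longrightarrow> \<bar>g z\<bar> \<le> c" and i: "integrable lborel (\<lambda>z. g z * \<rho> z)" for g c
  proof -
    have "\<bar>\<integral>z. g z * \<rho> z \<partial>lborel\<bar> \<le> (\<integral>z. \<bar>g z * \<rho> z\<bar> \<partial>lborel)" by (rule integral_abs_bound)
    also have "\<dots> \<le> (\<integral>z. c * \<rho> z \<partial>lborel)"
    proof (rule integral_mono)
      show "\<bar>g z * \<rho> z\<bar> \<le> c * \<rho> z" for z
        using g[of z] \<rho>_nonneg[of z] \<rho>_0[of z] by (cases "norm z < \<delta>") (auto simp: abs_mult intro: mult_right_mono)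
    qed (use i int\<rho> in auto)
    finally show ?thesis by (simp add: S_def)
  qed
  have f_bound: "\<bar>f y\<bar> \<le> \<bar>p 0\<bar> + L * (norm y + \<delta>)" if y: "norm y < R" for y
  proof -
    have "\<bar>S * f y\<bar> \<le> (\<bar>p 0\<bar> + L * (norm y + \<delta>)) * S"
      unfolding f_eq[OF y]
    proof (rule avg[OF _ pint])
      fix z :: "real^'n" assume "norm z < \<delta>"
      then have "L * dist 0 (y + z) \<le> L * (norm y + \<delta>)"
        using norm_triangle_ineq[of y z] L0 by (intro mult_left_mono) auto
      then show "\<bar>p (y + z)\<bar> \<le> \<bar>p 0\<bar> + L * (norm y + \<delta>)" using p[of "y + z" 0] by linarith
    qed
    then show ?thesis using S by (simp add: abs_mult mult.commute)
  qed
  have f_diff: "\<bar>f (y + h) - f y - v y * h $ i\<bar> \<le> (C + \<kappa>) * norm h"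
    if y: "norm y < R" "norm (y + h) < R" and h: "norm h < \<delta>" for y h
  proof -
    have i: "integrable lborel (\<lambda>z. (p (y + h + z) - p (y + z) - v y * h $ i) * \<rho> z)"
      using pint[of "y + h"] pint[of y] int[of "\<lambda>_. v y * h $ i"] by (simp add: left_diff_distrib)
    have "S * (f (y + h) - f y - v y * h $ i) =
        (\<integral>z. p (y + h + z) * \<rho> z \<partial>lborel) - (\<integral>z. p (y + z) * \<rho> z \<partial>lborel) - (\<integral>z. (v y * h $ i) * \<rho> z \<partial>lborel)"
    proof -
      have "(\<integral>z. (v y * h $ i) * \<rho> z \<partial>lborel) = S * (v y * h $ i)" by (simp add: S_def)
      then show ?thesis by (simp only: right_diff_distrib f_eq[OF y(1)] f_eq[OF y(2)])
    qed
    also have "\<dots> = (\<integral>z. (p (y + h + z) - p (y + z) - v y * h $ i) * \<rho> z \<partial>lborel)"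
      using pint[of "y + h"] pint[of y] int[of "\<lambda>_. v y * h $ i"]
      by (simp add: left_diff_distrib)
    finally have eq: "S * (f (y + h) - f y - v y * h $ i) =
        (\<integral>z. (p (y + h + z) - p (y + z) - v y * h $ i) * \<rho> z \<partial>lborel)" .
    have "\<bar>S * (f (y + h) - f y - v y * h $ i)\<bar> \<le> ((C + \<kappa>) * norm h) * S"
      unfolding eq
    proof (rule avg[OF _ i])
      fix z :: "real^'n" assume z: "norm z < \<delta>"
      have "\<bar>p (y + h + z) - p (y + z) - v (y + z) * h $ i\<bar> \<le> C * norm h"
        using local[of "y + z" "y + h + z"] h by (simp add: dist_norm algebra_simps)
      moreover have "\<bar>(v (y + z) - v y) * h $ i\<bar> \<le> \<kappa> * norm h"
        unfolding abs_mult using v[of "y + z" y] z component_le_norm_cart[of h i]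
        by (intro mult_mono) (auto simp: dist_norm)
      ultimately show "\<bar>p (y + h + z) - p (y + z) - v y * h $ i\<bar> \<le> (C + \<kappa>) * norm h"
        by (simp add: left_diff_distrib distrib_right)
    qed
    then show ?thesis using S by (simp add: abs_mult mult.commute)
  qed
  have f_deriv: "\<bar>partial_deriv j f y - (if j = i then v y else 0)\<bar> \<le> C + \<kappa>" if y: "norm y < R" for y j
  proof -
    have "f differentiable_on UNIV" using f_smooth[of "Suc 0"] by simp
    from has_derivative_partial_deriv[OF this, of y]
    have "\<bar>(\<Sum>k\<in>UNIV. axis j 1 $ k * partial_deriv k f y) - v y * axis j 1 $ i\<bar> \<le> (C + \<kappa>) * norm (axis j (1::real))"
    proof (rule has_derivative_linear_approx_bound)
      show "linear (\<lambda>h. v y * h $ i)" by (auto intro!: linearI simp: algebra_simps)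
      show "0 < min \<delta> (R - norm y)" using \<delta> y by simp
      show "\<bar>f (y + h) - f y - v y * h $ i\<bar> \<le> (C + \<kappa>) * norm h" if "norm h < min \<delta> (R - norm y)" for h
        using that y norm_triangle_ineq[of y h] by (intro f_diff) auto
    qed
    moreover have "(\<Sum>k\<in>UNIV. axis j 1 $ k * partial_deriv k f y) = partial_deriv j f y"
      by (rule sum_axis_mult)
    moreover have "axis j 1 $ i = (if j = i then 1 else (0::real))" by (auto simp: axis_def)
    ultimately show ?thesis by (cases "j = i") (simp_all add: norm_axis_1)
  qed
  show ?thesis using f_smooth f_bound f_deriv by blast
qed

lemma exp_bump_bounded_above: "\<exists>D>0. \<forall>t\<le>1. \<bar>exp_bump P t\<bar> \<le> D"
proof -
  have "compact (exp_bump P ` {0..1})"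
    by (intro compact_continuous_image exp_bump_continuous_on) auto
  then have "bounded (exp_bump P ` {0..1})" by (rule compact_imp_bounded)
  then obtain D where "D > 0" "\<forall>t\<in>{0..1}. \<bar>exp_bump P t\<bar> \<le> D"
    unfolding bounded_pos by auto
  moreover have "exp_bump P t = 0" if "t < 0" for t using that by (simp add: exp_bump_def)
  ultimately show ?thesis by (metis abs_zero atLeastAtMost_iff less_le not_le)
qed

text \<open>
  This cutoff is not identically \<open>1\<close> near the origin. It converges to \<open>1\<close> pointwise as \<open>R\<close> grows and
  its gradient is \<open>O(|y| / R\<^sup>2)\<close>, which is enough for dominated convergence and avoids dividing smooth
  functions.
\<close>

definition cutoff :: "real \<Rightarrow> real^'n \<Rightarrow> real" where
  "cutoff R y = exp 1 * exp_bump 1 (1 + (- 1 / R\<^sup>2) * (y \<bullet> y))"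

lemma C_k_cutoff: "C_k k (cutoff R)"
  unfolding cutoff_def[abs_def] by (intro C_k_mult C_k_const C_k_exp_bump_quadratic)

lemma cutoff_bounds: "0 \<le> cutoff R y" "cutoff R y \<le> 1"
proof -
  show "0 \<le> cutoff R y" by (simp add: cutoff_def exp_bump_def)
  let ?t = "1 + (- 1 / R\<^sup>2) * (y \<bullet> y)"
  have "exp 1 * exp (- 1 / t) \<le> 1" if "0 < t" "t \<le> 1" for t :: real
    using that by (simp add: exp_add[symmetric] field_simps)
  moreover have "?t \<le> 1" by simp
  ultimately show "cutoff R y \<le> 1"
    unfolding cutoff_def exp_bump_def by (cases "?t > 0") (simp_all add: algebra_simps)
qed

lemma quadratic_nonpos:
  assumes "0 < R" "R \<le> norm y"
  shows "1 + (- 1 / R\<^sup>2) * (y \<bullet> y) \<le> 0"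
proof -
  have "R\<^sup>2 \<le> y \<bullet> y" using assms by (simp add: power2_norm_eq_inner[symmetric] power_mono)
  then show ?thesis using assms by (simp add: field_simps)
qed

lemma cutoff_eq_0: "0 < R \<Longrightarrow> R \<le> norm y \<Longrightarrow> cutoff R y = 0"
  using quadratic_nonpos[of R y] unfolding cutoff_def exp_bump_def by simp

lemma partial_deriv_cutoff:
  "partial_deriv j (cutoff R) y =
     exp 1 * (exp_bump (bump_deriv 1) (1 + (- 1 / R\<^sup>2) * (y \<bullet> y)) * (2 * (- 1 / R\<^sup>2) * y $ j))"
  unfolding cutoff_def[abs_def]
  by (subst partial_deriv_eq[OF has_derivative_mult_right[OF exp_bump_quadratic_has_derivative]])
     (simp only: sum_axis_mult)

lemma partial_deriv_cutoff_bound: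
  "\<exists>D>0. \<forall>R>0. \<forall>j. \<forall>y::real^'n.
     \<bar>partial_deriv j (cutoff R) y\<bar> \<le> (if norm y < R then D * norm y / R\<^sup>2 else 0)"
proof -
  obtain D where D: "D > 0" "\<And>t. t \<le> 1 \<Longrightarrow> \<bar>exp_bump (bump_deriv 1) t\<bar> \<le> D"
    using exp_bump_bounded_above by blast
  have "\<bar>partial_deriv j (cutoff R) y\<bar> \<le> (if norm y < R then (2 * exp 1 * D) * norm y / R\<^sup>2 else 0)"
    if R: "R > 0" for R j and y :: "real^'n"
  proof (cases "norm y < R")
    case True
    have "\<bar>partial_deriv j (cutoff R) y\<bar> =
        exp 1 * (\<bar>exp_bump (bump_deriv 1) (1 + (- 1 / R\<^sup>2) * (y \<bullet> y))\<bar> * (2 * (1 / R\<^sup>2) * \<bar>y $ j\<bar>))"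
      unfolding partial_deriv_cutoff by (simp add: abs_mult)
    also have "\<dots> \<le> exp 1 * (D * (2 * (1 / R\<^sup>2) * norm y))"
      using D by (intro mult_left_mono mult_mono component_le_norm_cart D(2)) auto
    finally show ?thesis using True by (simp add: field_simps)
  next
    case False
    then show ?thesis
      using quadratic_nonpos[of R y] R unfolding partial_deriv_cutoff exp_bump_def by simp
  qed
  then show ?thesis using D(1) by (intro exI[of _ "2 * exp 1 * D"]) auto
qed

lemma cutoff_tendsto_1: "(\<lambda>n. cutoff (real (Suc n)) y) \<longlonglongrightarrow> 1"
proof -
  have "(\<lambda>n. 1 + (- (1 / real (Suc n) * (1 / real (Suc n)))) * (y \<bullet> y)) \<longlonglongrightarrow> 1 + (- (0 * 0)) * (y \<bullet> y)"
    by (intro tendsto_intros LIMSEQ_Suc[OF lim_1_over_n])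
  then have "(\<lambda>n. exp 1 * exp_bump 1 (1 + (- (1 / real (Suc n) * (1 / real (Suc n)))) * (y \<bullet> y)))
      \<longlonglongrightarrow> exp 1 * exp_bump 1 (1 + (- (0 * 0)) * (y \<bullet> y))"
    by (intro tendsto_mult tendsto_const continuous_on_tendsto_compose[OF exp_bump_continuous_on[of UNIV]]) auto
  then show ?thesis
    by (simp add: cutoff_def power2_eq_square exp_bump_def exp_minus)
qed

lemma test_function_cutoff_mult:
  assumes "0 < R" "\<And>k. C_k k f"
  shows "test_function (\<lambda>y. cutoff R y * f y)"
proof -
  have "{y. cutoff R y * f y \<noteq> 0} \<subseteq> cball 0 R"
    using cutoff_eq_0[OF assms(1)] by (force simp: not_le)
  then have "bounded {y. cutoff R y * f y \<noteq> 0}" using bounded_cball bounded_subset by blast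
  then show ?thesis
    unfolding test_function_def by (simp add: compact_closure C_k_mult C_k_cutoff assms(2))
qed

section \<open>Fields close to gradients\<close>

context bounded_vector_measure
begin

text \<open>
  The duality step. The hypotheses say that the field \<open>v e\<^sub>i\<close> is within \<open>C\<close> of the gradient of a
  merely Lipschitz function \<open>p\<close>. Mollifying \<open>p\<close> and cutting it off gives a test function \<open>\<phi>\<close>; since
  \<open>F\<close> annihilates \<open>\<nabla>\<phi>\<close>, only the difference of the two fields is integrated, and it is at most \<open>C\<close>
  up to an error that the cutoff radius sends to zero.
\<close>

lemma signed_integral_potential_bound:
  fixes p v :: "real^'n \<Rightarrow> real" and B C L \<delta> :: real
  assumes div: "divergence_free F"
    and p: "\<And>a b. \<bar>p b - p a\<bar> \<le> L * dist a b"
    and \<delta>: "0 < \<delta>"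
    and local: "\<And>a b. dist a b < \<delta> \<Longrightarrow> \<bar>p b - p a - v a * (b - a) $ i\<bar> \<le> C * dist a b"
    and v_cont: "uniformly_continuous_on UNIV v" and v_bound: "\<And>a. \<bar>v a\<bar> \<le> B"
  shows "\<bar>SI i v\<bar> \<le> 2 * real CARD('n) * C * measure V UNIV"
proof -
  have L0: "0 \<le> L" using p[of 0 "axis i 1"] by (simp add: dist_norm)
  have C0: "0 \<le> C"
  proof -
    have "dist 0 ((\<delta> / 2) *\<^sub>R axis i (1::real)) = \<delta> / 2" using \<delta> by simp
    then have "\<bar>p ((\<delta> / 2) *\<^sub>R axis i 1) - p 0 - v 0 * ((\<delta> / 2) *\<^sub>R axis i 1 - 0) $ i\<bar> \<le> C * (\<delta> / 2)"
      using local[of 0 "(\<delta> / 2) *\<^sub>R axis i 1"] \<delta> by simp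
    then have "0 \<le> C * (\<delta> / 2)" by (rule order_trans[OF abs_ge_zero])
    then show ?thesis using \<delta> by (simp add: zero_le_mult_iff)
  qed
  obtain D where D: "D > 0" "\<And>R j y. R > 0 \<Longrightarrow>
      \<bar>partial_deriv j (cutoff R) (y::real^'n)\<bar> \<le> (if norm y < R then D * norm y / R\<^sup>2 else 0)"
    using partial_deriv_cutoff_bound by blast
  have bound: "\<bar>SI i v\<bar> \<le> 2 * real CARD('n) * (C + \<kappa>) * measure V UNIV" if \<kappa>: "\<kappa> > 0" for \<kappa>
  proof -
    obtain \<delta>' where \<delta>': "\<delta>' > 0" "\<And>a b. dist a b < \<delta>' \<Longrightarrow> \<bar>v a - v b\<bar> \<le> \<kappa>"
      using v_cont \<kappa> unfolding uniformly_continuous_on_def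
      by (metis UNIV_I dist_commute dist_real_def less_imp_le)
    define \<epsilon> where "\<epsilon> = min \<delta> \<delta>'"
    have \<epsilon>: "\<epsilon> > 0" using \<delta> \<delta>' by (simp add: \<epsilon>_def)
    define K where "K = \<bar>p 0\<bar> + L * \<epsilon>"
    have K0: "K \<ge> 0" using L0 \<epsilon> by (simp add: K_def)
    \<comment> \<open>The error caused by the cutoff: the part of \<open>v\<close> that is cut off, and the product of the
      mollified potential, of at most linear growth, with the gradient of the cutoff. The two
      powers of the radius in that gradient keep the product bounded.\<close>
    define h where "h n y = B * (1 - cutoff (real (Suc n)) y)
        + (if norm y < real (Suc n) then (K + L * norm y) * (D * norm y / (real (Suc n))\<^sup>2) else 0)"
      for n and y :: "real^'n"
    have B0: "0 \<le> B" using v_bound[of 0] by simp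
    have h_meas: "h n \<in> borel_measurable V" for n
    proof -
      have [measurable]: "cutoff (real (Suc n)) \<in> borel_measurable borel"
        by (rule borel_measurable_continuous_onI[OF C_k_continuous_on[OF C_k_cutoff]])
      show ?thesis unfolding h_def[abs_def] by measurable
    qed
    have h_le: "\<bar>h n y\<bar> \<le> B + (K + L) * D" and h_nonneg: "0 \<le> h n y" for n y
    proof -
      have 1: "0 \<le> B * (1 - cutoff (real (Suc n)) y)" "B * (1 - cutoff (real (Suc n)) y) \<le> B * 1"
        using B0 cutoff_bounds[of "real (Suc n)" y] by (auto intro!: mult_left_le mult_nonneg_nonneg simp del: of_nat_Suc)
      let ?R = "real (Suc n)"
      have R: "?R \<ge> 1" by simp
      have 2: "(K + L * norm y) * (D * norm y / ?R\<^sup>2) \<le> (K + L) * D" if y: "norm y < ?R"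
      proof -
        have "K + L * norm y \<le> K * ?R + L * ?R"
          using y K0 L0 mult_left_mono[OF R K0] by (intro add_mono mult_left_mono) auto
        moreover have "D * norm y / ?R\<^sup>2 \<le> D * ?R / ?R\<^sup>2"
          using y D(1) by (intro divide_right_mono mult_left_mono) auto
        ultimately have "(K + L * norm y) * (D * norm y / ?R\<^sup>2) \<le> (K * ?R + L * ?R) * (D * ?R / ?R\<^sup>2)"
          using K0 L0 D(1) by (intro mult_mono) (auto simp del: of_nat_Suc)
        also have "\<dots> = (K + L) * D" by (simp add: power2_eq_square field_simps del: of_nat_Suc)
        finally show ?thesis .
      qed
      have 3: "0 \<le> (K + L * norm y) * (D * norm y / ?R\<^sup>2)" "0 \<le> (K + L) * D"
        using K0 L0 D(1) by (auto simp del: of_nat_Suc)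
      show "0 \<le> h n y" using 1 3 by (auto simp: h_def simp del: of_nat_Suc)
      then show "\<bar>h n y\<bar> \<le> B + (K + L) * D"
        using 1 2 3 by (auto simp: h_def simp del: of_nat_Suc intro!: add_mono)
    qed
    have h_lim: "(\<lambda>n. h n y) \<longlonglongrightarrow> 0" for y
    proof -
      have "(\<lambda>n. B * (1 - cutoff (real (Suc n)) y)
          + (K + L * norm y) * (D * norm y * (1 / real (Suc n) * (1 / real (Suc n)))))
          \<longlonglongrightarrow> B * (1 - 1) + (K + L * norm y) * (D * norm y * (0 * 0))"
        by (intro tendsto_intros cutoff_tendsto_1 LIMSEQ_Suc[OF lim_1_over_n])
      then have "(\<lambda>n. B * (1 - cutoff (real (Suc n)) y)
          + (K + L * norm y) * (D * norm y * (1 / real (Suc n) * (1 / real (Suc n))))) \<longlonglongrightarrow> 0" by simp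
      then show ?thesis
      proof (rule tendsto_sandwich[OF _ _ tendsto_const, rotated 2])
        show "\<forall>\<^sub>F n in sequentially. h n y \<le> B * (1 - cutoff (real (Suc n)) y)
          + (K + L * norm y) * (D * norm y * (1 / real (Suc n) * (1 / real (Suc n))))"
          using K0 L0 D(1) by (intro always_eventually allI) (auto simp: h_def power2_eq_square simp del: of_nat_Suc)
      qed (simp add: h_nonneg)
    qed
    have h_int: "integrable V (h n)" for n
      by (rule integrable_const_bound[of _ "B + (K + L) * D"]) (use h_le h_meas in auto)
    have main: "\<bar>SI i v\<bar> \<le> 2 * real CARD('n) * ((C + \<kappa>) * measure V UNIV + (\<integral>y. h n y \<partial>V))" for n
    proof -
      let ?R = "real (Suc n)"
      have R0: "?R > 0" by simp
      obtain f where f: "\<And>k. C_k k f"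
        "\<And>y. norm y < ?R \<Longrightarrow> \<bar>f y\<bar> \<le> \<bar>p 0\<bar> + L * (norm y + \<epsilon>)"
        "\<And>y j. norm y < ?R \<Longrightarrow> \<bar>partial_deriv j f y - (if j = i then v y else 0)\<bar> \<le> C + \<kappa>"
      proof -
        have "\<exists>f. (\<forall>k. C_k k f) \<and> (\<forall>y. norm y < ?R \<longrightarrow> \<bar>f y\<bar> \<le> \<bar>p 0\<bar> + L * (norm y + \<epsilon>) \<and>
           (\<forall>j. \<bar>partial_deriv j f y - (if j = i then v y else 0)\<bar> \<le> C + \<kappa>))"
          by (rule smooth_approximate_potential[OF p \<epsilon> local \<delta>'(2)]) (auto simp: \<epsilon>_def)
        then show ?thesis using that by blast
      qed
      define \<phi> where "\<phi> y = cutoff ?R y * f y" for y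
      have \<phi>_test: "test_function \<phi>" unfolding \<phi>_def[abs_def] by (rule test_function_cutoff_mult[OF R0 f(1)])
      have pd: "partial_deriv j \<phi> y = cutoff ?R y * partial_deriv j f y + partial_deriv j (cutoff ?R) y * f y" for j y
      proof -
        have "cutoff ?R differentiable_on (UNIV :: (real^'n) set)" "f differentiable_on UNIV"
          using C_k_cutoff[of "Suc 0"] f(1)[of "Suc 0"] by auto
        from has_derivative_mult[OF this[THEN has_derivative_partial_deriv]]
        show ?thesis unfolding \<phi>_def[abs_def] by (subst partial_deriv_eq, assumption) (simp only: sum_axis_mult)
      qed
      have key: "\<bar>(if j = i then v y else 0) - partial_deriv j \<phi> y\<bar> \<le> (C + \<kappa>) + h n y" for j y
      proof -
        let ?c = "cutoff ?R y" and ?u = "if j = i then v y else 0"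
        note c = cutoff_bounds[of ?R y]
        have u: "\<bar>?u\<bar> \<le> B" using v_bound B0 by simp
        show ?thesis
        proof (cases "norm y < ?R")
          case True
          have "?u - partial_deriv j \<phi> y = - ?c * (partial_deriv j f y - ?u) + ?u * (1 - ?c) - partial_deriv j (cutoff ?R) y * f y"
            unfolding pd by (simp add: algebra_simps)
          moreover have "\<bar>- ?c * (partial_deriv j f y - ?u)\<bar> \<le> 1 * (C + \<kappa>)"
            unfolding abs_mult using c by (intro mult_mono f(3) True) auto
          moreover have "\<bar>?u * (1 - ?c)\<bar> \<le> B * (1 - ?c)"
            unfolding abs_mult using c u by (intro mult_mono) auto
          moreover have "\<bar>partial_deriv j (cutoff ?R) y * f y\<bar> \<le> (D * norm y / ?R\<^sup>2) * (K + L * norm y)"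
            unfolding abs_mult
          proof (intro mult_mono)
            show "\<bar>partial_deriv j (cutoff ?R) y\<bar> \<le> D * norm y / ?R\<^sup>2" using D(2)[OF R0, of j y] True by simp
            show "\<bar>f y\<bar> \<le> K + L * norm y" using f(2)[OF True] by (simp add: K_def algebra_simps)
          qed (use D(1) in auto)
          ultimately show ?thesis using True unfolding h_def by (simp add: mult.commute del: of_nat_Suc)
        next
          case False
          have "partial_deriv j \<phi> y = 0"
            using False D(2)[OF R0, of j y] cutoff_eq_0[OF R0, of y] unfolding pd by simp
          moreover have "cutoff ?R y = 0" using False by (intro cutoff_eq_0) auto
          ultimately show ?thesis using False u C0 \<kappa> unfolding h_def by simp
        qed
      qed
      have pd_cont: "continuous_on UNIV (partial_deriv j \<phi>)" for j
        using \<phi>_test by (auto simp: test_function_def dest: spec[of _ "Suc 0"])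
      have v_meas: "v \<in> borel_measurable borel"
        by (rule borel_measurable_continuous_onI[OF uniformly_continuous_imp_continuous[OF v_cont]])
      have u_int: "integrable V (\<lambda>y. if j = i then v y else 0)" for j
        by (rule integrable_const_bound[of _ B]) (use v_meas v_bound B0 in auto)
      have diff_int: "integrable V (\<lambda>y. (if j = i then v y else 0) - partial_deriv j \<phi> y)" for j
      proof (rule integrable_const_bound[of _ "(C + \<kappa>) + (B + (K + L) * D)"])
        show "AE y in V. norm ((if j = i then v y else 0) - partial_deriv j \<phi> y) \<le> (C + \<kappa>) + (B + (K + L) * D)"
        proof (intro always_eventually allI)
          fix y
          have "\<bar>(if j = i then v y else 0) - partial_deriv j \<phi> y\<bar> \<le> (C + \<kappa>) + \<bar>h n y\<bar>"
            using key[of j y] by linarith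
          then show "norm ((if j = i then v y else 0) - partial_deriv j \<phi> y) \<le> (C + \<kappa>) + (B + (K + L) * D)"
            unfolding real_norm_def using h_le[of n y] by linarith
        qed
        show "(\<lambda>y. (if j = i then v y else 0) - partial_deriv j \<phi> y) \<in> borel_measurable V"
          using borel_measurable_continuous_onI[OF pd_cont[of j]] v_meas by measurable
      qed
      have pd_int: "integrable V (partial_deriv j \<phi>)" for j
        using Bochner_Integration.integrable_diff[OF u_int[of j] diff_int[of j]] by simp
      have "SI i v = (\<Sum>j\<in>UNIV. SI j (\<lambda>y. if j = i then v y else 0))"
      proof -
        have "SI j (\<lambda>y. if j = i then v y else 0) = (if j = i then SI i v else 0)" for j
          by (simp add: signed_integral_def)
        then show ?thesis by simp
      qed
      also have "\<dots> = (\<Sum>j\<in>UNIV. SI j (\<lambda>y. if j = i then v y else 0)) - (\<Sum>j\<in>UNIV. SI j (partial_deriv j \<phi>))"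
        using div \<phi>_test by (simp add: divergence_free_def)
      also have "\<dots> = (\<Sum>j\<in>UNIV. SI j (\<lambda>y. (if j = i then v y else 0) - partial_deriv j \<phi> y))"
        by (simp only: sum_subtractf[symmetric] signed_integral_diff[OF u_int pd_int])
      finally have eq: "SI i v = (\<Sum>j\<in>UNIV. SI j (\<lambda>y. (if j = i then v y else 0) - partial_deriv j \<phi> y))" .
      have "\<bar>SI i v\<bar> \<le> (\<Sum>j\<in>UNIV. \<bar>SI j (\<lambda>y. (if j = i then v y else 0) - partial_deriv j \<phi> y)\<bar>)"
        unfolding eq by (rule sum_abs)
      also have "\<dots> \<le> (\<Sum>j\<in>(UNIV::'n set). 2 * ((C + \<kappa>) * measure V UNIV + (\<integral>y. h n y \<partial>V)))"
      proof (rule sum_mono)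
        fix j
        have "\<bar>SI j (\<lambda>y. (if j = i then v y else 0) - partial_deriv j \<phi> y)\<bar>
            \<le> 2 * (\<integral>y. \<bar>(if j = i then v y else 0) - partial_deriv j \<phi> y\<bar> \<partial>V)"
          by (rule abs_signed_integral_le[OF diff_int])
        also have "(\<integral>y. \<bar>(if j = i then v y else 0) - partial_deriv j \<phi> y\<bar> \<partial>V) \<le> (\<integral>y. (C + \<kappa>) + h n y \<partial>V)"
          by (intro integral_mono integrable_abs diff_int Bochner_Integration.integrable_add h_int key) simp_all
        also have "\<dots> = (C + \<kappa>) * measure V UNIV + (\<integral>y. h n y \<partial>V)"
          using h_int[of n] by simp
        finally show "\<bar>SI j (\<lambda>y. (if j = i then v y else 0) - partial_deriv j \<phi> y)\<bar>
           \<le> 2 * ((C + \<kappa>) * measure V UNIV + (\<integral>y. h n y \<partial>V))" by simp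
      qed
      finally show ?thesis by (simp add: algebra_simps)
    qed
    have "(\<lambda>n. \<integral>y. h n y \<partial>V) \<longlonglongrightarrow> (\<integral>y. 0 \<partial>V)"
      by (rule integral_dominated_convergence[of _ _ _ "\<lambda>_. B + (K + L) * D"])
         (use h_meas h_lim h_le in \<open>auto intro!: always_eventually\<close>)
    then have "(\<lambda>n. 2 * real CARD('n) * ((C + \<kappa>) * measure V UNIV + (\<integral>y. h n y \<partial>V)))
        \<longlonglongrightarrow> 2 * real CARD('n) * ((C + \<kappa>) * measure V UNIV + (\<integral>y. 0 \<partial>V))"
      by (intro tendsto_intros)
    then have "\<bar>SI i v\<bar> \<le> 2 * real CARD('n) * ((C + \<kappa>) * measure V UNIV + (\<integral>y. 0 \<partial>V))"
      by (rule LIMSEQ_le_const) (use main in auto)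
    then show ?thesis by simp
  qed
  have "((\<lambda>\<kappa>. 2 * real CARD('n) * (C + \<kappa>) * measure V UNIV) \<longlongrightarrow> 2 * real CARD('n) * (C + 0) * measure V UNIV) (at_right 0)"
    by (intro tendsto_intros)
  then have "\<bar>SI i v\<bar> \<le> 2 * real CARD('n) * (C + 0) * measure V UNIV"
    by (rule tendsto_lowerbound) (use bound in \<open>auto intro!: eventually_at_rightI[of 0 1]\<close>)
  then show ?thesis by simp
qed

end

section \<open>Chains, loops and potentials\<close>

text \<open>
  A polygonal path is represented by the list of its vertices, and \<open>w a b\<close> is the contribution of
  the edge from \<open>a\<close> to \<open>b\<close>.
\<close>

fun chain_sum :: "('a \<Rightarrow> 'a \<Rightarrow> real) \<Rightarrow> 'a list \<Rightarrow> real" where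
  "chain_sum w (a # b # zs) = w a b + chain_sum w (b # zs)"
| "chain_sum w _ = 0"

lemma chain_sum_append: "chain_sum w (xs @ a # ys) = chain_sum w (xs @ [a]) + chain_sum w (a # ys)"
proof (induction xs rule: induct_list012)
  case 1 then show ?case by simp
next
  case (2 x) then show ?case by simp
next
  case (3 x y zs) then show ?case by simp
qed

lemma chain_sum_snoc: "chain_sum w (xs @ [a, b]) = chain_sum w (xs @ [a]) + w a b"
  using chain_sum_append[of w xs a "[b]"] by simp

lemma chain_sum_add: "chain_sum (\<lambda>a b. v a b + w a b) zs = chain_sum v zs + chain_sum w zs"
  by (induction zs rule: induct_list012) auto

lemma chain_sum_scale: "chain_sum (\<lambda>a b. c * w a b) zs = c * chain_sum w zs"
  by (induction zs rule: induct_list012) (auto simp: algebra_simps)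

lemma chain_sum_mono:
  "(\<And>a b. a \<in> set zs \<Longrightarrow> b \<in> set zs \<Longrightarrow> v a b \<le> w a b) \<Longrightarrow> chain_sum v zs \<le> chain_sum w zs"
  by (induction zs rule: induct_list012) (auto intro!: add_mono)

lemma chain_sum_abs: "\<bar>chain_sum w zs\<bar> \<le> chain_sum (\<lambda>a b. \<bar>w a b\<bar>) zs"
  by (induction zs rule: induct_list012) (auto intro: order_trans[OF abs_triangle_ineq])

lemma chain_sum_nonneg: "(\<And>a b. 0 \<le> w a b) \<Longrightarrow> 0 \<le> chain_sum w zs"
  by (induction zs rule: induct_list012) auto

lemma chain_sum_rev:
  assumes "\<And>a b. w b a = w a b"
  shows "chain_sum w (rev zs) = chain_sum w zs"
proof (induction zs rule: induct_list012)
  case (3 x y zs)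
  then show ?case using chain_sum_snoc[of w "rev zs" y x] assms by simp
qed auto

lemma chain_sum_diff:
  "zs \<noteq> [] \<Longrightarrow> chain_sum (\<lambda>a b. h b - h a) zs = h (last zs) - (h (hd zs) :: real)"
  by (induction zs rule: induct_list012) auto

abbreviation chain_length :: "'a::metric_space list \<Rightarrow> real" where
  "chain_length \<equiv> chain_sum dist"

lemma dist_le_chain_length: "zs \<noteq> [] \<Longrightarrow> dist (hd zs) (last zs) \<le> chain_length zs"
proof (induction zs rule: induct_list012)
  case (3 x y zs)
  then show ?case using dist_triangle[of x "last (y # zs)" y] by auto
qed auto

lemma dist_vertex_le_chain_length:
  assumes "z \<in> set zs"
  shows "dist (hd zs) z \<le> chain_length zs"
proof -
  obtain xs ys where zs: "zs = xs @ z # ys" using assms by (metis split_list)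
  have "dist (hd zs) z \<le> chain_length (xs @ [z])"
    using dist_le_chain_length[of "xs @ [z]"] by (cases xs) (auto simp: zs)
  also have "\<dots> \<le> chain_length zs"
    unfolding zs chain_sum_append[of _ xs z ys] by (simp add: chain_sum_nonneg)
  finally show ?thesis .
qed

text \<open>
  The loop consists of the path \<open>zs\<close> and of the closing edge from its last to its first vertex. The
  closing edge is short, and every proper arc of the path is at most twice as long as its chord.
\<close>

definition chord_arc_loop :: "'a::metric_space list \<Rightarrow> bool" where
  "chord_arc_loop zs \<longleftrightarrow> 2 \<le> length zs \<and> dist (hd zs) (last zs) \<le> chain_length zs / 2 \<and>
     (\<forall>xs ys us. zs = xs @ ys @ us \<longrightarrow> ys \<noteq> [] \<longrightarrow> ys \<noteq> zs \<longrightarrow> chain_length ys \<le> 2 * dist (hd ys) (last ys))"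

text \<open>
  Surgery on loops. In a closed chain there are arcs at least twice as long as their chord, the whole
  chain being one. An arc of this kind with the fewest vertices has no proper arc of this kind, so
  together with its chord it is a chord-arc loop. Cutting it off leaves a closed chain with fewer
  vertices: by antisymmetry the two copies of the chord cancel, and the length drops by at least
  half of the length \<open>s\<close> of the arc. The price \<open>C * s\<close> of the piece is thus paid for by the loss of
  length, whatever the number of cuts.
\<close>

lemma closed_chain_bound:
  fixes w :: "'a::metric_space \<Rightarrow> 'a \<Rightarrow> real"
  assumes anti: "\<And>a b. w b a = - w a b"
    and bound: "\<And>zs. chord_arc_loop zs \<Longrightarrow> \<bar>chain_sum w zs + w (last zs) (hd zs)\<bar> \<le> C * chain_length zs"
    and ys: "ys \<noteq> []" "hd ys = last ys"
  shows "\<bar>chain_sum w ys\<bar> \<le> 2 * C * chain_length ys"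
  using ys
proof (induction "length ys" arbitrary: ys rule: less_induct)
  case less
  have w0: "w a a = 0" for a using anti[of a a] by simp
  show ?case
  proof (cases "length ys \<le> 2")
    case True
    then obtain a where "ys = [a] \<or> ys = [a, a]"
      using less.prems by (cases ys rule: remdups_adj.cases) auto
    then show ?thesis by (auto simp: w0)
  next
    case False
    \<comment> \<open>With two vertices every chord would equal its arc; three make the chord a genuine cut.\<close>
    define short where "short zs \<longleftrightarrow> 3 \<le> length zs \<and> dist (hd zs) (last zs) \<le> chain_length zs / 2
      \<and> (\<exists>xs us. ys = xs @ zs @ us)" for zs :: "'a list"
    have "short ys" using False less.prems
      by (auto simp: short_def chain_sum_nonneg intro!: exI[of _ "[]"])
    then obtain zs where zs: "short zs" "\<And>zs'. short zs' \<Longrightarrow> length zs \<le> length zs'"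
      by (metis ex_has_least_nat)
    obtain xs us where ys: "ys = xs @ zs @ us" using zs(1) unfolding short_def by blast
    have len: "3 \<le> length zs" using zs(1) by (simp add: short_def)
    define a b where "a = hd zs" and "b = last zs"
    obtain ms where ms: "zs = a # ms @ [b]"
    proof -
      obtain a' zs' where 1: "zs = a' # zs'" using len by (cases zs) auto
      moreover from this len have "zs' = butlast zs' @ [last zs']" by (cases zs') auto
      ultimately show ?thesis using that by (metis a_def b_def last_snoc list.sel(1) append_Cons)
    qed
    have ab: "dist a b \<le> chain_length zs / 2" using zs(1) by (simp add: short_def a_def b_def)
    have "chord_arc_loop zs"
      unfolding chord_arc_loop_def
    proof (intro conjI allI impI)
      fix p q r assume pqr: "zs = p @ q @ r" "q \<noteq> []" "q \<noteq> zs"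
      show "chain_length q \<le> 2 * dist (hd q) (last q)"
      proof (rule ccontr)
        assume *: "\<not> ?thesis"
        then have "3 \<le> length q"
          using pqr(2) by (cases q rule: remdups_adj.cases) (auto, case_tac xs, auto)
        moreover have "ys = (xs @ p) @ q @ (r @ us)" using pqr(1) ys by simp
        ultimately have "short q"
          unfolding short_def using * by (intro conjI exI[of _ "xs @ p"] exI[of _ "r @ us"]) simp_all
        from zs(2)[OF this] pqr show False by auto
      qed
    qed (use zs(1) in \<open>auto simp: short_def\<close>)
    from bound[OF this] have 1: "\<bar>chain_sum w zs + w b a\<bar> \<le> C * chain_length zs"
      by (simp add: a_def b_def)
    define ys' where "ys' = xs @ a # b # us"
    have split: "chain_sum v ys = chain_sum v ys' - v a b + chain_sum v zs" for v
      using chain_sum_append[of v xs a "ms @ b # us"] chain_sum_append[of v "a # ms" b us]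
        chain_sum_append[of v xs a "b # us"] chain_sum_append[of v "xs @ [a]" b us]
      by (simp add: ys ms ys'_def)
    have "\<bar>chain_sum w ys'\<bar> \<le> 2 * C * chain_length ys'"
    proof (rule less.hyps)
      show "length ys' < length ys" using len by (cases ms) (auto simp: ys ys'_def ms)
      show "ys' \<noteq> []" by (simp add: ys'_def)
      show "hd ys' = last ys'" using less.prems(2) by (cases xs; cases us) (auto simp: ys ys'_def ms)
    qed
    moreover have "chain_sum w ys = chain_sum w ys' + (chain_sum w zs + w b a)"
      using split[of w] anti[of a b] by simp
    moreover have C0: "C * dist a b \<le> C * (chain_length zs / 2)"
    proof (cases "chain_length zs = 0")
      case True
      then show ?thesis using ab by simp
    next
      case False
      then have "0 < chain_length zs" using chain_sum_nonneg[of dist zs] by simp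
      with 1 have "0 \<le> C" by (smt (verit) zero_le_mult_iff)
      then show ?thesis using ab by (intro mult_left_mono)
    qed
    moreover have "C * chain_length ys = C * (chain_length ys' - dist a b + chain_length zs)"
      by (simp only: split[of dist])
    ultimately show ?thesis
      using 1 unfolding right_diff_distrib distrib_left abs_le_iff by linarith
  qed
qed

text \<open>
  The potential at \<open>y\<close> is the infimum, over all chains from a base point to \<open>y\<close>, of the work along the
  chain plus \<open>C\<close> times its length. Closing up a chain shows that this is bounded below, and extending
  a chain by one edge gives the estimate for increments.
\<close>

lemma exists_potential:
  fixes w :: "'a::metric_space \<Rightarrow> 'a \<Rightarrow> real"
  assumes anti: "\<And>a b. w b a = - w a b"
    and closed: "\<And>ys. ys \<noteq> [] \<Longrightarrow> hd ys = last ys \<Longrightarrow> \<bar>chain_sum w ys\<bar> \<le> C * chain_length ys"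
  shows "\<exists>p. \<forall>a b. \<bar>p b - p a - w a b\<bar> \<le> C * dist a b"
proof -
  fix o' :: 'a
  define cost where "cost = chain_sum (\<lambda>a b. w a b + C * dist a b)"
  have cost_eq: "cost zs = chain_sum w zs + C * chain_length zs" for zs
    unfolding cost_def chain_sum_add chain_sum_scale ..
  define P where "P y = cost ` {zs. zs \<noteq> [] \<and> hd zs = o' \<and> last zs = y}" for y
  define p where "p y = Inf (P y)" for y
  have bdd: "bdd_below (P y)" for y
  proof (rule bdd_belowI)
    fix c assume "c \<in> P y"
    then obtain zs where zs: "c = cost zs" "zs \<noteq> []" "hd zs = o'" "last zs = y" by (auto simp: P_def)
    have "\<bar>chain_sum w (zs @ [o'])\<bar> \<le> C * chain_length (zs @ [o'])"
      using zs by (intro closed) auto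
    moreover have "chain_sum v (zs @ [o']) = chain_sum v zs + v y o'" for v
      using chain_sum_snoc[of v "butlast zs" y o'] zs by (metis append_butlast_last_id append_assoc append_Cons append_Nil)
    ultimately show "- w y o' - C * dist y o' \<le> c"
      by (simp add: zs(1) cost_eq algebra_simps)
  qed
  have ne: "P y \<noteq> {}" for y
    unfolding P_def by (auto intro!: exI[of _ "[o', y]"])
  have step: "p b \<le> p a + w a b + C * dist a b" for a b
  proof -
    have "p b - (w a b + C * dist a b) \<le> p a"
      unfolding p_def[of a]
    proof (rule cInf_greatest[OF ne])
      fix c assume "c \<in> P a"
      then obtain zs where zs: "c = cost zs" "zs \<noteq> []" "hd zs = o'" "last zs = a" by (auto simp: P_def)
      have "p b \<le> cost (zs @ [b])"
        unfolding p_def by (rule cInf_lower[OF _ bdd]) (use zs in \<open>auto simp: P_def\<close>)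
      also have "\<dots> = c + w a b + C * dist a b"
        using chain_sum_snoc[of _ "butlast zs" a b] zs unfolding cost_def
        by (metis (no_types, lifting) append_butlast_last_id append_assoc append_Cons append_Nil add.assoc)
      finally show "p b - (w a b + C * dist a b) \<le> c" by simp
    qed
    then show ?thesis by simp
  qed
  have "\<bar>p b - p a - w a b\<bar> \<le> C * dist a b" for a b
    using step[of b a] step[of a b] anti[of a b] by (simp add: dist_commute)
  then show ?thesis by blast
qed

section \<open>The Riesz kernel along a chord-arc loop\<close>

text \<open>
  A discrete form of \<open>b\<^bsup>-\<beta>\<^esup> \<le> t\<^bsup>-\<beta>\<^esup>\<close> integrated over \<open>t\<close> from \<open>a\<close> to \<open>b\<close>; the right-hand side
  telescopes along a chain. It is the weighted arithmetic-geometric mean inequality for \<open>a\<close>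
  and \<open>b\<close>.
\<close>

lemma powr_increment_bound:
  fixes a b \<beta> :: real
  assumes "0 \<le> a" "a \<le> b" "0 < \<beta>" "\<beta> < 1"
  shows "(b - a) * b powr - \<beta> \<le> (b powr (1 - \<beta>) - a powr (1 - \<beta>)) / (1 - \<beta>)"
proof (cases "b = 0")
  case False
  then have b: "b > 0" using assms by simp
  have "a powr (1 - \<beta>) * b powr \<beta> \<le> (1 - \<beta>) * a + \<beta> * b"
    using Youngs_inequality_0[of "1 - \<beta>" \<beta> a b] assms b by (cases "a = 0") auto
  then have "a powr (1 - \<beta>) * b powr \<beta> * b powr - \<beta> \<le> ((1 - \<beta>) * a + \<beta> * b) * b powr - \<beta>"
    by (intro mult_right_mono) auto
  moreover have "b powr \<beta> * b powr - \<beta> = 1" using b by (simp add: powr_minus)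
  ultimately have "a powr (1 - \<beta>) \<le> ((1 - \<beta>) * a + \<beta> * b) * b powr - \<beta>" by (simp add: mult.assoc)
  moreover have "b powr (1 - \<beta>) = b * b powr - \<beta>" using b by (simp add: powr_diff powr_minus divide_inverse)
  ultimately have "(1 - \<beta>) * ((b - a) * b powr - \<beta>) \<le> b powr (1 - \<beta>) - a powr (1 - \<beta>)"
    by (simp add: algebra_simps)
  then show ?thesis using assms by (simp add: field_simps)
qed (use assms in auto)

lemma powr_minus_lipschitz:
  fixes t t' e \<beta> :: real
  assumes e: "0 < e" "e \<le> t" "e \<le> t'" and \<beta>: "0 < \<beta>" "\<beta> < 1"
  shows "\<bar>t powr - \<beta> - t' powr - \<beta>\<bar> \<le> e powr (- \<beta> - 1) * \<bar>t - t'\<bar>"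
proof -
  have *: "\<bar>t powr - \<beta> - t' powr - \<beta>\<bar> \<le> e powr (- \<beta> - 1) * \<bar>t - t'\<bar>"
    if t: "e \<le> t" "t \<le> t'" for t t'
  proof -
    have pos: "0 < t" "0 < t'" using e t by auto
    have "t / t' \<le> (t / t') powr \<beta>"
      using powr_mono'[of \<beta> 1 "t / t'"] pos t \<beta> by simp
    then have "t / t' * t powr - \<beta> \<le> (t / t') powr \<beta> * t powr - \<beta>" by (intro mult_right_mono) auto
    also have "(t / t') powr \<beta> * t powr - \<beta> = t' powr - \<beta>"
      using pos by (simp add: powr_divide powr_minus field_simps)
    finally have "t powr - \<beta> - t' powr - \<beta> \<le> t powr - \<beta> * ((t' - t) / t')"
      using pos by (simp add: field_simps)
    also have "\<dots> \<le> t powr - \<beta> * ((t' - t) / t)"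
      using pos t by (intro mult_left_mono divide_left_mono) auto
    also have "\<dots> = t powr (- \<beta> - 1) * (t' - t)" using pos by (simp add: powr_diff)
    also have "\<dots> \<le> e powr (- \<beta> - 1) * (t' - t)"
      using e t \<beta> by (intro mult_right_mono powr_mono2') auto
    finally have "t powr - \<beta> - t' powr - \<beta> \<le> e powr (- \<beta> - 1) * (t' - t)" .
    moreover have "t' powr - \<beta> \<le> t powr - \<beta>" using pos t \<beta> by (intro powr_mono2') auto
    ultimately show ?thesis using t by simp
  qed
  show ?thesis using *[of t t'] *[of t' t] e by (cases "t \<le> t'") (auto simp: abs_minus_commute)
qed

text \<open>
  A substitute for the average of \<open>(e + dist x y) powr - \<beta>\<close> over the segment from \<open>a\<close> to \<open>b\<close>. It is
  symmetric in \<open>a\<close> and \<open>b\<close>, it is the kernel itself for \<open>a = b\<close>, and the half sum of the distances,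
  being at least half of \<open>dist a b\<close>, keeps it small on long edges even if \<open>x\<close> is a vertex.
\<close>

definition segment_kernel :: "real \<Rightarrow> real \<Rightarrow> 'a::metric_space \<Rightarrow> 'a \<Rightarrow> 'a \<Rightarrow> real" where
  "segment_kernel e \<beta> x a b = (e + dist x a / 2 + dist x b / 2) powr - \<beta>"

lemma segment_kernel_nonneg [simp]: "0 \<le> segment_kernel e \<beta> x a b"
  by (simp add: segment_kernel_def)

lemma segment_kernel_commute: "segment_kernel e \<beta> x a b = segment_kernel e \<beta> x b a"
  unfolding segment_kernel_def by (simp only: ac_simps)

context
  fixes e \<beta> :: real
  assumes e: "0 < e" and \<beta>: "0 < \<beta>" "\<beta> < 1"
begin

text \<open>
  In the application \<open>A\<close> is the length of the arc between \<open>a\<close> and the vertex nearest to \<open>x\<close>.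
\<close>

lemma edge_bound:
  assumes "0 \<le> A" "A \<le> 4 * dist x a"
  shows "dist a b * segment_kernel e \<beta> x a b
     \<le> 10 / (1 - \<beta>) * ((A + dist a b) powr (1 - \<beta>) - A powr (1 - \<beta>))"
proof (cases "A + dist a b = 0")
  case True
  then have "dist a b = 0" using assms zero_le_dist[of a b] by linarith
  then show ?thesis by simp
next
  case False
  then have pos: "0 < A + dist a b" using assms by (simp add: add_nonneg_eq_0_iff order_less_le)
  have "dist a b \<le> dist x a + dist x b" by (metis dist_commute dist_triangle)
  \<comment> \<open>The left side is at most half of \<open>dist x a + dist x b\<close>, because \<open>A + dist a b\<close> is at most five times that sum.\<close>
  then have m: "(A + dist a b) / 10 \<le> e + dist x a / 2 + dist x b / 2"
    unfolding add_divide_distrib using assms e zero_le_dist[of x b] by linarith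
  have "segment_kernel e \<beta> x a b \<le> ((A + dist a b) / 10) powr - \<beta>"
    unfolding segment_kernel_def using m pos \<beta> by (intro powr_mono2') auto
  also have "\<dots> = 10 powr \<beta> * (A + dist a b) powr - \<beta>"
    using pos by (simp add: powr_divide powr_minus field_simps)
  also have "\<dots> \<le> 10 * (A + dist a b) powr - \<beta>"
    using powr_mono[of \<beta> 1 10] \<beta> by (intro mult_right_mono) auto
  finally have "dist a b * segment_kernel e \<beta> x a b \<le> dist a b * (10 * (A + dist a b) powr - \<beta>)"
    by (rule mult_left_mono) simp
  also have "\<dots> = 10 * (((A + dist a b) - A) * (A + dist a b) powr - \<beta>)" by simp
  also have "\<dots> \<le> 10 * (((A + dist a b) powr (1 - \<beta>) - A powr (1 - \<beta>)) / (1 - \<beta>))"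
    using assms \<beta> by (intro mult_left_mono powr_increment_bound) auto
  finally show ?thesis by simp
qed

text \<open>
  The path starts at the vertex nearest to \<open>x\<close>, so that every vertex is at least half as far from
  \<open>x\<close> as from the start, hence, by the chord-arc condition, at least a quarter of the length of the
  arc leading to it. The kernel then decays like \<open>t\<^bsup>-\<beta>\<^esup>\<close> in the arc length \<open>t\<close>.
\<close>

lemma half_chain_bound:
  assumes "zs \<noteq> []"
    and "\<And>ps qs. zs = ps @ qs \<Longrightarrow> ps \<noteq> [] \<Longrightarrow> chain_length ps \<le> 2 * dist (hd ps) (last ps)"
    and "\<And>z. z \<in> set zs \<Longrightarrow> dist x (hd zs) \<le> dist x z"
  shows "chain_sum (\<lambda>a b. dist a b * segment_kernel e \<beta> x a b) (zs @ [b])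
     \<le> 10 / (1 - \<beta>) * chain_length (zs @ [b]) powr (1 - \<beta>)"
  using assms
proof (induction zs arbitrary: b rule: rev_induct)
  case (snoc a zs)
  let ?f = "\<lambda>a b. dist a b * segment_kernel e \<beta> x a b"
  let ?A = "chain_length (zs @ [a])"
  have "?A \<le> 2 * dist (hd (zs @ [a])) a" using snoc.prems(2)[of "zs @ [a]" "[]"] by simp
  also have "\<dots> \<le> 2 * (dist x (hd (zs @ [a])) + dist x a)"
    by (metis dist_commute dist_triangle mult_left_mono zero_le_numeral)
  also have "\<dots> \<le> 4 * dist x a" using snoc.prems(3)[of a] by simp
  finally have A: "?A \<le> 4 * dist x a" .
  have IH: "chain_sum ?f (zs @ [a]) \<le> 10 / (1 - \<beta>) * ?A powr (1 - \<beta>)"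
  proof (cases "zs = []")
    case False
    show ?thesis
    proof (rule snoc.IH[OF False])
      show "chain_length ps \<le> 2 * dist (hd ps) (last ps)" if "zs = ps @ qs" "ps \<noteq> []" for ps qs
        using snoc.prems(2)[of ps "qs @ [a]"] that by simp
      show "dist x (hd zs) \<le> dist x z" if "z \<in> set zs" for z
        using snoc.prems(3)[of z] that False by simp
    qed
  qed simp
  show ?case
    using IH edge_bound[OF _ A, of b] chain_sum_nonneg[of dist "zs @ [a]"]
    by (simp add: chain_sum_snoc algebra_simps)
qed simp

text \<open>
  Split the path at the vertex \<open>v\<close> nearest to \<open>x\<close> and walk away from \<open>v\<close> in both directions. The
  two halves only need the chord-arc condition on arcs that omit an end vertex of the path, and these
  are proper.
\<close>

lemma near_bound:
  assumes zs: "chord_arc_loop zs"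
  shows "chain_sum (\<lambda>a b. dist a b * segment_kernel e \<beta> x a b) zs
      + dist (last zs) (hd zs) * segment_kernel e \<beta> x (last zs) (hd zs)
      \<le> 30 / (1 - \<beta>) * chain_length zs powr (1 - \<beta>)"
proof -
  let ?f = "\<lambda>a b. dist a b * segment_kernel e \<beta> x a b"
  let ?s = "chain_length zs"
  let ?c = "10 / (1 - \<beta>)"
  have c0: "0 \<le> ?c" using \<beta> by simp
  have ne: "zs \<noteq> []" using zs by (auto simp: chord_arc_loop_def)
  have arc: "chain_length ys \<le> 2 * dist (hd ys) (last ys)"
    if "zs = xs @ ys @ us" "ys \<noteq> []" "ys \<noteq> zs" for xs ys us
    using zs that unfolding chord_arc_loop_def by blast
  obtain v where v: "v \<in> set zs" "\<And>z. z \<in> set zs \<Longrightarrow> dist x v \<le> dist x z"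
    using arg_min_if_finite(1)[of "set zs" "dist x"] arg_min_least[of "set zs" _ "dist x"] ne by auto
  obtain ps qs where split: "zs = ps @ v # qs" using v(1) by (metis split_list)
  have half: "chain_sum ?f (v # qs) \<le> ?c * chain_length (v # qs) powr (1 - \<beta>)"
    if arc: "\<And>ys us. v # qs = ys @ us \<Longrightarrow> us \<noteq> [] \<Longrightarrow> ys \<noteq> [] \<Longrightarrow> chain_length ys \<le> 2 * dist (hd ys) (last ys)"
      and min: "\<And>z. z \<in> set qs \<Longrightarrow> dist x v \<le> dist x z" for qs
  proof (cases "qs = []")
    case True
    then show ?thesis by simp
  next
    case False
    then have eq: "v # qs = (v # butlast qs) @ [last qs]" by simp
    show ?thesis
      unfolding eq
    proof (rule half_chain_bound)
      show "chain_length ys \<le> 2 * dist (hd ys) (last ys)" if "v # butlast qs = ys @ us" "ys \<noteq> []" for ys us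
        using that eq by (intro arc[of ys "us @ [last qs]"]) auto
      show "dist x (hd (v # butlast qs)) \<le> dist x z" if "z \<in> set (v # butlast qs)" for z
        using that min[of z] in_set_butlastD[of z qs] by auto
    qed simp
  qed
  have "chain_sum ?f (v # qs) \<le> ?c * chain_length (v # qs) powr (1 - \<beta>)"
  proof (rule half)
    show "chain_length ys \<le> 2 * dist (hd ys) (last ys)" if "v # qs = ys @ us" "us \<noteq> []" "ys \<noteq> []" for ys us
    proof (rule arc)
      show eq: "zs = ps @ ys @ us" using that split by simp
      show "ys \<noteq> zs" using arg_cong[OF eq, of length] that(2) by auto
    qed (rule that(3))
  qed (use split v(2) in auto)
  moreover have "chain_sum ?f (v # rev ps) \<le> ?c * chain_length (v # rev ps) powr (1 - \<beta>)"
  proof (rule half)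
    fix ys us assume *: "v # rev ps = ys @ us" "us \<noteq> []" "ys \<noteq> []"
    then have "rev (v # rev ps) = rev us @ rev ys" by (metis rev_append)
    then have eq: "ps @ [v] = rev us @ rev ys" by simp
    have "chain_length (rev ys) \<le> 2 * dist (hd (rev ys)) (last (rev ys))"
    proof (rule arc)
      show eq': "zs = rev us @ rev ys @ qs" using eq split by (metis append_assoc append_Cons append_Nil)
      show "rev ys \<noteq> zs" using arg_cong[OF eq', of length] *(2) by auto
    qed (use * in auto)
    then show "chain_length ys \<le> 2 * dist (hd ys) (last ys)"
      by (simp add: chain_sum_rev dist_commute hd_rev last_rev)
  qed (use split v(2) in auto)
  moreover have "chain_sum ?f (v # rev ps) = chain_sum ?f (ps @ [v])" "chain_length (v # rev ps) = chain_length (ps @ [v])"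
    using chain_sum_rev[of ?f "ps @ [v]"] chain_sum_rev[of dist "ps @ [v]"]
    by (simp_all add: dist_commute segment_kernel_commute[of _ _ _ b a for a b])
  moreover have split_sum: "chain_sum w zs = chain_sum w (ps @ [v]) + chain_sum w (v # qs)" for w
    unfolding split by (rule chain_sum_append)
  moreover have "chain_length (v # qs) powr (1 - \<beta>) \<le> ?s powr (1 - \<beta>)" "chain_length (ps @ [v]) powr (1 - \<beta>) \<le> ?s powr (1 - \<beta>)"
    using \<beta> split_sum[of dist] chain_sum_nonneg[of dist "v # qs"] chain_sum_nonneg[of dist "ps @ [v]"]
    by (auto intro!: powr_mono2)
  ultimately have 1: "chain_sum ?f zs \<le> ?c * ?s powr (1 - \<beta>) + ?c * ?s powr (1 - \<beta>)"
    using c0 by (smt (verit) mult_left_mono)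
  have "?f (last zs) (hd zs) \<le> ?c * (dist (last zs) (hd zs)) powr (1 - \<beta>)"
    using edge_bound[of 0 x "last zs" "hd zs"] by simp
  also have "\<dots> \<le> ?c * ?s powr (1 - \<beta>)"
  proof (intro mult_left_mono powr_mono2)
    show "dist (last zs) (hd zs) \<le> ?s" using dist_le_chain_length[OF ne] by (simp add: dist_commute)
  qed (use \<beta> c0 in auto)
  finally show ?thesis using 1 by simp
qed

text \<open>
  Since the increments of \<open>h\<close> around the loop add up to zero, a constant may be subtracted from the
  kernel. With the value at the first vertex as the constant, this gains a factor of the order
  \<open>chain_length zs / dist x (hd zs)\<close>.
\<close>

lemma far_bound:
  fixes x :: "'a::metric_space" and h :: "'a \<Rightarrow> real"
  assumes zs: "chord_arc_loop zs" and s: "0 < chain_length zs"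
    and far: "2 * chain_length zs \<le> dist x (hd zs)"
    and h: "\<And>a b. \<bar>h b - h a\<bar> \<le> dist a b"
  shows "\<bar>chain_sum (\<lambda>a b. (h b - h a) * segment_kernel e \<beta> x a b) zs
      + (h (hd zs) - h (last zs)) * segment_kernel e \<beta> x (last zs) (hd zs)\<bar>
      \<le> 6 * (chain_length zs)\<^sup>2 * dist x (hd zs) powr (- \<beta> - 1)"
proof -
  let ?s = "chain_length zs"
  let ?D = "dist x (hd zs)"
  let ?K = "segment_kernel e \<beta> x"
  define k0 where "k0 = (e + ?D) powr - \<beta>"
  define c where "c = 4 * ?s * ?D powr (- \<beta> - 1)"
  have ne: "zs \<noteq> []" using zs by (auto simp: chord_arc_loop_def)
  have D: "0 < ?D" using s far by linarith
  have K: "\<bar>?K a b - k0\<bar> \<le> c" if ab: "a \<in> set zs" "b \<in> set zs" for a b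
  proof -
    have *: "\<bar>dist x z - ?D\<bar> \<le> ?s" if "z \<in> set zs" for z
      using dist_vertex_le_chain_length[OF that] dist_triangle[of x z "hd zs"] dist_triangle[of x "hd zs" z]
      by (simp add: dist_commute)
    have m: "\<bar>e + dist x a / 2 + dist x b / 2 - (e + ?D)\<bar> \<le> ?s" using *[OF ab(1)] *[OF ab(2)] by linarith
    have "\<bar>?K a b - k0\<bar> \<le> (?D / 2) powr (- \<beta> - 1) * \<bar>e + dist x a / 2 + dist x b / 2 - (e + ?D)\<bar>"
      unfolding segment_kernel_def k0_def
    proof (rule powr_minus_lipschitz)
      show "?D / 2 \<le> e + dist x a / 2 + dist x b / 2" using abs_le_D2[OF m] far e by linarith
    qed (use e D \<beta> in auto)
    also have "\<dots> \<le> (4 * ?D powr (- \<beta> - 1)) * ?s"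
    proof (intro mult_mono m)
      have "(?D / 2) powr (- \<beta> - 1) = (1 / 2) powr (- \<beta> - 1) * ?D powr (- \<beta> - 1)"
        using D by (subst powr_mult[symmetric]) simp_all
      also have "\<dots> \<le> (1 / 2) powr (- 2) * ?D powr (- \<beta> - 1)"
        using \<beta> by (intro mult_right_mono powr_mono') auto
      also have "(1 / 2) powr (- 2) = (4 :: real)" by (simp add: powr_minus powr_numeral power2_eq_square)
      finally show "(?D / 2) powr (- \<beta> - 1) \<le> 4 * ?D powr (- \<beta> - 1)" .
    qed auto
    finally show ?thesis by (simp add: c_def mult_ac)
  qed
  have "(\<lambda>a b. (h b - h a) * ?K a b) = (\<lambda>a b. (h b - h a) * (?K a b - k0) + k0 * (h b - h a))"
    by (simp add: algebra_simps)
  then have "chain_sum (\<lambda>a b. (h b - h a) * ?K a b) zs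
      = chain_sum (\<lambda>a b. (h b - h a) * (?K a b - k0)) zs + k0 * (h (last zs) - h (hd zs))"
    by (simp only: chain_sum_add chain_sum_scale chain_sum_diff[OF ne])
  then have eq: "chain_sum (\<lambda>a b. (h b - h a) * ?K a b) zs + (h (hd zs) - h (last zs)) * ?K (last zs) (hd zs)
      = chain_sum (\<lambda>a b. (h b - h a) * (?K a b - k0)) zs + (h (hd zs) - h (last zs)) * (?K (last zs) (hd zs) - k0)"
    by (simp add: algebra_simps)
  have c0: "0 \<le> c" using s by (simp add: c_def)
  have summand: "\<bar>(h b - h a) * (?K a b - k0)\<bar> \<le> c * dist a b" if ab: "a \<in> set zs" "b \<in> set zs" for a b
    using mult_mono[OF h[of b a] K[OF ab]] by (simp add: abs_mult mult.commute)
  have "\<bar>chain_sum (\<lambda>a b. (h b - h a) * (?K a b - k0)) zs\<bar> \<le> chain_sum (\<lambda>a b. c * dist a b) zs"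
    by (rule order_trans[OF chain_sum_abs chain_sum_mono]) (rule summand)
  moreover have "\<bar>(h (hd zs) - h (last zs)) * (?K (last zs) (hd zs) - k0)\<bar> \<le> c * (?s / 2)"
  proof (rule order_trans[OF summand])
    show "c * dist (last zs) (hd zs) \<le> c * (?s / 2)"
      using zs c0 by (intro mult_left_mono) (auto simp: chord_arc_loop_def dist_commute)
  qed (use ne in auto)
  ultimately have "\<bar>chain_sum (\<lambda>a b. (h b - h a) * ?K a b) zs + (h (hd zs) - h (last zs)) * ?K (last zs) (hd zs)\<bar>
      \<le> c * ?s + c * (?s / 2)"
    unfolding eq chain_sum_scale by linarith
  also have "\<dots> = 6 * ?s\<^sup>2 * ?D powr (- \<beta> - 1)" by (simp add: c_def power2_eq_square)
  finally show ?thesis .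
qed

end

section \<open>Loops and Morrey measures\<close>

lemma dyadic_shell:
  fixes t s :: real
  assumes "0 < s" "2 * s \<le> t"
  shows "\<exists>j::nat. 2 ^ j * s \<le> t \<and> t < 2 ^ (j + 1) * s"
proof -
  define j where "j = (LEAST j::nat. t < 2 ^ (j + 1) * s)"
  obtain n where "t / s < 2 ^ n" using real_arch_pow[of 2 "t / s"] by auto
  also have "(2::real) ^ n \<le> 2 ^ (n + 1)" by simp
  finally have "t < 2 ^ (n + 1) * s" using assms by (simp add: field_simps)
  then have 1: "t < 2 ^ (j + 1) * s" unfolding j_def by (rule LeastI)
  moreover have "2 ^ j * s \<le> t"
  proof (cases j)
    case 0
    then show ?thesis using assms by simp
  next
    case (Suc k)
    then have "\<not> t < 2 ^ (k + 1) * s" unfolding j_def by (intro not_less_Least) simp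
    then show ?thesis using Suc by simp
  qed
  ultimately show ?thesis by blast
qed

text \<open>
  Decompose the space into the ball of radius \<open>2 s\<close> and dyadic shells around it. On the shell of
  radius \<open>2 ^ j * s\<close> the extra decay of order \<open>- 1\<close> beyond the Morrey exponent \<open>\<beta>\<close> leaves the
  contribution \<open>s / 2 ^ j\<close>.
\<close>

lemma morrey_decay_integral:
  fixes \<nu> :: "'a::metric_space measure" and S :: "'a \<Rightarrow> real"
  assumes sets: "sets \<nu> = sets borel"
    and ball: "\<And>r. 0 < r \<Longrightarrow> emeasure \<nu> (ball y r) \<le> ennreal (M * r powr \<beta>)"
    and \<beta>: "0 < \<beta>" "\<beta> < 1" and s: "0 < s" and c: "0 \<le> c1" "0 \<le> c2" "0 \<le> M"
    and near: "\<And>x. \<bar>S x\<bar> \<le> c1 * s powr (1 - \<beta>)"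
    and far: "\<And>x. 2 * s \<le> dist x y \<Longrightarrow> \<bar>S x\<bar> \<le> c2 * s\<^sup>2 * dist x y powr (- \<beta> - 1)"
  shows "(\<integral>\<^sup>+x. ennreal \<bar>S x\<bar> \<partial>\<nu>) \<le> ennreal (4 * (c1 + c2) * M * s)"
proof -
  define C where "C j = (c1 + c2) * (s powr (1 - \<beta>) * (2 ^ j) powr (- \<beta> - 1))" for j :: nat
  define R where "R j = 2 ^ (j + 1) * s" for j :: nat
  have C0: "0 \<le> C j" for j using c by (simp add: C_def)
  have R0: "0 < R j" for j using s by (simp add: R_def)
  have pt: "ennreal \<bar>S x\<bar> \<le> (\<Sum>j. ennreal (C j) * indicator (ball y (R j)) x)" for x
  proof -
    have "\<exists>j. \<bar>S x\<bar> \<le> C j \<and> x \<in> ball y (R j)"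
    proof (cases "2 * s \<le> dist x y")
      case False
      have "\<bar>S x\<bar> \<le> (c1 + c2) * s powr (1 - \<beta>)"
        using near[of x] mult_right_mono[of c1 "c1 + c2" "s powr (1 - \<beta>)"] c by simp
      then show ?thesis using False by (intro exI[of _ 0]) (simp add: C_def R_def dist_commute)
    next
      case True
      obtain j where j: "2 ^ j * s \<le> dist x y" "dist x y < R j"
        using dyadic_shell[OF s True] unfolding R_def by blast
      have "s\<^sup>2 * dist x y powr (- \<beta> - 1) \<le> s\<^sup>2 * (2 ^ j * s) powr (- \<beta> - 1)"
        using j s \<beta> by (intro mult_left_mono powr_mono2') auto
      also have "(2 ^ j * s) powr (- \<beta> - 1) = (2 ^ j) powr (- \<beta> - 1) * s powr (- \<beta> - 1)"
        using s by (simp add: powr_mult)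
      also have "s\<^sup>2 * ((2 ^ j) powr (- \<beta> - 1) * s powr (- \<beta> - 1)) = (s powr 2 * s powr (- \<beta> - 1)) * (2 ^ j) powr (- \<beta> - 1)"
        using s by (simp add: powr_numeral)
      also have "s powr 2 * s powr (- \<beta> - 1) = s powr (1 - \<beta>)" by (simp add: powr_add[symmetric])
      finally have 1: "c2 * (s\<^sup>2 * dist x y powr (- \<beta> - 1)) \<le> c2 * (s powr (1 - \<beta>) * (2 ^ j) powr (- \<beta> - 1))"
        by (intro mult_left_mono c)
      have "\<bar>S x\<bar> \<le> c2 * (s\<^sup>2 * dist x y powr (- \<beta> - 1))" using far[OF True] by (simp add: mult.assoc)
      also note 1
      also have "c2 * (s powr (1 - \<beta>) * (2 ^ j) powr (- \<beta> - 1)) \<le> C j"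
        unfolding C_def using c by (intro mult_right_mono) auto
      finally show ?thesis using j by (intro exI[of _ j]) (simp add: dist_commute)
    qed
    then obtain j where j: "\<bar>S x\<bar> \<le> C j" "x \<in> ball y (R j)" by blast
    have "ennreal \<bar>S x\<bar> \<le> ennreal (C j) * indicator (ball y (R j)) x"
      using j by (simp add: ennreal_leI)
    also have "\<dots> \<le> (\<Sum>j. ennreal (C j) * indicator (ball y (R j)) x)"
    proof -
      define F where "F j = ennreal (C j) * indicator (ball y (R j)) x" for j
      have "(\<Sum>k\<in>{j}. F k) \<le> (\<Sum>k. F k)" by (rule sum_le_suminf) auto
      then have "F j \<le> (\<Sum>k. F k)" by simp
      then show ?thesis unfolding F_def .
    qed
    finally show ?thesis .
  qed
  have term_le: "ennreal (C j) * emeasure \<nu> (ball y (R j)) \<le> ennreal (2 * (c1 + c2) * M * s * (1 / 2) ^ j)" for j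
  proof -
    have "ennreal (C j) * emeasure \<nu> (ball y (R j)) \<le> ennreal (C j) * ennreal (M * R j powr \<beta>)"
      by (intro mult_left_mono ball R0) simp
    also have "\<dots> = ennreal (C j * (M * R j powr \<beta>))" using C0 c by (simp add: ennreal_mult)
    also have "\<dots> \<le> ennreal (2 * (c1 + c2) * M * s * (1 / 2) ^ j)"
    proof (rule ennreal_leI)
      have p: "(2 ^ j) powr (- \<beta> - 1) * (2 ^ j) powr \<beta> = ((1::real) / 2) ^ j"
      proof -
        have "((2::real) ^ j) powr (- \<beta> - 1) * (2 ^ j) powr \<beta> = (2 ^ j) powr (- 1)"
          unfolding powr_add[symmetric] by simp
        also have "\<dots> = 1 / 2 ^ j" by (rule powr_neg_one) simp
        finally show ?thesis by (simp add: power_one_over)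
      qed
      have q: "s powr (1 - \<beta>) * s powr \<beta> = s" using s unfolding powr_add[symmetric] by simp
      have "R j powr \<beta> = 2 powr \<beta> * ((2 ^ j) powr \<beta> * s powr \<beta>)"
        using s by (simp add: R_def powr_mult mult.assoc)
      then have "C j * (M * R j powr \<beta>) = (c1 + c2) * M * 2 powr \<beta> *
           ((s powr (1 - \<beta>) * s powr \<beta>) * ((2 ^ j) powr (- \<beta> - 1) * (2 ^ j) powr \<beta>))"
        by (simp add: C_def mult_ac)
      also have "\<dots> = (c1 + c2) * M * 2 powr \<beta> * (s * (1 / 2) ^ j)" unfolding p q ..
      also have "\<dots> \<le> (c1 + c2) * M * 2 * (s * (1 / 2) ^ j)"
        using c s powr_mono[of \<beta> 1 2] \<beta> by (intro mult_right_mono mult_left_mono) auto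
      finally show "C j * (M * R j powr \<beta>) \<le> 2 * (c1 + c2) * M * s * (1 / 2) ^ j" by (simp add: mult_ac)
    qed
    finally show ?thesis .
  qed
  have "(\<integral>\<^sup>+x. ennreal \<bar>S x\<bar> \<partial>\<nu>) \<le> (\<integral>\<^sup>+x. (\<Sum>j. ennreal (C j) * indicator (ball y (R j)) x) \<partial>\<nu>)"
    by (intro nn_integral_mono pt)
  also have "\<dots> = (\<Sum>j. \<integral>\<^sup>+x. ennreal (C j) * indicator (ball y (R j)) x \<partial>\<nu>)"
  proof (rule nn_integral_suminf)
    have [measurable]: "ball y (R j) \<in> sets \<nu>" for j by (simp add: sets)
    show "(\<lambda>x. ennreal (C j) * indicator (ball y (R j)) x) \<in> borel_measurable \<nu>" for j by measurable
  qed
  also have "\<dots> = (\<Sum>j. ennreal (C j) * emeasure \<nu> (ball y (R j)))"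
    by (simp add: nn_integral_cmult_indicator sets)
  also have "\<dots> \<le> (\<Sum>j. ennreal (2 * (c1 + c2) * M * s * (1 / 2) ^ j))"
    by (intro suminf_le term_le) auto
  also have "\<dots> = ennreal (\<Sum>j. 2 * (c1 + c2) * M * s * (1 / 2) ^ j)"
    using c s by (intro suminf_ennreal2) (auto intro!: summable_mult summable_geometric)
  also have "(\<Sum>j. 2 * (c1 + c2) * M * s * (1 / 2) ^ j) = 4 * (c1 + c2) * M * s"
    by (simp add: suminf_mult suminf_geometric)
  finally show ?thesis .
qed

text \<open>
  The function \<open>g\<close> is a dual variable: below it is the sign of a component of a potential of \<open>F\<close>.
\<close>

locale morrey_field =
  fixes \<nu> :: "(real^'n) measure" and g :: "real^'n \<Rightarrow> real" and i :: 'n and e \<beta> M :: real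
  assumes finite: "finite_measure \<nu>" and sets [measurable_cong]: "sets \<nu> = sets borel"
    and ball: "\<And>x r. 0 < r \<Longrightarrow> emeasure \<nu> (ball x r) \<le> ennreal (M * r powr \<beta>)"
    and g_meas [measurable]: "g \<in> borel_measurable borel" and g_bound: "\<And>x. \<bar>g x\<bar> \<le> 1"
    and e: "0 < e" and \<beta>: "0 < \<beta>" "\<beta> < 1" and M: "0 \<le> M"
begin

sublocale finite_measure \<nu> by (rule finite)

text \<open>
  For the field \<open>v e\<^sub>i\<close> defined next, \<open>w a b\<close> plays the role of its line integral from \<open>a\<close> to \<open>b\<close>.
  It has the antisymmetry of a line integral and the same first-order behaviour as \<open>b\<close> tends to
  \<open>a\<close>.
\<close>

definition w :: "real^'n \<Rightarrow> real^'n \<Rightarrow> real" where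
  "w a b = (b $ i - a $ i) * (\<integral>x. g x * segment_kernel e \<beta> x a b \<partial>\<nu>)"

definition v :: "real^'n \<Rightarrow> real" where
  "v a = (\<integral>x. g x * (e + dist x a) powr - \<beta> \<partial>\<nu>)"

lemma segment_kernel_le: "segment_kernel e \<beta> x a b \<le> e powr - \<beta>" for x :: "real^'n"
  unfolding segment_kernel_def using e \<beta> by (intro powr_mono2') auto

lemma segment_kernel_same: "segment_kernel e \<beta> x a a = (e + dist x a) powr - \<beta>" for x :: "real^'n"
  unfolding segment_kernel_def by (simp add: algebra_simps)

lemma segment_kernel_meas [measurable]: "(\<lambda>x. segment_kernel e \<beta> x a b) \<in> borel_measurable borel"
  for a b :: "real^'n"
  unfolding segment_kernel_def by measurable

lemma integrable_kernel: "integrable \<nu> (\<lambda>x. g x * segment_kernel e \<beta> x a b)"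
proof (rule integrable_const_bound[of _ "1 * e powr - \<beta>"])
  show "AE x in \<nu>. norm (g x * segment_kernel e \<beta> x a b) \<le> 1 * e powr - \<beta>"
    using g_bound segment_kernel_le unfolding norm_mult
    by (intro always_eventually allI mult_mono) auto
qed measurable

lemma abs_g_integral_le:
  assumes f: "\<And>x. \<bar>f x\<bar> \<le> c" and [measurable]: "f \<in> borel_measurable borel"
  shows "\<bar>\<integral>x. g x * f x \<partial>\<nu>\<bar> \<le> c * measure \<nu> UNIV"
proof -
  have c0: "0 \<le> c" using f[of 0] by linarith
  have b: "\<bar>g x * f x\<bar> \<le> c" for x
    using mult_mono[OF g_bound[of x] f[of x]] c0 by (simp add: abs_mult)
  have "\<bar>\<integral>x. g x * f x \<partial>\<nu>\<bar> \<le> (\<integral>x. \<bar>g x * f x\<bar> \<partial>\<nu>)" by (rule integral_abs_bound)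
  also have "\<dots> \<le> (\<integral>x. c \<partial>\<nu>)"
  proof (rule integral_mono)
    show "integrable \<nu> (\<lambda>x. \<bar>g x * f x\<bar>)"
      by (rule integrable_const_bound[of _ c]) (use b in auto)
  qed (use b in auto)
  finally show ?thesis using sets_eq_imp_space_eq[OF sets] by (simp add: mult.commute)
qed

lemma v_bound: "\<bar>v a\<bar> \<le> e powr - \<beta> * measure \<nu> UNIV"
  unfolding v_def
proof (rule abs_g_integral_le)
  show "\<bar>(e + dist x a) powr - \<beta>\<bar> \<le> e powr - \<beta>" for x
    using segment_kernel_le[of x a a] by (simp add: segment_kernel_same)
qed measurable

lemma w_bound: "\<bar>w a b\<bar> \<le> dist a b * (e powr - \<beta> * measure \<nu> UNIV)"
  unfolding w_def abs_mult
proof (intro mult_mono abs_g_integral_le)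
  show "\<bar>b $ i - a $ i\<bar> \<le> dist a b"
    using component_le_norm_cart[of "b - a" i] by (simp add: dist_norm norm_minus_commute)
  show "\<bar>segment_kernel e \<beta> x a b\<bar> \<le> e powr - \<beta>" for x using segment_kernel_le by simp
qed auto

lemma w_antisym: "w b a = - w a b"
  unfolding w_def segment_kernel_commute[of _ _ _ b a] by (simp add: algebra_simps)

lemma integral_kernel_diff:
  assumes "\<And>x. \<bar>segment_kernel e \<beta> x a b - segment_kernel e \<beta> x a' b'\<bar> \<le> c"
  shows "\<bar>(\<integral>x. g x * segment_kernel e \<beta> x a b \<partial>\<nu>) - (\<integral>x. g x * segment_kernel e \<beta> x a' b' \<partial>\<nu>)\<bar>
    \<le> c * measure \<nu> UNIV"
proof -
  have "(\<integral>x. g x * segment_kernel e \<beta> x a b \<partial>\<nu>) - (\<integral>x. g x * segment_kernel e \<beta> x a' b' \<partial>\<nu>)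
      = (\<integral>x. g x * (segment_kernel e \<beta> x a b - segment_kernel e \<beta> x a' b') \<partial>\<nu>)"
    by (simp add: right_diff_distrib Bochner_Integration.integral_diff[OF integrable_kernel integrable_kernel])
  then show ?thesis using abs_g_integral_le[OF assms] by simp
qed

lemma kernel_lipschitz:
  "\<bar>segment_kernel e \<beta> x a b - segment_kernel e \<beta> x a' b'\<bar> \<le> e powr (- \<beta> - 1) * (dist a a' + dist b b')"
  for x :: "real^'n"
proof -
  have "\<bar>segment_kernel e \<beta> x a b - segment_kernel e \<beta> x a' b'\<bar> \<le> e powr (- \<beta> - 1) *
     \<bar>(e + dist x a / 2 + dist x b / 2) - (e + dist x a' / 2 + dist x b' / 2)\<bar>"
    unfolding segment_kernel_def by (rule powr_minus_lipschitz) (use e \<beta> in auto)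
  also have "\<dots> \<le> e powr (- \<beta> - 1) * (dist a a' + dist b b')"
  proof (rule mult_left_mono)
    have "\<bar>dist x a - dist x a'\<bar> \<le> dist a a'" "\<bar>dist x b - dist x b'\<bar> \<le> dist b b'"
      by (metis abs_dist_diff_le dist_commute)+
    then show "\<bar>(e + dist x a / 2 + dist x b / 2) - (e + dist x a' / 2 + dist x b' / 2)\<bar> \<le> dist a a' + dist b b'"
      by linarith
  qed simp
  finally show ?thesis .
qed

definition field_lipschitz :: real where "field_lipschitz = 2 * e powr (- \<beta> - 1) * measure \<nu> UNIV"

lemma field_lipschitz_nonneg: "0 \<le> field_lipschitz" by (simp add: field_lipschitz_def)

lemma v_eq: "v a = (\<integral>x. g x * segment_kernel e \<beta> x a a \<partial>\<nu>)"
  by (simp add: v_def segment_kernel_same)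

lemma v_lipschitz: "\<bar>v a - v b\<bar> \<le> field_lipschitz * dist a b"
  unfolding v_eq using integral_kernel_diff[OF kernel_lipschitz, of a a b b] by (simp add: field_lipschitz_def mult_ac)

lemma w_approx: "\<bar>w a b - v a * (b - a) $ i\<bar> \<le> field_lipschitz * dist a b * dist a b"
proof -
  have 1: "\<bar>(\<integral>x. g x * segment_kernel e \<beta> x a b \<partial>\<nu>) - v a\<bar> \<le> field_lipschitz * dist a b"
  proof -
    have "\<bar>(\<integral>x. g x * segment_kernel e \<beta> x a b \<partial>\<nu>) - v a\<bar> \<le> e powr (- \<beta> - 1) * dist a b * measure \<nu> UNIV"
      unfolding v_eq using integral_kernel_diff[OF kernel_lipschitz, of a b a a] by (simp add: dist_commute)
    also have "\<dots> \<le> field_lipschitz * dist a b" by (simp add: field_lipschitz_def mult_ac)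
    finally show ?thesis .
  qed
  have "w a b - v a * (b - a) $ i = ((\<integral>x. g x * segment_kernel e \<beta> x a b \<partial>\<nu>) - v a) * (b - a) $ i"
    by (simp add: w_def algebra_simps)
  then show ?thesis
    using mult_mono[OF 1 component_le_norm_cart[of "b - a" i]] field_lipschitz_nonneg
    by (simp add: abs_mult dist_norm norm_minus_commute)
qed

text \<open>
  The terms \<open>30 / (1 - \<beta>)\<close> and \<open>6\<close> are the constants of the near and of the far estimate, and the
  factor \<open>4\<close> comes from the sum over dyadic shells.
\<close>

definition loop_bound :: real where "loop_bound = 4 * (30 / (1 - \<beta>) + 6) * M"

text \<open>
  A chord-arc loop of length \<open>s\<close> produces a potential of size \<open>s\<^bsup>1-\<beta>\<^esup>\<close> on the ball of radius \<open>2 s\<close>,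
  whose \<open>\<nu>\<close>-measure is of order \<open>M s\<^bsup>\<beta>\<^esup>\<close>, and a rapidly decaying one outside. The total is of order
  \<open>M s\<close>.
\<close>

lemma chord_arc_loop_bound:
  assumes zs: "chord_arc_loop zs"
  shows "\<bar>chain_sum w zs + w (last zs) (hd zs)\<bar> \<le> loop_bound * chain_length zs"
proof (cases "chain_length zs = 0")
  case True
  have "\<bar>chain_sum w zs\<bar> \<le> chain_sum (\<lambda>a b. (e powr - \<beta> * measure \<nu> UNIV) * dist a b) zs"
    by (rule order_trans[OF chain_sum_abs chain_sum_mono]) (use w_bound in \<open>simp add: mult.commute\<close>)
  then have "chain_sum w zs = 0" by (simp add: chain_sum_scale True)
  moreover have "dist (last zs) (hd zs) = 0"
    using zs True by (simp add: chord_arc_loop_def dist_commute)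
  ultimately show ?thesis using True by (simp add: w_def)
next
  case False
  then have s: "0 < chain_length zs" using chain_sum_nonneg[of dist zs] by simp
  let ?K = "segment_kernel e \<beta>"
  define S where "S x = chain_sum (\<lambda>a b. (b $ i - a $ i) * ?K x a b) zs
      + (hd zs $ i - last zs $ i) * ?K x (last zs) (hd zs)" for x
  have comp: "\<bar>b $ i - a $ i\<bar> \<le> dist a b" for a b :: "real^'n"
    using component_le_norm_cart[of "b - a" i] by (simp add: dist_norm norm_minus_commute)
  have near: "\<bar>S x\<bar> \<le> 30 / (1 - \<beta>) * chain_length zs powr (1 - \<beta>)" for x
  proof -
    have *: "\<bar>(b $ i - a $ i) * ?K x a b\<bar> \<le> dist a b * ?K x a b" for a b
      unfolding abs_mult using comp by (intro mult_mono) auto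
    have "\<bar>chain_sum (\<lambda>a b. (b $ i - a $ i) * ?K x a b) zs\<bar> \<le> chain_sum (\<lambda>a b. dist a b * ?K x a b) zs"
      by (rule order_trans[OF chain_sum_abs chain_sum_mono]) (rule *)
    then have "\<bar>S x\<bar> \<le> chain_sum (\<lambda>a b. dist a b * ?K x a b) zs + dist (last zs) (hd zs) * ?K x (last zs) (hd zs)"
      unfolding S_def using *[of "hd zs" "last zs"] by linarith
    also have "\<dots> \<le> 30 / (1 - \<beta>) * chain_length zs powr (1 - \<beta>)" by (rule near_bound[OF e \<beta> zs])
    finally show ?thesis .
  qed
  have far: "\<bar>S x\<bar> \<le> 6 * (chain_length zs)\<^sup>2 * dist x (hd zs) powr (- \<beta> - 1)"
    if "2 * chain_length zs \<le> dist x (hd zs)" for x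
    unfolding S_def by (rule far_bound[OF e \<beta> zs s that comp])
  have int: "integrable \<nu> (\<lambda>x. g x * chain_sum (\<lambda>a b. (b $ i - a $ i) * ?K x a b) zs)
      \<and> chain_sum w zs = (\<integral>x. g x * chain_sum (\<lambda>a b. (b $ i - a $ i) * ?K x a b) zs \<partial>\<nu>)" for zs
  proof (induction zs rule: induct_list012)
    case (3 a b zs)
    have "integrable \<nu> (\<lambda>x. (b $ i - a $ i) * (g x * ?K x a b))"
      by (intro integrable_mult_right integrable_kernel)
    moreover have "w a b = (\<integral>x. (b $ i - a $ i) * (g x * ?K x a b) \<partial>\<nu>)" by (simp add: w_def)
    moreover have "g x * chain_sum (\<lambda>a b. (b $ i - a $ i) * ?K x a b) (a # b # zs)
        = (b $ i - a $ i) * (g x * ?K x a b) + g x * chain_sum (\<lambda>a b. (b $ i - a $ i) * ?K x a b) (b # zs)" for x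
      by (simp add: algebra_simps)
    moreover have "chain_sum w (a # b # zs) = w a b + chain_sum w (b # zs)" by simp
    ultimately show ?case using 3(2) by (simp only: Bochner_Integration.integral_add Bochner_Integration.integrable_add simp_thms)
  qed auto
  have int1: "integrable \<nu> (\<lambda>x. (hd zs $ i - last zs $ i) * (g x * ?K x (last zs) (hd zs)))"
    by (intro integrable_mult_right integrable_kernel)
  have gS: "g x * S x = g x * chain_sum (\<lambda>a b. (b $ i - a $ i) * ?K x a b) zs
      + (hd zs $ i - last zs $ i) * (g x * ?K x (last zs) (hd zs))" for x
    by (simp add: S_def algebra_simps)
  have intS: "integrable \<nu> (\<lambda>x. g x * S x)" and eq: "chain_sum w zs + w (last zs) (hd zs) = (\<integral>x. g x * S x \<partial>\<nu>)"
    unfolding gS using int[of zs] int1 by (simp_all add: w_def)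
  have "ennreal \<bar>chain_sum w zs + w (last zs) (hd zs)\<bar> \<le> (\<integral>\<^sup>+x. ennreal (norm (g x * S x)) \<partial>\<nu>)"
    unfolding eq using integral_norm_bound_ennreal[OF intS] by simp
  also have "\<dots> \<le> (\<integral>\<^sup>+x. ennreal \<bar>S x\<bar> \<partial>\<nu>)"
  proof (intro nn_integral_mono ennreal_leI)
    show "norm (g x * S x) \<le> \<bar>S x\<bar>" for x
      using mult_right_mono[OF g_bound[of x], of "\<bar>S x\<bar>"] by (simp add: abs_mult)
  qed
  also have "\<dots> \<le> ennreal (4 * (30 / (1 - \<beta>) + 6) * M * chain_length zs)"
    using \<beta> M by (intro morrey_decay_integral[OF sets ball \<beta> s _ _ M near far]) auto
  finally show ?thesis
    using M \<beta> s by (simp add: loop_bound_def)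
qed

lemma exists_potential_of_field:
  "\<exists>p. \<forall>a b. \<bar>p b - p a - w a b\<bar> \<le> 2 * loop_bound * dist a b"
  by (intro exists_potential w_antisym closed_chain_bound chord_arc_loop_bound)

end

section \<open>Truncated Riesz potentials\<close>

context bounded_vector_measure
begin

definition truncated_potential :: "real \<Rightarrow> real \<Rightarrow> 'n \<Rightarrow> real^'n \<Rightarrow> real" where
  "truncated_potential e \<beta> i x = SI i (\<lambda>y. (e + dist x y) powr - \<beta>)"

lemma kernel_integrable:
  assumes "0 < e" "0 < \<beta>"
  shows "integrable V (\<lambda>y. (e + dist x y) powr - \<beta>)"
proof (rule integrable_const_bound[of _ "e powr - \<beta>"])
  show "AE y in V. norm ((e + dist x y) powr - \<beta>) \<le> e powr - \<beta>"
    using assms by (intro always_eventually allI) (auto intro!: powr_mono2')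
qed measurable

lemma truncated_potential_measurable [measurable]:
  "truncated_potential e \<beta> i \<in> borel_measurable borel"
proof -
  have "(\<lambda>x. integral\<^sup>L U (\<lambda>y. (e + dist x y) powr - \<beta>)) \<in> borel_measurable borel"
    if U: "U \<le> V" "sets U = sets borel" for U
  proof -
    note [measurable_cong] = U(2)
    interpret U: finite_measure U by (rule finite_measure_le[OF U])
    show ?thesis by measurable
  qed
  from this[OF pos_le] this[OF neg_le] show ?thesis
    unfolding truncated_potential_def[abs_def] signed_integral_def by simp
qed

end

locale solenoidal_measure = bounded_vector_measure F for F :: "(real^'n) set \<Rightarrow> real^'n" +
  assumes div: "divergence_free F"

locale solenoidal_morrey = solenoidal_measure F + morrey_field \<nu> g i e \<beta> M
  for F :: "(real^'n) set \<Rightarrow> real^'n" and \<nu> g and i :: 'n and e \<beta> M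
begin

text \<open>
  The loop estimate provides a potential and the duality step applies to it; \<open>\<kappa>\<close> absorbs the
  difference between \<open>w\<close> and the field on short edges.
\<close>

lemma signed_integral_field_bound: "\<bar>SI i v\<bar> \<le> 4 * real CARD('n) * loop_bound * Sigma_Algebra.measure V UNIV"
proof -
  obtain p where p: "\<And>a b. \<bar>p b - p a - w a b\<bar> \<le> 2 * loop_bound * dist a b"
    using exists_potential_of_field by blast
  define W where "W = e powr - \<beta> * Sigma_Algebra.measure \<nu> UNIV"
  have bound: "\<bar>SI i v\<bar> \<le> 2 * real CARD('n) * (2 * loop_bound + \<kappa>) * Sigma_Algebra.measure V UNIV" if \<kappa>: "0 < \<kappa>" for \<kappa>
  proof (rule signed_integral_potential_bound[OF div])
    show "\<bar>p b - p a\<bar> \<le> (W + 2 * loop_bound) * dist a b" for a b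
      using p[of b a] w_bound[of a b] unfolding W_def[symmetric] distrib_right
      by (simp only: mult.commute[of "dist a b" W])
    \<comment> \<open>At this scale the first-order error of \<open>w\<close> is at most \<open>\<kappa>\<close> times the distance.\<close>
    show "0 < \<kappa> / (field_lipschitz + 1)" using \<kappa> field_lipschitz_nonneg by simp
    show "\<bar>p b - p a - v a * (b - a) $ i\<bar> \<le> (2 * loop_bound + \<kappa>) * dist a b" if "dist a b < \<kappa> / (field_lipschitz + 1)" for a b
    proof -
      have "(field_lipschitz + 1) * dist a b < \<kappa>" using that field_lipschitz_nonneg by (simp add: field_simps)
      then have "field_lipschitz * dist a b \<le> \<kappa>" using zero_le_dist[of a b] unfolding distrib_right by linarith
      then have "field_lipschitz * dist a b * dist a b \<le> \<kappa> * dist a b" by (intro mult_right_mono) auto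
      then show ?thesis using p[of b a] w_approx[of a b] unfolding distrib_right by linarith
    qed
    show "uniformly_continuous_on UNIV v"
    proof (rule lipschitz_on_uniformly_continuous)
      show "field_lipschitz-lipschitz_on UNIV v"
        using v_lipschitz field_lipschitz_nonneg by (intro lipschitz_onI) (simp_all add: dist_real_def)
    qed
    show "\<bar>v a\<bar> \<le> W" for a unfolding W_def by (rule v_bound)
  qed
  have "((\<lambda>\<kappa>. 2 * real CARD('n) * (2 * loop_bound + \<kappa>) * Sigma_Algebra.measure V UNIV) \<longlongrightarrow>
      2 * real CARD('n) * (2 * loop_bound + 0) * Sigma_Algebra.measure V UNIV) (at_right 0)"
    by (intro tendsto_intros)
  then have "\<bar>SI i v\<bar> \<le> 2 * real CARD('n) * (2 * loop_bound + 0) * Sigma_Algebra.measure V UNIV"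
    by (rule tendsto_lowerbound) (use bound in \<open>auto intro!: eventually_at_rightI[of 0 1]\<close>)
  then show ?thesis by simp
qed

lemma fubini_kernel:
  assumes U: "U \<le> V" "sets U = sets borel"
  shows "(\<integral>x. g x * (\<integral>y. (e + dist x y) powr - \<beta> \<partial>U) \<partial>\<nu>) = integral\<^sup>L U v"
proof -
  have sU [measurable_cong]: "sets U = sets borel" by (rule U)
  interpret U: finite_measure U by (rule finite_measure_le[OF U])
  interpret P: pair_sigma_finite \<nu> U ..
  interpret PF: finite_measure "\<nu> \<Otimes>\<^sub>M U" by (rule finite_measure_pair_measure) unfold_locales
  have "integrable (\<nu> \<Otimes>\<^sub>M U) (\<lambda>(x, y). g x * (e + dist x y) powr - \<beta>)"
  proof (rule PF.integrable_const_bound[of _ "1 * e powr - \<beta>"])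
    have "(e + dist x y) powr - \<beta> \<le> e powr - \<beta>" for x y :: "real^'n"
      using segment_kernel_le[of x y y] by (simp add: segment_kernel_same)
    then have "\<bar>g x * (e + dist x y) powr - \<beta>\<bar> \<le> 1 * e powr - \<beta>" for x y
      unfolding abs_mult by (intro mult_mono g_bound) auto
    then show "AE z in \<nu> \<Otimes>\<^sub>M U. norm (case z of (x, y) \<Rightarrow> g x * (e + dist x y) powr - \<beta>) \<le> 1 * e powr - \<beta>"
      by (intro always_eventually allI) (auto split: prod.split)
  qed measurable
  from P.Fubini_integral[OF this] show ?thesis by (simp add: v_def[abs_def])
qed

end

context solenoidal_measure
begin

text \<open>
  Duality: with \<open>g\<close> the sign of the potential, Fubini's theorem turns its \<open>L\<^sup>1(\<nu>)\<close> norm into the integral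
  of the field \<open>v e\<^sub>i\<close> against \<open>F\<close>.
\<close>

lemma truncated_trace_inequality:
  fixes \<nu> :: "(real^'n) measure"
  assumes \<nu>: "finite_measure \<nu>" "sets \<nu> = sets borel"
    and ball: "\<And>x r. 0 < r \<Longrightarrow> emeasure \<nu> (ball x r) \<le> ennreal (M * r powr \<beta>)"
    and e: "0 < e" and \<beta>: "0 < \<beta>" "\<beta> < 1" and M: "0 \<le> M"
  shows "(\<integral>\<^sup>+x. ennreal \<bar>truncated_potential e \<beta> i x\<bar> \<partial>\<nu>)
    \<le> ennreal (16 * real CARD('n) * (30 / (1 - \<beta>) + 6) * M * Sigma_Algebra.measure V UNIV)"
proof -
  let ?T = "truncated_potential e \<beta> i"
  define g where "g x = sgn (?T x)" for x
  note [measurable_cong] = \<nu>(2)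
  have gm: "g \<in> borel_measurable borel" unfolding g_def[abs_def] by measurable
  interpret S: solenoidal_morrey F \<nu> g i e \<beta> M
  proof (intro solenoidal_morrey.intro solenoidal_measure_axioms morrey_field.intro)
    show "\<bar>g x\<bar> \<le> 1" for x by (simp add: g_def sgn_real_def)
  qed (fact \<nu> ball gm e \<beta> M)+
  have b: "\<bar>?T x\<bar> \<le> 2 * (e powr - \<beta> * Sigma_Algebra.measure V UNIV)" for x
  proof -
    have "\<bar>?T x\<bar> \<le> 2 * (\<integral>y. \<bar>(e + dist x y) powr - \<beta>\<bar> \<partial>V)"
      unfolding truncated_potential_def by (rule abs_signed_integral_le[OF kernel_integrable[OF e \<beta>(1)]])
    also have "(\<integral>y. \<bar>(e + dist x y) powr - \<beta>\<bar> \<partial>V) \<le> (\<integral>y. e powr - \<beta> \<partial>V)"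
      using e \<beta> by (intro integral_mono integrable_abs kernel_integrable) (auto intro!: powr_mono2')
    finally show ?thesis by (simp add: mult.commute)
  qed
  have T_int: "integrable \<nu> ?T"
    by (rule S.integrable_const_bound[where B = "2 * (e powr - \<beta> * Sigma_Algebra.measure V UNIV)"]) (use b in auto)
  have part: "integrable \<nu> (\<lambda>x. g x * integral\<^sup>L U (\<lambda>y. (e + dist x y) powr - \<beta>))"
    if U: "U \<le> V" "sets U = sets borel" for U
  proof (rule S.integrable_const_bound[where B = "1 * (\<integral>y. e powr - \<beta> \<partial>V)"])
    note [measurable_cong] = U(2)
    interpret U: finite_measure U by (rule finite_measure_le[OF U])
    have "\<bar>integral\<^sup>L U (\<lambda>y. (e + dist x y) powr - \<beta>)\<bar> \<le> (\<integral>y. e powr - \<beta> \<partial>V)" for x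
    proof (rule order_trans[OF integral_abs_le(2)[OF U kernel_integrable[OF e \<beta>(1)]]])
      show "(\<integral>y. \<bar>(e + dist x y) powr - \<beta>\<bar> \<partial>V) \<le> (\<integral>y. e powr - \<beta> \<partial>V)"
        using e \<beta> by (intro integral_mono integrable_abs kernel_integrable) (auto intro!: powr_mono2')
    qed
    then have "\<bar>g x * integral\<^sup>L U (\<lambda>y. (e + dist x y) powr - \<beta>)\<bar> \<le> 1 * (\<integral>y. e powr - \<beta> \<partial>V)" for x
      unfolding abs_mult by (intro mult_mono S.g_bound) auto
    then show "AE x in \<nu>. norm (g x * integral\<^sup>L U (\<lambda>y. (e + dist x y) powr - \<beta>)) \<le> 1 * (\<integral>y. e powr - \<beta> \<partial>V)"
      by (intro always_eventually allI) simp
    show "(\<lambda>x. g x * integral\<^sup>L U (\<lambda>y. (e + dist x y) powr - \<beta>)) \<in> borel_measurable \<nu>"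
      using gm by measurable
  qed
  have "(\<integral>x. \<bar>?T x\<bar> \<partial>\<nu>) = (\<integral>x. g x * ?T x \<partial>\<nu>)"
    by (simp add: g_def abs_sgn mult.commute)
  also have "\<dots> = SI i S.v"
    unfolding truncated_potential_def signed_integral_def right_diff_distrib
    by (simp only: Bochner_Integration.integral_diff[OF part[OF pos_le sets_upper_variation] part[OF neg_le sets_upper_variation]]
        S.fubini_kernel[OF pos_le sets_upper_variation] S.fubini_kernel[OF neg_le sets_upper_variation])
  also have "\<dots> \<le> 4 * real CARD('n) * S.loop_bound * Sigma_Algebra.measure V UNIV"
    using S.signed_integral_field_bound by linarith
  finally have "(\<integral>x. \<bar>?T x\<bar> \<partial>\<nu>) \<le> 16 * real CARD('n) * (30 / (1 - \<beta>) + 6) * M * Sigma_Algebra.measure V UNIV"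
    by (simp add: S.loop_bound_def mult_ac)
  then show ?thesis using T_int by (subst nn_integral_eq_integral) (auto intro: ennreal_leI)
qed

end

section \<open>The logarithmic kernel\<close>

text \<open>
  Truncation at both ends makes the field bounded and Lipschitz, as the duality step requires.
\<close>

definition clipped_log :: "real \<Rightarrow> real \<Rightarrow> real" where
  "clipped_log N t = ln (max (1 / N) (min N t))"

lemma clipped_log_increment:
  assumes N: "1 \<le> N" and t: "0 \<le> t" "t \<le> t'"
  shows "clipped_log N t \<le> clipped_log N t'"
    and "t * (clipped_log N t' - clipped_log N t) \<le> t' - t"
    and "clipped_log N t' - clipped_log N t \<le> N * (t' - t)"
proof -
  define u u' where "u = max (1 / N) (min N t)" and "u' = max (1 / N) (min N t')"
  have uN: "1 / N \<le> u" by (simp add: u_def)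
  moreover have "0 < 1 / N" using N by simp
  ultimately have u0: "0 < u" by linarith
  have uu: "u \<le> u'" "u' - u \<le> t' - t" using t by (auto simp: u_def u'_def max_def min_def)
  have ln: "clipped_log N t' - clipped_log N t \<le> (u' - u) / u"
    unfolding clipped_log_def u_def[symmetric] u'_def[symmetric] using u0 uu by (intro ln_diff_le) auto
  show "clipped_log N t \<le> clipped_log N t'"
    unfolding clipped_log_def u_def[symmetric] u'_def[symmetric] using u0 uu by simp
  have "(u' - u) / u \<le> N * (u' - u)"
  proof -
    have "1 \<le> N * u" using uN N by (simp add: field_simps)
    then have "1 * (u' - u) \<le> N * u * (u' - u)" using uu by (intro mult_right_mono) auto
    then show ?thesis using u0 by (simp add: field_simps)
  qed
  also have "\<dots> \<le> N * (t' - t)" using uu N by (intro mult_left_mono) auto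
  finally show "clipped_log N t' - clipped_log N t \<le> N * (t' - t)" using ln by linarith
  show "t * (clipped_log N t' - clipped_log N t) \<le> t' - t"
  proof (cases "t \<le> N")
    case True
    then have "t \<le> u" by (simp add: u_def)
    have "t * (clipped_log N t' - clipped_log N t) \<le> t * ((u' - u) / u)"
      using ln t by (intro mult_left_mono)
    also have "\<dots> \<le> u * ((u' - u) / u)"
      using \<open>t \<le> u\<close> uu u0 by (intro mult_right_mono) auto
    also have "\<dots> = u' - u" using u0 by simp
    finally show ?thesis using uu by linarith
  next
    case False
    then show ?thesis using t by (simp add: clipped_log_def)
  qed
qed

lemma clipped_log_bound: "1 \<le> N \<Longrightarrow> \<bar>clipped_log N t\<bar> \<le> ln N"
proof -
  assume N: "1 \<le> N"
  let ?u = "max (1 / N) (min N t)"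
  have pos: "0 < 1 / N" using N by simp
  have "1 / N \<le> N" using N by (simp add: field_simps) (smt (verit) mult_le_cancel_left1)
  then have u: "1 / N \<le> ?u" "?u \<le> N" by auto
  have "ln (1 / N) \<le> ln ?u" using u pos by (subst ln_le_cancel_iff) linarith+
  moreover have "ln ?u \<le> ln N" using u pos by (subst ln_le_cancel_iff) linarith+
  ultimately show ?thesis using N by (simp add: clipped_log_def ln_div abs_le_iff)
qed

lemma clipped_log_le_ln:
  assumes N: "1 \<le> N" and t: "0 < t"
  shows "\<bar>clipped_log N t\<bar> \<le> \<bar>ln t\<bar>"
proof -
  have lN: "ln (1 / N) = - ln N" "0 \<le> ln N" using N by (auto simp: ln_div)
  have NN: "1 / N \<le> N" using N by (simp add: field_simps) (smt (verit) mult_le_cancel_left1)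
  consider "t \<le> 1 / N" | "1 / N \<le> t" "t \<le> N" | "N \<le> t" by linarith
  then show ?thesis
  proof cases
    case 1
    then have "ln t \<le> - ln N" using t N lN(1) by (metis ln_mono order_less_le_trans)
    moreover have "clipped_log N t = - ln N" using 1 NN lN(1) by (simp add: clipped_log_def)
    ultimately show ?thesis using lN by linarith
  next
    case 2
    then show ?thesis by (simp add: clipped_log_def)
  next
    case 3
    then have "ln N \<le> ln t" using N by simp
    moreover have "clipped_log N t = ln N" using 3 NN by (simp add: clipped_log_def)
    ultimately show ?thesis using lN by linarith
  qed
qed

lemma clipped_log_tendsto:
  assumes "0 < t"
  shows "(\<lambda>n. clipped_log (real (Suc n)) t) \<longlonglongrightarrow> ln t"
proof (rule tendsto_eventually)
  have "eventually (\<lambda>n. t < real (Suc n)) sequentially" "eventually (\<lambda>n. 1 / t < real (Suc n)) sequentially"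
    using filterlim_compose[OF filterlim_real_sequentially filterlim_Suc]
    by (auto simp: filterlim_at_top_dense)
  then show "\<forall>\<^sub>F n in sequentially. clipped_log (real (Suc n)) t = ln t"
  proof eventually_elim
    case (elim n)
    then have "1 / real (Suc n) \<le> t" using assms by (simp add: field_simps)
    then show ?case using elim by (simp add: clipped_log_def max_def min_def)
  qed
qed

context solenoidal_measure
begin

text \<open>
  Here a potential can be written down: for \<open>p y = (y\<^sub>i - x\<^sub>i) * log |x - y|\<close> the gradient differs from
  \<open>log |x - y| e\<^sub>i\<close> by \<open>(y\<^sub>i - x\<^sub>i) \<nabla> log |x - y|\<close>, which is bounded by \<open>1\<close>. Clipping the logarithm
  preserves this, since \<open>t\<close> times the slope of the clipped logarithm is still at most \<open>1\<close>.
\<close>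

lemma signed_integral_clipped_log_bound:
  assumes N: "1 \<le> N"
  shows "\<bar>SI i (\<lambda>y. clipped_log N (dist x y))\<bar> \<le> 4 * real CARD('n) * measure V UNIV"
proof -
  define v where "v y = clipped_log N (dist x y)" for y
  define p where "p y = (y $ i - x $ i) * v y" for y
  have comp: "\<bar>b $ i - a $ i\<bar> \<le> dist a b" for a b :: "real^'n"
    using component_le_norm_cart[of "b - a" i] by (simp add: dist_norm norm_minus_commute)
  have tri: "\<bar>dist x a - dist x b\<bar> \<le> dist a b" for a b by (metis abs_dist_diff_le dist_commute)
  have v_lip: "\<bar>v a - v b\<bar> \<le> N * dist a b" for a b
  proof -
    have *: "\<bar>clipped_log N t - clipped_log N t'\<bar> \<le> N * \<bar>t - t'\<bar>" if "0 \<le> t" "t \<le> t'" for t t'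
      using clipped_log_increment[OF N that] that by (simp add: abs_le_iff)
    have "\<bar>v a - v b\<bar> \<le> N * \<bar>dist x a - dist x b\<bar>"
      unfolding v_def using *[of "dist x a" "dist x b"] *[of "dist x b" "dist x a"]
      by (cases "dist x a \<le> dist x b") (auto simp: abs_minus_commute)
    also have "\<dots> \<le> N * dist a b" using tri N by (intro mult_left_mono) auto
    finally show ?thesis .
  qed
  have v_bound: "\<bar>v a\<bar> \<le> ln N" for a unfolding v_def by (rule clipped_log_bound[OF N])
  have min_diff: "min (dist x a) (dist x b) * \<bar>v b - v a\<bar> \<le> dist a b" for a b
  proof (cases "dist x a \<le> dist x b")
    case True
    with clipped_log_increment(1,2)[OF N zero_le_dist True] tri[of a b]
    show ?thesis by (simp add: v_def)
  next
    case False
    then have "dist x b \<le> dist x a" by simp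
    from this clipped_log_increment(1,2)[OF N zero_le_dist this] tri[of a b]
    show ?thesis by (simp add: v_def abs_minus_commute)
  qed
  have p_diff: "\<bar>p b - p a - v a * (b - a) $ i\<bar> \<le> dist a b + dist a b * \<bar>v b - v a\<bar>" for a b
  proof -
    have "p b - p a - v a * (b - a) $ i = (b $ i - x $ i) * (v b - v a)" by (simp add: p_def algebra_simps)
    then have "\<bar>p b - p a - v a * (b - a) $ i\<bar> \<le> dist x b * \<bar>v b - v a\<bar>"
      using mult_right_mono[OF comp[of b x], of "\<bar>v b - v a\<bar>"] by (simp add: abs_mult)
    also have "\<dots> \<le> (min (dist x a) (dist x b) + dist a b) * \<bar>v b - v a\<bar>"
      using tri[of a b] by (intro mult_right_mono) (auto simp: min_def)
    also have "\<dots> \<le> dist a b + dist a b * \<bar>v b - v a\<bar>"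
      using min_diff[of a b] by (simp add: distrib_right)
    finally show ?thesis .
  qed
  have "\<bar>SI i v\<bar> \<le> 2 * real CARD('n) * 2 * measure V UNIV"
  proof (rule signed_integral_potential_bound[OF div])
    show "\<bar>p b - p a\<bar> \<le> (1 + 3 * ln N) * dist a b" for a b
    proof -
      have "\<bar>v a * (b - a) $ i\<bar> \<le> ln N * dist a b"
        unfolding abs_mult using v_bound[of a] comp[where a=a and b=b] by (intro mult_mono) auto
      moreover have "dist a b * \<bar>v b - v a\<bar> \<le> dist a b * (2 * ln N)"
        using v_bound[of a] v_bound[of b] by (intro mult_left_mono) auto
      ultimately show ?thesis using p_diff[of b a] by (simp add: algebra_simps)
    qed
    show "0 < 1 / N" using N by simp
    show "\<bar>p b - p a - v a * (b - a) $ i\<bar> \<le> 2 * dist a b" if "dist a b < 1 / N" for a b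
    proof -
      have "N * dist a b \<le> 1" using that N by (simp add: field_simps)
      then have "\<bar>v b - v a\<bar> \<le> 1" using v_lip[of b a] by (simp add: dist_commute)
      then have "dist a b * \<bar>v b - v a\<bar> \<le> dist a b * 1" by (intro mult_left_mono) auto
      then show ?thesis using p_diff[of b a] by simp
    qed
    show "uniformly_continuous_on UNIV v"
    proof (rule lipschitz_on_uniformly_continuous)
      show "N-lipschitz_on UNIV v"
        using v_lip N by (intro lipschitz_onI) (simp_all add: dist_real_def)
    qed
    show "\<bar>v a\<bar> \<le> ln N" for a by (rule v_bound)
  qed
  then show ?thesis unfolding v_def by simp
qed

text \<open>
  For \<open>\<alpha> = d\<close> the potential is bounded at every point, so that only the total mass of \<open>\<nu>\<close> matters.
\<close>

lemma riesz_potential_log_bound: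
  assumes c: "0 < c"
  shows "norm (riesz_potential c (real CARD('n)) F x) \<le> real CARD('n) * (c * (4 * real CARD('n) * measure V UNIV))"
proof (cases "riesz_converges c (real CARD('n)) F x")
  case True
  let ?f = "\<lambda>y. riesz_kernel c (real CARD('n)) (x - y)"
  have f: "?f = (\<lambda>y. - c * ln (dist x y))" by (simp add: riesz_kernel_def dist_norm)
  have "\<bar>SI i ?f\<bar> \<le> c * (4 * real CARD('n) * measure V UNIV)" for i
  proof -
    have "(\<lambda>n. SI i (\<lambda>y. - c * clipped_log (real (Suc n)) (dist x y))) \<longlonglongrightarrow> SI i ?f"
    proof (rule signed_integral_tendsto)
      show "emeasure V {x} = 0" "integrable V ?f" using True by (auto simp: riesz_converges_def)
      show "(\<lambda>y. - c * clipped_log (real (Suc n)) (dist x y)) \<in> borel_measurable borel" for n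
        unfolding clipped_log_def by measurable
      show "\<bar>- c * clipped_log (real (Suc n)) (dist x y)\<bar> \<le> \<bar>?f y\<bar>" if "y \<noteq> x" for n y
        unfolding fun_cong[OF f] abs_mult using that by (intro mult_left_mono clipped_log_le_ln) auto
      show "(\<lambda>n. - c * clipped_log (real (Suc n)) (dist x y)) \<longlonglongrightarrow> ?f y" if "y \<noteq> x" for y
        unfolding fun_cong[OF f] using that by (intro tendsto_mult tendsto_const clipped_log_tendsto) auto
    qed
    then have "(\<lambda>n. \<bar>SI i (\<lambda>y. - c * clipped_log (real (Suc n)) (dist x y))\<bar>) \<longlonglongrightarrow> \<bar>SI i ?f\<bar>"
      by (rule tendsto_rabs)
    then show ?thesis
    proof (rule LIMSEQ_le_const2, intro exI allI impI)
      fix n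
      have "\<bar>SI i (\<lambda>y. clipped_log (real (Suc n)) (dist x y))\<bar> \<le> 4 * real CARD('n) * measure V UNIV"
        by (rule signed_integral_clipped_log_bound) simp
      then show "\<bar>SI i (\<lambda>y. - c * clipped_log (real (Suc n)) (dist x y))\<bar> \<le> c * (4 * real CARD('n) * measure V UNIV)"
        unfolding signed_integral_scale abs_mult using c by simp
    qed
  qed
  then have "(\<Sum>i\<in>UNIV. \<bar>riesz_potential c (real CARD('n)) F x $ i\<bar>)
      \<le> (\<Sum>i\<in>(UNIV::'n set). c * (4 * real CARD('n) * measure V UNIV))"
    using True by (intro sum_mono) (simp add: riesz_potential_def)
  then show ?thesis using norm_le_l1_cart[of "riesz_potential c (real CARD('n)) F x"] by simp
next
  case False
  then show ?thesis using c by (simp add: riesz_potential_def)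
qed

end

section \<open>Removal of the truncation\<close>

context bounded_vector_measure
begin

lemma riesz_potential_power_limit:
  assumes \<alpha>: "0 < \<alpha>" "\<alpha> < real CARD('n)" and x: "riesz_converges c \<alpha> F x"
  defines "A \<equiv> Gamma ((real CARD('n) - \<alpha>) / 2) / (pi powr (real CARD('n) / 2) * 2 powr \<alpha> * Gamma (\<alpha> / 2))"
  shows "(\<lambda>n. A * truncated_potential (1 / real (Suc n)) (real CARD('n) - \<alpha>) i x)
    \<longlonglongrightarrow> riesz_potential c \<alpha> F x $ i"
proof -
  let ?\<beta> = "real CARD('n) - \<alpha>"
  have f: "(\<lambda>y. riesz_kernel c \<alpha> (x - y)) = (\<lambda>y. A * dist x y powr - ?\<beta>)"
    using \<alpha> by (simp add: riesz_kernel_def A_def dist_norm Let_def)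
  have "(\<lambda>n. SI i (\<lambda>y. A * (1 / real (Suc n) + dist x y) powr - ?\<beta>)) \<longlonglongrightarrow> SI i (\<lambda>y. A * dist x y powr - ?\<beta>)"
  proof (rule signed_integral_tendsto)
    show "emeasure V {x} = 0" "integrable V (\<lambda>y. A * dist x y powr - ?\<beta>)"
      using x unfolding riesz_converges_def f by auto
    show "(\<lambda>y. A * (1 / real (Suc n) + dist x y) powr - ?\<beta>) \<in> borel_measurable borel" for n by measurable
    show "\<bar>A * (1 / real (Suc n) + dist x y) powr - ?\<beta>\<bar> \<le> \<bar>A * dist x y powr - ?\<beta>\<bar>" if "y \<noteq> x" for n y
      unfolding abs_mult using that \<alpha> by (auto intro!: mult_left_mono powr_mono2')
    show "(\<lambda>n. A * (1 / real (Suc n) + dist x y) powr - ?\<beta>) \<longlonglongrightarrow> A * dist x y powr - ?\<beta>" if "y \<noteq> x" for y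
    proof -
      have "(\<lambda>n. A * (1 / real (Suc n) + dist x y) powr - ?\<beta>) \<longlonglongrightarrow> A * (0 + dist x y) powr - ?\<beta>"
        using that by (intro tendsto_intros LIMSEQ_Suc[OF lim_1_over_n]) auto
      then show ?thesis by simp
    qed
  qed
  then show ?thesis
    using x by (simp add: riesz_potential_def f signed_integral_scale truncated_potential_def)
qed

end

context solenoidal_measure
begin

text \<open>
  Fatou's lemma removes the truncation of the kernel and, at the same time, the restriction of \<open>\<nu>\<close> to
  a ball, which is what makes it finite. At points where the potential does not converge its value
  is \<open>0\<close>, so the limit inferior dominates it everywhere.
\<close>

lemma trace_inequality_power:
  fixes \<nu> :: "(real^'n) measure"
  assumes \<alpha>: "real CARD('n) - 1 < \<alpha>" "\<alpha> < real CARD('n)"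
    and sets [measurable_cong]: "sets \<nu> = sets borel" and M: "0 \<le> M"
    and ball: "\<And>x r. 0 < r \<Longrightarrow> emeasure \<nu> (ball x r) \<le> ennreal (M * r powr (real CARD('n) - \<alpha>))"
  defines "A \<equiv> Gamma ((real CARD('n) - \<alpha>) / 2) / (pi powr (real CARD('n) / 2) * 2 powr \<alpha> * Gamma (\<alpha> / 2))"
  shows "(\<integral>\<^sup>+x. ennreal (norm (riesz_potential c \<alpha> F x)) \<partial>\<nu>) \<le>
    ennreal (real CARD('n) * (A * (16 * real CARD('n) * (30 / (1 - (real CARD('n) - \<alpha>)) + 6) * M * measure V UNIV)))"
proof -
  define \<beta> where "\<beta> = real CARD('n) - \<alpha>"
  have \<beta>: "0 < \<beta>" "\<beta> < 1" using \<alpha> by (auto simp: \<beta>_def)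
  have "1 \<le> CARD('n)" by (simp add: Suc_le_eq)
  then have \<alpha>0: "0 < \<alpha>" using \<alpha> by linarith
  have A: "0 < A" unfolding A_def using \<alpha> \<alpha>0 by (intro divide_pos_pos mult_pos_pos Gamma_real_pos) auto
  define Q where "Q = A * (16 * real CARD('n) * (30 / (1 - \<beta>) + 6) * M * measure V UNIV)"
  define u where "u i n x = ennreal (A * \<bar>truncated_potential (1 / real (Suc n)) \<beta> i x\<bar>) * indicator (ball 0 (real (Suc n))) x"
    for i n and x :: "real^'n"
  have u_meas [measurable]: "u i n \<in> borel_measurable \<nu>" for i n
  proof -
    have [measurable]: "ball (0::real^'n) (real (Suc n)) \<in> sets borel" by simp
    show ?thesis unfolding u_def[abs_def] by measurable
  qed
  have u_int: "(\<integral>\<^sup>+x. u i n x \<partial>\<nu>) \<le> ennreal Q" for i n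
  proof -
    let ?B = "ball 0 (real (Suc n)) :: (real^'n) set"
    let ?T = "truncated_potential (1 / real (Suc n)) \<beta> i"
    define \<nu>' where "\<nu>' = density \<nu> (indicator ?B)"
    have B [measurable]: "?B \<in> sets \<nu>" by (simp add: sets)
    have em: "emeasure \<nu>' X = emeasure \<nu> (?B \<inter> X)" if "X \<in> sets borel" for X
      unfolding \<nu>'_def using that B by (subst emeasure_density) (auto simp: sets indicator_inter_arith[symmetric] simp del: of_nat_Suc)
    have "(\<integral>\<^sup>+x. u i n x \<partial>\<nu>) = (\<integral>\<^sup>+x. ennreal A * (indicator ?B x * ennreal \<bar>?T x\<bar>) \<partial>\<nu>)"
      unfolding u_def using A by (intro nn_integral_cong) (simp add: ennreal_mult mult_ac)
    also have "\<dots> = ennreal A * (\<integral>\<^sup>+x. indicator ?B x * ennreal \<bar>?T x\<bar> \<partial>\<nu>)"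
      by (rule nn_integral_cmult) measurable
    also have "(\<integral>\<^sup>+x. indicator ?B x * ennreal \<bar>?T x\<bar> \<partial>\<nu>) = (\<integral>\<^sup>+x. ennreal \<bar>?T x\<bar> \<partial>\<nu>')"
      unfolding \<nu>'_def by (rule nn_integral_density[symmetric]) measurable
    also have "\<dots> \<le> ennreal (16 * real CARD('n) * (30 / (1 - \<beta>) + 6) * M * measure V UNIV)"
    proof (rule truncated_trace_inequality)
      show "sets \<nu>' = sets borel" by (simp add: \<nu>'_def sets)
      then have "space \<nu>' = UNIV" using sets_eq_imp_space_eq by fastforce
      moreover have "emeasure \<nu> ?B \<noteq> \<infinity>"
        using ball[of "real (Suc n)" 0] by (auto simp: top_unique simp del: of_nat_Suc)
      ultimately show "finite_measure \<nu>'" by (intro finite_measureI) (simp add: em del: of_nat_Suc)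
      show "emeasure \<nu>' (ball x r) \<le> ennreal (M * r powr \<beta>)" if "0 < r" for x r
      proof -
        have "emeasure \<nu>' (ball x r) \<le> emeasure \<nu> (ball x r)"
          unfolding em[OF borel_open[OF open_ball]] by (rule emeasure_mono) (auto simp: sets)
        also note ball[OF that]
        finally show ?thesis by (simp add: \<beta>_def)
      qed
    qed (use \<beta> M in auto)
    finally show ?thesis using A by (simp add: Q_def ennreal_mult'[symmetric] mult_left_mono)
  qed
  have pt: "ennreal (norm (riesz_potential c \<alpha> F x)) \<le> (\<Sum>i\<in>UNIV. liminf (\<lambda>n. u i n x))" for x
  proof (cases "riesz_converges c \<alpha> F x")
    case True
    have lim: "liminf (\<lambda>n. u i n x) = ennreal \<bar>riesz_potential c \<alpha> F x $ i\<bar>" for i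
    proof (rule lim_imp_Liminf)
      have "(\<lambda>n. ennreal \<bar>A * truncated_potential (1 / real (Suc n)) \<beta> i x\<bar>) \<longlonglongrightarrow> ennreal \<bar>riesz_potential c \<alpha> F x $ i\<bar>"
        unfolding A_def \<beta>_def
        by (intro tendsto_ennrealI tendsto_rabs riesz_potential_power_limit \<alpha>0 \<alpha> True)
      moreover have "eventually (\<lambda>n. norm x < real (Suc n)) sequentially"
        using filterlim_compose[OF filterlim_real_sequentially filterlim_Suc]
        by (auto simp: filterlim_at_top_dense)
      then have "eventually (\<lambda>n. ennreal \<bar>A * truncated_potential (1 / real (Suc n)) \<beta> i x\<bar> = u i n x) sequentially"
        by eventually_elim (use A in \<open>simp add: u_def abs_mult\<close>)
      ultimately show "(\<lambda>n. u i n x) \<longlonglongrightarrow> ennreal \<bar>riesz_potential c \<alpha> F x $ i\<bar>"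
        by (rule Lim_transform_eventually)
    qed simp
    have "ennreal (norm (riesz_potential c \<alpha> F x)) \<le> ennreal (\<Sum>i\<in>UNIV. \<bar>riesz_potential c \<alpha> F x $ i\<bar>)"
      by (intro ennreal_leI norm_le_l1_cart)
    then show ?thesis unfolding lim by simp
  qed (simp add: riesz_potential_def)
  have "(\<integral>\<^sup>+x. ennreal (norm (riesz_potential c \<alpha> F x)) \<partial>\<nu>) \<le> (\<integral>\<^sup>+x. (\<Sum>i\<in>UNIV. liminf (\<lambda>n. u i n x)) \<partial>\<nu>)"
    by (intro nn_integral_mono pt)
  also have "\<dots> = (\<Sum>i\<in>UNIV. \<integral>\<^sup>+x. liminf (\<lambda>n. u i n x) \<partial>\<nu>)"
    by (rule nn_integral_sum) measurable
  also have "\<dots> \<le> (\<Sum>i\<in>(UNIV::'n set). ennreal Q)"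
  proof (rule sum_mono)
    fix i
    have "(\<integral>\<^sup>+x. liminf (\<lambda>n. u i n x) \<partial>\<nu>) \<le> liminf (\<lambda>n. \<integral>\<^sup>+x. u i n x \<partial>\<nu>)"
      by (rule nn_integral_liminf) (rule u_meas)
    also have "\<dots> \<le> liminf (\<lambda>n. ennreal Q)"
      by (intro Liminf_mono always_eventually allI u_int)
    finally show "(\<integral>\<^sup>+x. liminf (\<lambda>n. u i n x) \<partial>\<nu>) \<le> ennreal Q" by (simp add: Liminf_const)
  qed
  also have "\<dots> = ennreal (real CARD('n) * Q)"
    by (simp add: ennreal_mult' ennreal_of_nat_eq_real_of_nat)
  finally show ?thesis by (simp add: Q_def \<beta>_def)
qed

end

section \<open>The trace inequality\<close>

lemma emeasure_ball_le_morrey_norm: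
  assumes "0 < r"
  shows "emeasure \<nu> (ball x r) \<le> morrey_norm \<beta> \<nu> * ennreal (r powr \<beta>)"
proof -
  have p: "0 < ennreal (r powr \<beta>)" using assms by simp
  have "emeasure \<nu> (ball x r) / ennreal (r powr \<beta>) \<le> morrey_norm \<beta> \<nu>"
    unfolding morrey_norm_def using assms by (intro SUP_upper2[of x] SUP_upper2[of r]) auto
  then have "emeasure \<nu> (ball x r) / ennreal (r powr \<beta>) * ennreal (r powr \<beta>) \<le> morrey_norm \<beta> \<nu> * ennreal (r powr \<beta>)"
    by (rule mult_right_mono) simp
  moreover have "emeasure \<nu> (ball x r) / ennreal (r powr \<beta>) * ennreal (r powr \<beta>) = emeasure \<nu> (ball x r)"
    unfolding ennreal_divide_times using p by (subst ennreal_divide_self) simp_all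
  ultimately show ?thesis by simp
qed

lemma emeasure_UNIV_le_morrey_norm_0:
  fixes \<nu> :: "(real^'n) measure"
  assumes sets: "sets \<nu> = sets borel"
  shows "emeasure \<nu> UNIV \<le> morrey_norm 0 \<nu>"
proof -
  have "(\<Union>n. ball 0 (real (Suc n)) :: (real^'n) set) = UNIV"
  proof -
    have "\<exists>n. norm x < real (Suc n)" for x :: "real^'n"
      by (meson less_SucI less_eq_real_def of_nat_less_iff order.strict_trans reals_Archimedean2 lessI)
    then show ?thesis by auto
  qed
  then have "emeasure \<nu> UNIV = (SUP n. emeasure \<nu> (ball 0 (real (Suc n))))"
    by (subst SUP_emeasure_incseq) (auto simp: sets incseq_def)
  also have "\<dots> \<le> morrey_norm 0 \<nu>"
  proof (rule SUP_least)
    show "emeasure \<nu> (ball 0 (real (Suc n))) \<le> morrey_norm 0 \<nu>" for n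
      using emeasure_ball_le_morrey_norm[of "real (Suc n)" \<nu> 0 0] by simp
  qed
  finally show ?thesis .
qed

theorem theorem1p4:
  fixes \<alpha> c :: real
  assumes "real CARD('n::finite) - 1 < \<alpha>" and "\<alpha> \<le> real CARD('n)" and "0 < c"
  shows "\<exists>C>0. \<forall>F \<in> (bounded_vector_measures :: ((real^'n) set \<Rightarrow> real^'n) set).
           \<forall>\<nu> :: (real^'n) measure.
             divergence_free F \<longrightarrow> radon_measure \<nu> \<longrightarrow>
             morrey_norm (real CARD('n) - \<alpha>) \<nu> < \<infinity> \<longrightarrow>
             (\<integral>\<^sup>+ x. ennreal (norm (riesz_potential c \<alpha> F x)) \<partial>\<nu>)
               \<le> ennreal C * morrey_norm (real CARD('n) - \<alpha>) \<nu> * total_variation F UNIV"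
proof -
  have TV: "total_variation F UNIV = ennreal (measure (variation_measure F) UNIV)"
    if F: "F \<in> bounded_vector_measures" for F :: "(real^'n) set \<Rightarrow> real^'n"
  proof -
    interpret finite_measure "variation_measure F" by (rule finite_measure_variation[OF F])
    have "vector_measure F" using F unfolding bounded_vector_measures_def by blast
    from emeasure_variation_measure[OF this, of UNIV] show ?thesis by (simp add: emeasure_eq_measure)
  qed
  show ?thesis
  proof (cases "\<alpha> = real CARD('n)")
    case True
    show ?thesis
    proof (intro exI[of _ "real CARD('n) * (c * (4 * real CARD('n)))"] conjI ballI allI impI)
      show "0 < real CARD('n) * (c * (4 * real CARD('n)))" using assms by simp
      fix F :: "(real^'n) set \<Rightarrow> real^'n" and \<nu> :: "(real^'n) measure"
      assume F: "F \<in> bounded_vector_measures" "divergence_free F" and \<nu>: "radon_measure \<nu>"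
      interpret solenoidal_measure F by unfold_locales (rule F)+
      let ?K = "real CARD('n) * (c * (4 * real CARD('n) * measure V UNIV))"
      have "(\<integral>\<^sup>+ x. ennreal (norm (riesz_potential c \<alpha> F x)) \<partial>\<nu>) \<le> (\<integral>\<^sup>+ x. ennreal ?K \<partial>\<nu>)"
        unfolding True by (intro nn_integral_mono ennreal_leI riesz_potential_log_bound assms)
      also have "\<dots> = ennreal ?K * emeasure \<nu> UNIV"
        using \<nu> sets_eq_imp_space_eq[of \<nu> borel] by (simp add: radon_measure_def)
      also have "\<dots> \<le> ennreal ?K * morrey_norm 0 \<nu>"
        using \<nu> by (intro mult_left_mono emeasure_UNIV_le_morrey_norm_0) (auto simp: radon_measure_def)
      also have "ennreal ?K = ennreal (real CARD('n) * (c * (4 * real CARD('n)))) * total_variation F UNIV"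
        unfolding TV[OF F(1)] using assms(3) by (subst ennreal_mult[symmetric]) (auto simp: mult_ac)
      finally show "(\<integral>\<^sup>+ x. ennreal (norm (riesz_potential c \<alpha> F x)) \<partial>\<nu>)
          \<le> ennreal (real CARD('n) * (c * (4 * real CARD('n)))) * morrey_norm (real CARD('n) - \<alpha>) \<nu> * total_variation F UNIV"
        using True by (simp add: mult_ac)
    qed
  next
    case False
    then have \<alpha>: "\<alpha> < real CARD('n)" using assms by simp
    have "1 \<le> CARD('n)" by (simp add: Suc_le_eq)
    then have \<alpha>0: "0 < \<alpha>" using assms by linarith
    define \<beta> where "\<beta> = real CARD('n) - \<alpha>"
    have \<beta>: "0 < \<beta>" "\<beta> < 1" using assms \<alpha> by (auto simp: \<beta>_def)
    define A where "A = Gamma ((real CARD('n) - \<alpha>) / 2) / (pi powr (real CARD('n) / 2) * 2 powr \<alpha> * Gamma (\<alpha> / 2))"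
    have A: "0 < A" unfolding A_def using \<alpha> \<alpha>0 by (intro divide_pos_pos mult_pos_pos Gamma_real_pos) auto
    define C where "C = real CARD('n) * (A * (16 * real CARD('n) * (30 / (1 - \<beta>) + 6)))"
    have C: "0 < C" unfolding C_def using A \<beta> by (intro mult_pos_pos add_pos_pos divide_pos_pos) auto
    show ?thesis
    proof (intro exI[of _ C] conjI C ballI allI impI)
      fix F :: "(real^'n) set \<Rightarrow> real^'n" and \<nu> :: "(real^'n) measure"
      assume F: "F \<in> bounded_vector_measures" "divergence_free F" and \<nu>: "radon_measure \<nu>"
        and fin: "morrey_norm (real CARD('n) - \<alpha>) \<nu> < \<infinity>"
      interpret solenoidal_measure F by unfold_locales (rule F)+
      define M where "M = enn2real (morrey_norm (real CARD('n) - \<alpha>) \<nu>)"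
      have M: "morrey_norm (real CARD('n) - \<alpha>) \<nu> = ennreal M" "0 \<le> M"
        using fin by (auto simp: M_def less_top)
      have "(\<integral>\<^sup>+x. ennreal (norm (riesz_potential c \<alpha> F x)) \<partial>\<nu>) \<le>
          ennreal (real CARD('n) * (A * (16 * real CARD('n) * (30 / (1 - (real CARD('n) - \<alpha>)) + 6) * M * measure V UNIV)))"
        unfolding A_def
      proof (rule trace_inequality_power[OF assms(1) \<alpha> _ M(2)])
        show "sets \<nu> = sets borel" using \<nu> by (simp add: radon_measure_def)
      next
        show "emeasure \<nu> (ball x r) \<le> ennreal (M * r powr (real CARD('n) - \<alpha>))" if "0 < r" for x r
          using emeasure_ball_le_morrey_norm[OF that, of \<nu> x "real CARD('n) - \<alpha>"] M
          by (simp add: ennreal_mult)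
      qed
      also have "\<dots> = ennreal (C * M * measure V UNIV)" by (simp add: C_def \<beta>_def mult_ac)
      also have "\<dots> = ennreal C * ennreal M * ennreal (measure V UNIV)"
        using C M(2) by (simp add: ennreal_mult)
      finally show "(\<integral>\<^sup>+x. ennreal (norm (riesz_potential c \<alpha> F x)) \<partial>\<nu>)
          \<le> ennreal C * morrey_norm (real CARD('n) - \<alpha>) \<nu> * total_variation F UNIV"
        unfolding TV[OF F(1)] M(1) .
    qed
  qed
qed

end
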